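(* Let $R$ be a commutative ring with unity, let $q\in R$ be invertible, and assume that $q-1$ is not invertible in the subring $R_q:=\langle q,q^{-1}\rangle$ of $R$ generated by $q$ and $q^{-1}$. Let $\mathcal{O}_q^{R}(M_n)$, $\mathcal{O}_q^{R}(GL_n)$, $\mathcal{O}_q^{R}(SL_n)$ and $D_q$ be as in the context. For a fixed total order on $\{1,\dots,n\}^{\times 2}$, an "ordered monomial" $\prod_{i,j=1}^n t_{i,j}^{N_{i,j}}$ means the product of the powers $t_{i,j}^{N_{i,j}}$ taken in increasing order of $(i,j)$ with respect to that total order. (a) Fix any total order on $\{1,\dots,n\}^{\times 2}$. Then: the set $B_M:=\{\prod_{i,j=1}^n t_{i,j}^{N_{i,j}} : N_{i,j}\in\mathbb{N}\ \forall i,j\}$ is an $R$-basis of $\mathcal{O}_q^{R}(M_n)$; each of the sets $B_{GL}^{\wedge}:=\{\prod_{i,j=1}^n t_{i,j}^{N_{i,j}}\,D_q^{-N} : N,N_{i,j}\in\mathbb{N}\ \forall i,j;\ \min(\{N_{i,i}\}_{1\le i\le n}\cup\{N\})=0\}$ and $B_{GL}^{\vee}:=\{\prod_{i,j=1}^n t_{i,j}^{N_{i,j}}\,D_q^{Z} : Z\in\mathbb{Z},\ N_{i,j}\in\mathbb{N}\ \forall i,j;\ \min\{N_{i,i}\}_{1\le i\le n}=0\}$ is an $R$-basis of $\mathcal{O}_q^{R}(GL_n)$; the set $B_{SL}:=\{\prod_{i,j=1}^n t_{i,j}^{N_{i,j}} : N_{i,j}\in\mathbb{N}\ \forall i,j;\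 \min\{N_{i,i}\}_{1\le i\le n}=0\}$ is an $R$-basis of $\mathcal{O}_q^{R}(SL_n)$. (b) Let $\preceq$ be any total order on $\{1,\dots,n\}^{\times 2}$ such that $(i,j)\preceq(h,k)\preceq(l,m)$ whenever $j>n+1-i$, $k=n+1-h$, $m<n+1-l$. With ordered monomials taken with respect to $\preceq$: each of the sets $B_{GL}^{\wedge,-}:=\{\prod_{i,j=1}^n t_{i,j}^{N_{i,j}}\,D_q^{-N} : N,N_{i,j}\in\mathbb{N}\ \forall i,j;\ \min(\{N_{i,n+1-i}\}_{1\le i\le n}\cup\{N\})=0\}$ and $B_{GL}^{\vee,-}:=\{\prod_{i,j=1}^n t_{i,j}^{N_{i,j}}\,D_q^{Z} : Z\in\mathbb{Z},\ N_{i,j}\in\mathbb{N}\ \forall i,j;\ \min\{N_{i,n+1-i}\}_{1\le i\le n}=0\}$ is an $R$-basis of $\mathcal{O}_q^{R}(GL_n)$; the set $B_{SL}^{-}:=\{\prod_{i,j=1}^n t_{i,j}^{N_{i,j}} : N_{i,j}\in\mathbb{N}\ \forall i,j;\ \min\{N_{i,n+1-i}\}_{1\le i\le n}=0\}$ is an $R$-basis of $\mathcal{O}_q^{R}(SL_n)$.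
   Context: For a commutative unital ring $R$ and invertible $q\in R$, $\mathcal{O}_q^{R}(M_n)$ is the unital associative $R$-algebra with generators $t_{i,j}$ ($i,j=1,\dots,n$) and relations $t_{i,j}t_{i,k}=q\,t_{i,k}t_{i,j}$ and $t_{i,k}t_{h,k}=q\,t_{h,k}t_{i,k}$ for all $j<k$, $i<h$; $t_{i,l}t_{j,k}=t_{j,k}t_{i,l}$ and $t_{i,k}t_{j,l}-t_{j,l}t_{i,k}=(q-q^{-1})\,t_{i,l}t_{j,k}$ for all $i<j$, $k<l$. The quantum determinant is $D_q:=\sum_{\sigma\in S_n}(-q)^{\ell(\sigma)}t_{1,\sigma(1)}t_{2,\sigma(2)}\cdots t_{n,\sigma(n)}$, where $\ell(\sigma)$ is the length of $\sigma$ in the symmetric group $S_n$; it is central in $\mathcal{O}_q^{R}(M_n)$. Define $\mathcal{O}_q^{R}(GL_n):=\mathcal{O}_q^{R}(M_n)[D_q^{-1}]$ (adjoining a formal inverse of the central element $D_q$) and $\mathcal{O}_q^{R}(SL_n):=\mathcal{O}_q^{R}(M_n)/(D_q-1)$; in the latter two algebras $t_{i,j}$ denotes the image of the generator $t_{i,j}$. $\mathbb{N}=\{0,1,2,\dots\}$. *)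

theory Defs
  imports Main "HOL-Library.Poly_Mapping" "HOL-Combinatorics.Permutations"
begin

text \<open>The free associative unital algebra over 'a on generator type 'g:
  finitely supported functions from words (lists of generators) to 'a;
  multiplication is concatenation of words, extended bilinearly.\<close>

type_synonym ('g, 'a) fralg = "'g list \<Rightarrow>\<^sub>0 'a"

definition fa_word :: "'g list \<Rightarrow> ('g, 'a::comm_ring_1) fralg" where
  "fa_word w = Poly_Mapping.single w 1"

definition fa_gen :: "'g \<Rightarrow> ('g, 'a::comm_ring_1) fralg" where
  "fa_gen g = fa_word [g]"

definition fa_one :: "('g, 'a::comm_ring_1) fralg" where
  "fa_one = fa_word []"

definition fa_scal :: "'a::comm_ring_1 \<Rightarrow> ('g, 'a) fralg \<Rightarrow> ('g, 'a) fralg" where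
  "fa_scal c p = Poly_Mapping.map (\<lambda>x. c * x) p"

definition fa_mul :: "('g, 'a::comm_ring_1) fralg \<Rightarrow> ('g, 'a) fralg \<Rightarrow> ('g, 'a) fralg" where
  "fa_mul p q = (\<Sum>u\<in>Poly_Mapping.keys p. \<Sum>v\<in>Poly_Mapping.keys q. Poly_Mapping.single (u @ v) (Poly_Mapping.lookup p u * Poly_Mapping.lookup q v))"

definition fa_pow :: "('g, 'a::comm_ring_1) fralg \<Rightarrow> nat \<Rightarrow> ('g, 'a) fralg" where
  "fa_pow p k = ((fa_mul p) ^^ k) fa_one"

definition fa_on :: "'g set \<Rightarrow> ('g, 'a::comm_ring_1) fralg set" where
  "fa_on G = {p. \<forall>w\<in>Poly_Mapping.keys p. set w \<subseteq> G}"

inductive_set fa_ideal :: "'g set \<Rightarrow> ('g, 'a::comm_ring_1) fralg set \<Rightarrow> ('g, 'a) fralg set"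
  for G S where
  gen: "r \<in> S \<Longrightarrow> r \<in> fa_ideal G S"
| zero: "0 \<in> fa_ideal G S"
| add: "x \<in> fa_ideal G S \<Longrightarrow> y \<in> fa_ideal G S \<Longrightarrow> x + y \<in> fa_ideal G S"
| mult: "x \<in> fa_ideal G S \<Longrightarrow> set u \<subseteq> G \<Longrightarrow> set v \<subseteq> G \<Longrightarrow>
           fa_scal c (fa_mul (fa_word u) (fa_mul x (fa_word v))) \<in> fa_ideal G S"

text \<open>The family b (indexed by I) of elements of the free algebra on G maps to an
  R-basis (R = 'a) of the algebra presented by generators G and relations S,
  i.e. of the quotient of the free algebra on G by the two-sided ideal generated by S.\<close>
definition pres_basis ::
  "'g set \<Rightarrow> ('g, 'a::comm_ring_1) fralg set \<Rightarrow> ('i \<Rightarrow> ('g, 'a) fralg) \<Rightarrow> 'i set \<Rightarrow> bool" where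
  "pres_basis G S b I \<longleftrightarrow>
     (\<forall>i\<in>I. b i \<in> fa_on G) \<and>
     (\<forall>p\<in>fa_on G. \<exists>J c. finite J \<and> J \<subseteq> I \<and>
          p - (\<Sum>i\<in>J. fa_scal (c i) (b i)) \<in> fa_ideal G S) \<and>
     (\<forall>J c. finite J \<longrightarrow> J \<subseteq> I \<longrightarrow>
          (\<Sum>i\<in>J. fa_scal (c i) (b i)) \<in> fa_ideal G S \<longrightarrow> (\<forall>i\<in>J. c i = 0))"

inductive_set gen_subring :: "'a::comm_ring_1 set \<Rightarrow> 'a set" for A where
  base: "x \<in> A \<Longrightarrow> x \<in> gen_subring A"
| one: "1 \<in> gen_subring A"
| add: "x \<in> gen_subring A \<Longrightarrow> y \<in> gen_subring A \<Longrightarrow> x + y \<in> gen_subring A"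
| neg: "x \<in> gen_subring A \<Longrightarrow> - x \<in> gen_subring A"
| mul: "x \<in> gen_subring A \<Longrightarrow> y \<in> gen_subring A \<Longrightarrow> x * y \<in> gen_subring A"

definition idx :: "nat \<Rightarrow> (nat \<times> nat) set" where
  "idx n = {1..n} \<times> {1..n}"

definition perm_length :: "nat \<Rightarrow> (nat \<Rightarrow> nat) \<Rightarrow> nat" where
  "perm_length n \<sigma> = card {(i, j). i \<in> {1..n} \<and> j \<in> {1..n} \<and> i < j \<and> \<sigma> j < \<sigma> i}"

definition tq :: "(nat \<times> nat \<Rightarrow> 'g) \<Rightarrow> nat \<Rightarrow> nat \<Rightarrow> ('g, 'a::comm_ring_1) fralg" where
  "tq emb i j = fa_gen (emb (i, j))"

text \<open>Defining relations of O_q(M_n) (each element r stands for the relation r = 0); qi = q^{-1}.\<close>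
definition qmat_rels :: "nat \<Rightarrow> 'a::comm_ring_1 \<Rightarrow> 'a \<Rightarrow> (nat \<times> nat \<Rightarrow> 'g) \<Rightarrow> ('g, 'a) fralg set" where
  "qmat_rels n q qi emb =
     {fa_mul (tq emb i j) (tq emb i k) - fa_scal q (fa_mul (tq emb i k) (tq emb i j)) | i j k.
        i \<in> {1..n} \<and> j \<in> {1..n} \<and> k \<in> {1..n} \<and> j < k}
   \<union> {fa_mul (tq emb i k) (tq emb h k) - fa_scal q (fa_mul (tq emb h k) (tq emb i k)) | i h k.
        i \<in> {1..n} \<and> h \<in> {1..n} \<and> k \<in> {1..n} \<and> i < h}
   \<union> {fa_mul (tq emb i l) (tq emb j k) - fa_mul (tq emb j k) (tq emb i l) | i j k l.
        i \<in> {1..n} \<and> j \<in> {1..n} \<and> k \<in> {1..n} \<and> l \<in> {1..n} \<and> i < j \<and> k < l}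
   \<union> {fa_mul (tq emb i k) (tq emb j l) - fa_mul (tq emb j l) (tq emb i k)
        - fa_scal (q - qi) (fa_mul (tq emb i l) (tq emb j k)) | i j k l.
        i \<in> {1..n} \<and> j \<in> {1..n} \<and> k \<in> {1..n} \<and> l \<in> {1..n} \<and> i < j \<and> k < l}"

definition qdet :: "nat \<Rightarrow> 'a::comm_ring_1 \<Rightarrow> (nat \<times> nat \<Rightarrow> 'g) \<Rightarrow> ('g, 'a) fralg" where
  "qdet n q emb = (\<Sum>\<sigma>\<in>{\<sigma>. \<sigma> permutes {1..n}}.
      fa_scal ((- q) ^ perm_length n \<sigma>) (fa_word (map (\<lambda>i. emb (i, \<sigma> i)) [1..<n+1])))"

definition GM :: "nat \<Rightarrow> (nat \<times> nat) set" where "GM n = idx n"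
definition RM :: "nat \<Rightarrow> 'a::comm_ring_1 \<Rightarrow> 'a \<Rightarrow> (nat \<times> nat, 'a) fralg set" where
  "RM n q qi = qmat_rels n q qi id"

text \<open>O_q(GL_n) = O_q(M_n)[D_q^{-1}]: generators Some (i,j) = t_(i,j) and None = D_q^{-1},
  relations of O_q(M_n) together with D_q^{-1} D_q = 1 = D_q D_q^{-1}.\<close>
definition GGL :: "nat \<Rightarrow> (nat \<times> nat) option set" where "GGL n = Some ` idx n \<union> {None}"
definition Dinv :: "((nat \<times> nat) option, 'a::comm_ring_1) fralg" where "Dinv = fa_gen None"
definition RGL :: "nat \<Rightarrow> 'a::comm_ring_1 \<Rightarrow> 'a \<Rightarrow> ((nat \<times> nat) option, 'a) fralg set" where
  "RGL n q qi = qmat_rels n q qi Some \<union>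
     {fa_mul Dinv (qdet n q Some) - fa_one, fa_mul (qdet n q Some) Dinv - fa_one}"

definition GSL :: "nat \<Rightarrow> (nat \<times> nat) set" where "GSL n = idx n"
definition RSL :: "nat \<Rightarrow> 'a::comm_ring_1 \<Rightarrow> 'a \<Rightarrow> (nat \<times> nat, 'a) fralg set" where
  "RSL n q qi = qmat_rels n q qi id \<union> {qdet n q id - fa_one}"

definition sorted_enum :: "('b \<times> 'b) set \<Rightarrow> 'b set \<Rightarrow> 'b list" where
  "sorted_enum r A = (THE xs. set xs = A \<and> distinct xs \<and> sorted_wrt (\<lambda>x y. (x, y) \<in> r) xs)"

definition mono_word :: "('b \<times> 'b) set \<Rightarrow> 'b set \<Rightarrow> ('b \<Rightarrow> nat) \<Rightarrow> 'b list" where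
  "mono_word r A N = concat (map (\<lambda>p. replicate (N p) p) (sorted_enum r A))"

definition expo :: "nat \<Rightarrow> (nat \<times> nat \<Rightarrow> nat) set" where
  "expo n = {N. \<forall>p. p \<notin> idx n \<longrightarrow> N p = 0}"

definition Dpow :: "nat \<Rightarrow> 'a::comm_ring_1 \<Rightarrow> int \<Rightarrow> ((nat \<times> nat) option, 'a) fralg" where
  "Dpow n q Z = (if 0 \<le> Z then fa_pow (qdet n q Some) (nat Z) else fa_pow Dinv (nat (- Z)))"

definition monoM :: "nat \<Rightarrow> (nat \<times> nat) rel \<Rightarrow> (nat \<times> nat \<Rightarrow> nat) \<Rightarrow> (nat \<times> nat, 'a::comm_ring_1) fralg" where
  "monoM n r N = fa_word (mono_word r (idx n) N)"

definition monoGL :: "nat \<Rightarrow> (nat \<times> nat) rel \<Rightarrow> (nat \<times> nat \<Rightarrow> nat) \<Rightarrow> ((nat \<times> nat) option, 'a::comm_ring_1) fralg" where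
  "monoGL n r N = fa_word (map Some (mono_word r (idx n) N))"

end

theory Submission
  imports Defs "HOL-Library.Product_Lexorder" "HOL-Combinatorics.Multiset_Permutations"
begin

text \<open>The relations, solved for lexicographically decreasing products of two letters, form a confluent
  rewriting system, so the lexicographically ordered monomials are a basis of the quantum matrix
  algebra, and left multiplication on normal forms represents it faithfully. Exchanging columns of
  two letters lowers \<open>\<Sum> i * j\<close>, hence reordering a monomial costs a unit and terms of lower weight, and
  every total order yields a basis by a unitriangular change of basis.

  The determinant \<open>D\<close> is the product of the rows in a quantum exterior algebra; Laplace expansion along
  rows and along columns shows that the quantum adjugate is a two-sided inverse up to \<open>D\<close>, so \<open>D\<close> is
  central. For part (a) the leading term of \<open>D\<close> with respect to the weight is the diagonal monomial. For
  part (b) one expands \<open>D\<close> with the rows in reverse order and filters by the number of antidiagonal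
  letters: the leading term is the antidiagonal monomial. In both cases multiplication by \<open>D\<close> adds the
  leading exponent up to lower terms, so the quantum matrix algebra is free over the polynomials in \<open>D\<close>
  on the monomials in which the leading monomial does not divide; localising at \<open>D\<close> and setting
  \<open>D = 1\<close> give the remaining bases.\<close>

text \<open>The coefficient ring may have zero divisors, so bases cannot be compared by dimension or
  by nonzero leading coefficients. Every comparison is arranged to have a unit as leading
  coefficient, which is the reason for the pairs u, u' with u' * u = 1 throughout. The quotient
  algebras are not types: congruences are kept as membership in an ideal, or in a span that contains
  the ideal, and identities that need an actual ring are proved for operators on normal forms and
  then evaluated at 1. The antidiagonal case cannot reuse the weight of the diagonal case: the
  antidiagonal term of D has the smallest \<open>stat\<close>, so it is never leading for it. The
  count of antidiagonal letters replaces it. This relies on orders that put the letters below, on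
  and above the antidiagonal into consecutive blocks, and on multiplying the rows of D in decreasing
  order, because then letters in the wrong order of blocks commute exactly. As GL_n is given by
  generators and relations, inverting D has to be shown to create no new relations: multiplication
  by a high power of D brings any relation back to the quantum matrix algebra.\<close>

section \<open>Free algebras and presentations\<close>

text \<open>\<open>Poly_Mapping\<close> multiplies by convolution over an additive monoid. With
  concatenation as the addition of words, \<open>fralg\<close> becomes the free algebra as a
  ready-made noncommutative ring, and \<open>fa_mul_eq\<close> identifies \<open>fa_mul\<close> with
  its product.\<close>

instantiation list :: (type) monoid_add
begin
definition zero_list :: "'a list" where "zero_list = []"
definition plus_list :: "'a list \<Rightarrow> 'a list \<Rightarrow> 'a list" where "plus_list = (@)"
instance by standard (simp_all add: zero_list_def plus_list_def)
end

text \<open>Scalars enter as multiples of the empty word, so that \<open>fa_scal\<close> turns into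
  a product with a central ring element.\<close>

definition sc :: "'a::comm_ring_1 \<Rightarrow> ('g, 'a) fralg" where
  "sc c = Poly_Mapping.single [] c"

lemma sc_add: "sc (a + b) = sc a + sc b"
  by (simp add: sc_def single_add)
lemma sc_mult: "sc (a * b) = sc a * sc b"
  by (simp add: sc_def mult_single plus_list_def)
lemma sc_0 [simp]: "sc 0 = 0" by (simp add: sc_def)
lemma sc_1 [simp]: "sc 1 = 1" by (simp add: sc_def flip: zero_list_def)
lemma sc_uminus: "sc (- a) = - sc a" by (simp add: sc_def single_uminus)
lemma sc_diff: "sc (a - b) = sc a - sc b" by (simp add: sc_def single_diff)
lemma poly_mapping_sum_single:
  "(p :: 'b \<Rightarrow>\<^sub>0 'a::comm_ring_1) = (\<Sum>k\<in>Poly_Mapping.keys p. Poly_Mapping.single k (Poly_Mapping.lookup p k))"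
  by (rule poly_mapping_eqI)
     (simp add: lookup_sum lookup_single when_def in_keys_iff sum.delta' if_distrib)

lemma fa_word_0 [simp]: "fa_word [] = 1"
  by (simp add: fa_word_def flip: zero_list_def)
lemma fa_word_append: "fa_word (u @ v) = fa_word u * fa_word v"
  by (simp add: fa_word_def mult_single plus_list_def)
lemma fa_word_Cons: "fa_word (a # v) = fa_word [a] * fa_word v"
  using fa_word_append[of "[a]" v] by simp

lemma sc_word: "sc c * fa_word w = Poly_Mapping.single w c"
  by (simp add: sc_def fa_word_def mult_single plus_list_def)

lemma fralg_expand:
  "p = (\<Sum>w\<in>Poly_Mapping.keys p. sc (Poly_Mapping.lookup p w) * fa_word w)"
  unfolding sc_word by (rule poly_mapping_sum_single)

lemma sc_central: "sc c * p = p * sc c"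
proof -
  have "sc c * (\<Sum>w\<in>Poly_Mapping.keys p. sc (Poly_Mapping.lookup p w) * fa_word w)
     = (\<Sum>w\<in>Poly_Mapping.keys p. sc (Poly_Mapping.lookup p w) * fa_word w) * sc c"
    unfolding sum_distrib_left sum_distrib_right
    by (rule sum.cong) (simp_all add: sc_word, simp_all add: sc_def mult_single plus_list_def mult.commute)
  then show ?thesis using fralg_expand[of p] by simp
qed

lemma sc_left_commute: "p * (sc c * x) = sc c * (p * x)"
  by (metis mult.assoc sc_central)

lemma lookup_sc_mult: "Poly_Mapping.lookup (sc c * p) w = c * Poly_Mapping.lookup p w"
proof -
  have "Poly_Mapping.map ((*) c) p = sc c * p"
    using mult_map_scale_conv_mult[of c p] by (simp add: sc_def zero_list_def)
  moreover have "Poly_Mapping.lookup (Poly_Mapping.map ((*) c) p) w = c * Poly_Mapping.lookup p w"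
    by (simp add: map.rep_eq when_def)
  ultimately show ?thesis by simp
qed

lemma fa_scal_eq: "fa_scal c p = sc c * p"
  unfolding fa_scal_def using mult_map_scale_conv_mult[of c p] by (simp add: sc_def zero_list_def)

lemma fa_mul_eq: "fa_mul p q = p * q"
proof -
  have "p * q = (\<Sum>u\<in>Poly_Mapping.keys p. Poly_Mapping.single u (Poly_Mapping.lookup p u)) *
     (\<Sum>v\<in>Poly_Mapping.keys q. Poly_Mapping.single v (Poly_Mapping.lookup q v))"
    using poly_mapping_sum_single[of p] poly_mapping_sum_single[of q] by simp
  also have "\<dots> = fa_mul p q"
    unfolding sum_distrib_right sum_distrib_left fa_mul_def
    by (simp add: mult_single plus_list_def) (rule sum.swap)
  finally show ?thesis by simp
qed

lemma fa_one_eq: "fa_one = 1" by (simp add: fa_one_def)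
lemma fa_pow_eq: "fa_pow p k = p ^ k"
  by (induction k) (simp_all add: fa_pow_def fa_one_eq fa_mul_eq)

lemmas fa_simps = fa_scal_eq fa_mul_eq fa_one_eq fa_pow_eq

lemma fa_on_word [simp]: "fa_word w \<in> fa_on G \<longleftrightarrow> set w \<subseteq> G"
  by (auto simp: fa_on_def fa_word_def)
lemma fa_on_0 [simp]: "0 \<in> fa_on G" by (simp add: fa_on_def)
lemma fa_on_1 [simp]: "1 \<in> fa_on G" by (simp add: fa_on_def zero_list_def)
lemma fa_on_sc [simp]: "sc c \<in> fa_on G" by (simp add: fa_on_def sc_def)
lemma fa_on_add [intro]: "p \<in> fa_on G \<Longrightarrow> p' \<in> fa_on G \<Longrightarrow> p + p' \<in> fa_on G"
  using keys_add[of p p'] by (fastforce simp: fa_on_def)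
lemma fa_on_mult [intro]: "p \<in> fa_on G \<Longrightarrow> p' \<in> fa_on G \<Longrightarrow> p * p' \<in> fa_on G"
  using keys_mult[of p p'] by (fastforce simp: fa_on_def plus_list_def)
lemma fa_on_uminus [intro]: "p \<in> fa_on G \<Longrightarrow> - p \<in> fa_on G"
  by (simp add: fa_on_def in_keys_iff)
lemma fa_on_diff [intro]: "p \<in> fa_on G \<Longrightarrow> p' \<in> fa_on G \<Longrightarrow> p - p' \<in> fa_on G"
  using fa_on_add[of p G "- p'"] fa_on_uminus[of p' G] by simp
lemma fa_on_sum [intro]: "(\<And>x. x \<in> A \<Longrightarrow> f x \<in> fa_on G) \<Longrightarrow> sum f A \<in> fa_on G"
  by (induction A rule: infinite_finite_induct) auto
lemma fa_on_power [intro]: "p \<in> fa_on G \<Longrightarrow> p ^ k \<in> fa_on G"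
  by (induction k) auto

lemma fa_on_induct [consumes 1, case_names zero add word]:
  assumes "p \<in> fa_on G" "P 0" "\<And>x y. P x \<Longrightarrow> P y \<Longrightarrow> P (x + y)"
    "\<And>c w. set w \<subseteq> G \<Longrightarrow> P (sc c * fa_word w)"
  shows "P p"
proof -
  have "P (\<Sum>w\<in>K. sc (Poly_Mapping.lookup p w) * fa_word w)"
    if "finite K" "K \<subseteq> Poly_Mapping.keys p" for K
    using that
  proof (induction K rule: finite_induct)
    case (insert x K)
    then have "set x \<subseteq> G" using assms(1) by (auto simp: fa_on_def)
    with insert assms(3,4) show ?case by simp
  qed (simp add: assms(2))
  from this[of "Poly_Mapping.keys p"] show ?thesis using fralg_expand[of p] by simp
qed

subsection \<open>Ideals and spans\<close>

lemma fa_ideal_mult: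
  assumes x: "x \<in> fa_ideal G S" and p: "p \<in> fa_on G" and p': "p' \<in> fa_on G"
  shows "p * x * p' \<in> fa_ideal G S"
  using p
proof (induction rule: fa_on_induct)
  case (word c w)
  show ?case using p'
  proof (induction rule: fa_on_induct)
    case (word c' w')
    have "fa_scal (c * c') (fa_mul (fa_word w) (fa_mul x (fa_word w'))) \<in> fa_ideal G S"
      using x \<open>set w \<subseteq> G\<close> \<open>set w' \<subseteq> G\<close> by (rule fa_ideal.mult)
    moreover have "fa_scal (c * c') (fa_mul (fa_word w) (fa_mul x (fa_word w')))
       = sc c * fa_word w * x * (sc c' * fa_word w')"
      by (simp add: fa_simps sc_mult mult.assoc sc_left_commute[of "fa_word w"] sc_left_commute[of x])
    ultimately show ?case by simp
  qed (auto intro: fa_ideal.zero fa_ideal.add simp: distrib_left distrib_right)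
qed (auto intro: fa_ideal.zero fa_ideal.add simp: distrib_left distrib_right)

lemma fa_ideal_mult_left: "x \<in> fa_ideal G S \<Longrightarrow> p \<in> fa_on G \<Longrightarrow> p * x \<in> fa_ideal G S"
  using fa_ideal_mult[of x G S p 1] by simp
lemma fa_ideal_mult_right: "x \<in> fa_ideal G S \<Longrightarrow> p \<in> fa_on G \<Longrightarrow> x * p \<in> fa_ideal G S"
  using fa_ideal_mult[of x G S 1 p] by simp
lemma fa_ideal_sc: "x \<in> fa_ideal G S \<Longrightarrow> sc c * x \<in> fa_ideal G S"
  by (rule fa_ideal_mult_left) simp_all
lemma fa_ideal_uminus: "x \<in> fa_ideal G S \<Longrightarrow> - x \<in> fa_ideal G S"
  using fa_ideal_sc[of x G S "-1"] by (simp add: sc_uminus)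
lemma fa_ideal_diff: "x \<in> fa_ideal G S \<Longrightarrow> y \<in> fa_ideal G S \<Longrightarrow> x - y \<in> fa_ideal G S"
  using fa_ideal.add[of x G S "- y"] fa_ideal_uminus[of y] by simp

lemma fa_ideal_minimal:
  assumes "x \<in> fa_ideal G S" "\<And>s. s \<in> S \<Longrightarrow> s \<in> fa_ideal G S'"
  shows "x \<in> fa_ideal G S'"
  using assms(1)
proof induction
  case (mult x u v c)
  then show ?case by (intro fa_ideal.mult)
qed (auto intro: fa_ideal.zero fa_ideal.add assms(2))

lemma fa_ideal_mono:
  assumes "x \<in> fa_ideal G S" "G \<subseteq> G'" "S \<subseteq> S'"
  shows "x \<in> fa_ideal G' S'"
  using assms(1)
proof induction
  case (gen r)
  then show ?case using assms by (auto intro: fa_ideal.gen)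
next
  case (mult x u v c)
  then show ?case using assms by (intro fa_ideal.mult) auto
qed (auto intro: fa_ideal.zero fa_ideal.add)

text \<open>An inductive span lets linear arguments run by induction without index sets;
  \<open>lspan_image_sum\<close> recovers a finite sum at the end. Congruence modulo an ideal is
  expressed by adding the ideal to the spanning set, and \<open>lspan_Un_ideal\<close> separates the
  two parts again.\<close>

inductive_set lspan :: "('g, 'a::comm_ring_1) fralg set \<Rightarrow> ('g, 'a) fralg set" for X where
  zero: "0 \<in> lspan X"
| step: "x \<in> X \<Longrightarrow> y \<in> lspan X \<Longrightarrow> sc c * x + y \<in> lspan X"

lemma lspan_base: "x \<in> X \<Longrightarrow> x \<in> lspan X"
  using lspan.step[of x X 0 1] lspan.zero[of X] by simp
lemma lspan_add: "x \<in> lspan X \<Longrightarrow> y \<in> lspan X \<Longrightarrow> x + y \<in> lspan X"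
  by (induction rule: lspan.induct) (auto simp: add.assoc intro: lspan.intros)
lemma lspan_sc: "x \<in> lspan X \<Longrightarrow> sc c * x \<in> lspan X"
proof (induction rule: lspan.induct)
  case (step x y d)
  then show ?case using lspan.step[of x X "sc c * y" "c * d"]
    by (simp add: distrib_left sc_mult mult.assoc)
qed (simp add: lspan.zero)
lemma lspan_uminus: "x \<in> lspan X \<Longrightarrow> - x \<in> lspan X"
  using lspan_sc[of x X "-1"] by (simp add: sc_uminus)
lemma lspan_diff: "x \<in> lspan X \<Longrightarrow> y \<in> lspan X \<Longrightarrow> x - y \<in> lspan X"
  using lspan_add[of x X "- y"] lspan_uminus[of y] by simp
lemma lspan_sum: "(\<And>a. a \<in> A \<Longrightarrow> f a \<in> lspan X) \<Longrightarrow> sum f A \<in> lspan X"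
  by (induction A rule: infinite_finite_induct) (auto intro: lspan.zero lspan_add)
lemma lspan_minimal: "x \<in> lspan X \<Longrightarrow> (\<And>x. x \<in> X \<Longrightarrow> x \<in> lspan Y) \<Longrightarrow> x \<in> lspan Y"
  by (induction rule: lspan.induct) (auto intro: lspan.zero lspan_add lspan_sc)
lemma lspan_mono: "x \<in> lspan X \<Longrightarrow> X \<subseteq> Y \<Longrightarrow> x \<in> lspan Y"
  by (rule lspan_minimal[of x X Y]) (auto intro: lspan_base)
lemma lspan_map:
  assumes "x \<in> lspan X" "\<And>x. x \<in> X \<Longrightarrow> p * x * p' \<in> lspan Y"
  shows "p * x * p' \<in> lspan Y"
  using assms(1)
proof induction
  case (step x y c)
  have "p * (sc c * x + y) * p' = sc c * (p * x * p') + p * y * p'"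
    by (simp add: distrib_left distrib_right mult.assoc sc_left_commute[of p])
  then show ?case using step assms(2) by (simp add: lspan_add lspan_sc)
qed (simp add: lspan.zero)

lemma lspan_Un_ideal:
  fixes x :: "('g, 'a::comm_ring_1) fralg"
  assumes "x \<in> lspan (fa_ideal G S \<union> X)"
  shows "\<exists>s\<in>lspan X. x - s \<in> fa_ideal G S"
  using assms
proof induction
  case zero
  then show ?case by (intro bexI[OF _ lspan.zero]) (simp add: fa_ideal.zero)
next
  case (step x y c)
  then obtain s where s: "s \<in> lspan X" "y - s \<in> fa_ideal G S" by auto
  show ?case
  proof (cases "x \<in> X")
    case True
    then have "sc c * x + s \<in> lspan X" using s by (intro lspan.step)
    moreover have "(sc c * x + y) - (sc c * x + s) = y - s" by simp
    ultimately show ?thesis using s by metis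
  next
    case False
    then have "sc c * x \<in> fa_ideal G S" using step by (auto intro: fa_ideal_sc)
    then have "sc c * x + (y - s) \<in> fa_ideal G S" using s fa_ideal.add by blast
    moreover have "sc c * x + y - s = sc c * x + (y - s)" by simp
    ultimately show ?thesis using s by metis
  qed
qed

lemma lspan_image_sum:
  assumes "x \<in> lspan (b ` I)"
  shows "\<exists>J c. finite J \<and> J \<subseteq> I \<and> x = (\<Sum>i\<in>J. sc (c i) * b i)"
  using assms
proof induction
  case zero
  show ?case by (rule exI[of _ "{}"]) simp
next
  case (step x y c)
  then obtain J d i where J: "finite J" "J \<subseteq> I" "y = (\<Sum>i\<in>J. sc (d i) * b i)" "i \<in> I" "x = b i"
    by auto
  show ?case
  proof (cases "i \<in> J")
    case False
    have "(\<Sum>j\<in>J. sc ((d(i := c)) j) * b j) = (\<Sum>j\<in>J. sc (d j) * b j)"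
      by (rule sum.cong) (use False in auto)
    then show ?thesis
      using J False by (intro exI[of _ "insert i J"] exI[of _ "d(i := c)"]) auto
  next
    case True
    have "(\<Sum>j\<in>J. sc ((d(i := c + d i)) j) * b j) = sc c * b i + (\<Sum>j\<in>J. sc (d j) * b j)"
      using J True by (subst (1 2) sum.remove[of J i]) (auto simp: sc_add algebra_simps intro!: sum.cong)
    then show ?thesis
      using J True by (intro exI[of _ J] exI[of _ "d(i := c + d i)"]) auto
  qed
qed

lemma pres_basisI:
  fixes b :: "'i \<Rightarrow> ('g, 'a::comm_ring_1) fralg"
  assumes "\<And>i. i \<in> I \<Longrightarrow> b i \<in> fa_on G"
    and "\<And>p :: ('g, 'a) fralg. p \<in> fa_on G \<Longrightarrow> p \<in> lspan (fa_ideal G S \<union> b ` I)"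
    and "\<And>J c i. finite J \<Longrightarrow> J \<subseteq> I \<Longrightarrow> (\<Sum>i\<in>J. sc (c i) * b i) \<in> fa_ideal G S \<Longrightarrow> i \<in> J \<Longrightarrow> c i = 0"
  shows "pres_basis G S b I"
  unfolding pres_basis_def fa_simps
proof (intro conjI ballI allI impI)
  fix p :: "('g, 'a) fralg" assume "p \<in> fa_on G"
  then obtain s where s: "s \<in> lspan (b ` I)" "p - s \<in> fa_ideal G S"
    using lspan_Un_ideal[OF assms(2)] by blast
  then obtain J c where "finite J" "J \<subseteq> I" "s = (\<Sum>i\<in>J. sc (c i) * b i)"
    using lspan_image_sum[OF s(1)] by blast
  with s(2) show "\<exists>J c. finite J \<and> J \<subseteq> I \<and> p - (\<Sum>i\<in>J. sc (c i) * b i) \<in> fa_ideal G S" by blast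
next
  fix J c i
  assume "finite J" "J \<subseteq> I" "(\<Sum>i\<in>J. sc (c i) * b i) \<in> fa_ideal G S" "i \<in> J"
  then show "c i = 0" by (rule assms(3))
qed (rule assms(1))

lemma pres_basis_on: "pres_basis G S b I \<Longrightarrow> i \<in> I \<Longrightarrow> b i \<in> fa_on G"
  by (simp add: pres_basis_def)
lemma pres_basis_span:
  assumes "pres_basis G S b I" "p \<in> fa_on G"
  shows "p \<in> lspan (fa_ideal G S \<union> b ` I)"
proof -
  obtain J c where J: "finite J" "J \<subseteq> I" "p - (\<Sum>i\<in>J. sc (c i) * b i) \<in> fa_ideal G S"
    using assms unfolding pres_basis_def fa_simps by blast
  have "p = (p - (\<Sum>i\<in>J. sc (c i) * b i)) + (\<Sum>i\<in>J. sc (c i) * b i)" by simp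
  also have "\<dots> \<in> lspan (fa_ideal G S \<union> b ` I)"
    by (intro lspan_add lspan_sum lspan_sc) (use J in \<open>auto intro: lspan_base\<close>)
  finally show ?thesis .
qed
lemma pres_basis_indep:
  assumes "pres_basis G S b I" "finite J" "J \<subseteq> I" "(\<Sum>i\<in>J. sc (c i) * b i) \<in> fa_ideal G S" "i \<in> J"
  shows "c i = 0"
  using assms unfolding pres_basis_def fa_simps by blast

section \<open>Unitriangular change of basis\<close>

lemma triangular_span:
  fixes \<mu> :: "'i \<Rightarrow> nat"
  assumes bij: "bij_betw \<phi> I' I"
    and tri: "\<And>i. i \<in> I' \<Longrightarrow> \<exists>u u'. u' * u = 1 \<and>
       b' i - sc u * b (\<phi> i) \<in> lspan (fa_ideal G S \<union> b ` {j\<in>I. \<mu> j < \<mu> (\<phi> i)})"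
    and j: "j \<in> I"
  shows "b j \<in> lspan (fa_ideal G S \<union> b' ` {i\<in>I'. \<mu> (\<phi> i) \<le> \<mu> j})"
  using j
proof (induction "\<mu> j" arbitrary: j rule: less_induct)
  case less
  obtain i where i: "i \<in> I'" "j = \<phi> i" using bij less.prems by (auto simp: bij_betw_def)
  obtain u u' where u: "u' * u = 1"
    "b' i - sc u * b j \<in> lspan (fa_ideal G S \<union> b ` {k\<in>I. \<mu> k < \<mu> j})"
    using tri[OF i(1)] i(2) by auto
  let ?Y = "fa_ideal G S \<union> b' ` {i\<in>I'. \<mu> (\<phi> i) \<le> \<mu> j}"
  have "b' i - sc u * b j \<in> lspan ?Y"
  proof (rule lspan_minimal[OF u(2)])
    fix x assume x: "x \<in> fa_ideal G S \<union> b ` {k\<in>I. \<mu> k < \<mu> j}"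
    show "x \<in> lspan ?Y"
    proof (cases "x \<in> fa_ideal G S")
      case False
      then obtain k where k: "k \<in> I" "\<mu> k < \<mu> j" "x = b k" using x by auto
      have "b k \<in> lspan (fa_ideal G S \<union> b' ` {i\<in>I'. \<mu> (\<phi> i) \<le> \<mu> k})"
        by (rule less.hyps) (use k in auto)
      then show ?thesis unfolding k(3) by (rule lspan_mono) (use k in auto)
    qed (auto intro: lspan_base)
  qed
  moreover have "b' i \<in> lspan ?Y" by (rule lspan_base) (use i in auto)
  \<comment> \<open>Cancelling \<open>b' i\<close> leaves the unit multiple of \<open>b j\<close>,
    and the inverse unit isolates \<open>b j\<close>.\<close>
  ultimately have "b' i - (b' i - sc u * b j) \<in> lspan ?Y" by (rule lspan_diff[rotated])
  then have "sc u' * (sc u * b j) \<in> lspan ?Y" by (simp add: lspan_sc)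
  moreover have "sc u' * (sc u * b j) = b j" using u(1) by (simp flip: mult.assoc sc_mult)
  ultimately show ?case by simp
qed

text \<open>Spanning comes from \<open>triangular_span\<close>. For independence, pick a member of
  maximal weight in the support of a relation: every correction term has strictly smaller weight, so
  the leading term there keeps a coefficient that is a unit times the original one.\<close>

lemma triangular_basis:
  fixes \<mu> :: "'i \<Rightarrow> nat" and b :: "'i \<Rightarrow> ('g, 'a::comm_ring_1) fralg"
  assumes basis: "pres_basis G S b I"
    and on: "\<And>i. i \<in> I' \<Longrightarrow> b' i \<in> fa_on G"
    and bij: "bij_betw \<phi> I' I"
    and tri: "\<And>i. i \<in> I' \<Longrightarrow> \<exists>u u'. u' * u = 1 \<and>
       b' i - sc u * b (\<phi> i) \<in> lspan (fa_ideal G S \<union> b ` {j\<in>I. \<mu> j < \<mu> (\<phi> i)})"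
  shows "pres_basis G S b' I'"
proof (rule pres_basisI)
  fix p :: "('g, 'a) fralg" assume "p \<in> fa_on G"
  then have "p \<in> lspan (fa_ideal G S \<union> b ` I)" using basis pres_basis_span by blast
  then show "p \<in> lspan (fa_ideal G S \<union> b' ` I')"
  proof (rule lspan_minimal)
    fix x assume x: "x \<in> fa_ideal G S \<union> b ` I"
    show "x \<in> lspan (fa_ideal G S \<union> b' ` I')"
    proof (cases "x \<in> fa_ideal G S")
      case False
      then obtain j where j: "j \<in> I" "x = b j" using x by auto
      have "b j \<in> lspan (fa_ideal G S \<union> b' ` {i\<in>I'. \<mu> (\<phi> i) \<le> \<mu> j})"
        by (rule triangular_span[OF bij tri j(1)])
      then show ?thesis unfolding j by (rule lspan_mono) auto
    qed (auto intro: lspan_base)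
  qed
next
  fix J c i0
  assume J: "finite J" "J \<subseteq> I'" "(\<Sum>i\<in>J. sc (c i) * b' i) \<in> fa_ideal G S" "i0 \<in> J"
  show "c i0 = 0"
  proof (rule ccontr)
    assume nz: "c i0 \<noteq> 0"
    \<comment> \<open>Zero coefficients are discarded first, so that the member of maximal weight
      has a nonzero coefficient.\<close>
    define K where "K = {i\<in>J. c i \<noteq> 0}"
    have K: "finite K" "K \<noteq> {}" "K \<subseteq> I'" using J nz by (auto simp: K_def)
    have sumK: "(\<Sum>i\<in>K. sc (c i) * b' i) = (\<Sum>i\<in>J. sc (c i) * b' i)"
      unfolding K_def by (rule sum.mono_neutral_left) (use J in auto)
    define M where "M = Max ((\<lambda>i. \<mu> (\<phi> i)) ` K)"
    have "M \<in> (\<lambda>i. \<mu> (\<phi> i)) ` K" unfolding M_def using K by (intro Max_in) auto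
    then obtain m where m: "m \<in> K" "M = \<mu> (\<phi> m)" by blast
    have m_max: "\<mu> (\<phi> i) \<le> \<mu> (\<phi> m)" if "i \<in> K" for i
      unfolding m(2)[symmetric] M_def using K that by (intro Max_ge) auto
    have "\<forall>i\<in>I'. \<exists>u. (\<exists>u'. u' * u = 1) \<and>
       b' i - sc u * b (\<phi> i) \<in> lspan (fa_ideal G S \<union> b ` {j\<in>I. \<mu> j < \<mu> (\<phi> i)})"
      using tri by blast
    from bchoice[OF this] obtain u where u: "\<And>i. i \<in> I' \<Longrightarrow> (\<exists>u'. u' * u i = 1) \<and>
       b' i - sc (u i) * b (\<phi> i) \<in> lspan (fa_ideal G S \<union> b ` {j\<in>I. \<mu> j < \<mu> (\<phi> i)})"
      by blast
    let ?L = "{j\<in>I. \<mu> j < \<mu> (\<phi> m)}"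
    have *: "(\<Sum>i\<in>K. sc (c i) * (b' i - sc (u i) * b (\<phi> i))) \<in> lspan (fa_ideal G S \<union> b ` ?L)"
    proof (intro lspan_sum lspan_sc)
      fix i assume i: "i \<in> K"
      show "b' i - sc (u i) * b (\<phi> i) \<in> lspan (fa_ideal G S \<union> b ` ?L)"
        using i K(3) m_max[OF i] by (intro lspan_mono[OF conjunct2[OF u[of i]]]) auto
    qed
    obtain s where s: "s \<in> lspan (b ` ?L)"
      "(\<Sum>i\<in>K. sc (c i) * (b' i - sc (u i) * b (\<phi> i))) - s \<in> fa_ideal G S"
      using lspan_Un_ideal[OF *] by blast
    then obtain L d where L: "finite L" "L \<subseteq> ?L" "s = (\<Sum>j\<in>L. sc (d j) * b j)"
      using lspan_image_sum[OF s(1)] by blast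
    define \<psi> where "\<psi> = the_inv_into I' \<phi>"
    have \<psi>: "\<psi> (\<phi> i) = i" if "i \<in> I'" for i
      unfolding \<psi>_def using bij that by (simp add: bij_betw_def the_inv_into_f_f)
    have inj: "inj_on \<phi> K" using bij K by (auto simp: bij_betw_def intro: inj_on_subset)
    \<comment> \<open>\<open>e\<close> is the relation rewritten in the old basis: leading terms
      indexed by the image of \<open>K\<close>, lower terms indexed by \<open>L\<close>. The two
      index sets may overlap.\<close>
    define e where "e j = (if j \<in> \<phi> ` K then c (\<psi> j) * u (\<psi> j) else 0) + (if j \<in> L then d j else 0)" for j
    let ?X = "\<phi> ` K \<union> L"
    have X: "finite ?X" "?X \<subseteq> I" using K L bij by (auto simp: bij_betw_def)
    have "(\<Sum>j\<in>?X. sc (e j) * b j) = (\<Sum>j\<in>?X. sc (if j \<in> \<phi> ` K then c (\<psi> j) * u (\<psi> j) else 0) * b j)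
       + (\<Sum>j\<in>?X. sc (if j \<in> L then d j else 0) * b j)"
      by (simp add: e_def sc_add distrib_right sum.distrib)
    also have "(\<Sum>j\<in>?X. sc (if j \<in> L then d j else 0) * b j) = s"
      unfolding L(3) by (rule sum.mono_neutral_cong_right) (use X in auto)
    also have "(\<Sum>j\<in>?X. sc (if j \<in> \<phi> ` K then c (\<psi> j) * u (\<psi> j) else 0) * b j)
       = (\<Sum>j\<in>\<phi> ` K. sc (c (\<psi> j) * u (\<psi> j)) * b j)"
      by (rule sum.mono_neutral_cong_right) (use X in auto)
    also have "\<dots> = (\<Sum>i\<in>K. sc (c i) * (sc (u i) * b (\<phi> i)))"
      unfolding sum.reindex[OF inj] by (rule sum.cong) (use K \<psi> in \<open>auto simp: sc_mult mult.assoc\<close>)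
    also have "\<dots> + s = (\<Sum>i\<in>K. sc (c i) * b' i) -
         ((\<Sum>i\<in>K. sc (c i) * (b' i - sc (u i) * b (\<phi> i))) - s)"
      by (simp add: right_diff_distrib sum_subtractf)
    finally have "(\<Sum>j\<in>?X. sc (e j) * b j) \<in> fa_ideal G S"
      using fa_ideal_diff[OF J(3) s(2)] sumK by simp
    then have "e (\<phi> m) = 0"
      by (rule pres_basis_indep[OF basis X]) (use m(1) in simp)
    \<comment> \<open>All indices in \<open>L\<close> have weight below that of the chosen maximal
      one, so no lower term can cancel its coefficient.\<close>
    moreover have "\<phi> m \<notin> L" using L by auto
    ultimately have "c m * u m = 0" using m(1) K \<psi>[of m] by (auto simp: e_def)
    moreover obtain u' where "u' * u m = 1" using u[of m] m(1) K(3) by blast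
    then have "c m = u' * (c m * u m)" by (simp add: mult.left_commute[of u'])
    ultimately have "c m = 0" by simp
    then show False using m(1) by (simp add: K_def)
  qed
qed (rule on)

section \<open>Lexicographic normal forms\<close>

text \<open>Counts inversions with respect to a relation: of rows and of columns within a row as
  termination measures, and of one-line permutations as the length.\<close>

fun linv :: "('b \<Rightarrow> 'b \<Rightarrow> bool) \<Rightarrow> 'b list \<Rightarrow> nat" where
  "linv R [] = 0"
| "linv R (x # xs) = length (filter (R x) xs) + linv R xs"

lemma linv_append:
  "linv R (xs @ ys) = linv R xs + linv R ys + (\<Sum>x\<leftarrow>xs. length (filter (R x) ys))"
  by (induction xs) auto

abbreviation (input) rowR :: "nat \<times> nat \<Rightarrow> nat \<times> nat \<Rightarrow> bool" where
  "rowR a b \<equiv> fst b < fst a"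
abbreviation (input) colR :: "nat \<times> nat \<Rightarrow> nat \<times> nat \<Rightarrow> bool" where
  "colR a b \<equiv> fst a = fst b \<and> snd b < snd a"

text \<open>Row inversions decide, and a rewriting inside one row, which keeps the row sequence, is
  measured by column inversions. The multiset conditions make the comparison stable in a context:
  inversions between a factor and its surroundings depend only on the rows, respectively the
  letters, that occur in it.\<close>

definition small :: "(nat \<times> nat) list \<Rightarrow> (nat \<times> nat) list \<Rightarrow> bool" where
  "small w w' \<longleftrightarrow>
     mset (map fst w) = mset (map fst w') \<and> linv rowR w < linv rowR w' \<or>
     map fst w = map fst w' \<and> mset w = mset w' \<and> linv colR w < linv colR w'"

lemma cross_row:
  assumes "mset (map fst xs) = mset (map fst xs')" "mset (map fst ys) = mset (map fst ys')"
  shows "(\<Sum>x\<leftarrow>xs. length (filter (rowR x) ys)) = (\<Sum>x\<leftarrow>xs'. length (filter (rowR x) ys'))"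
proof -
  have *: "size (filter_mset P (image_mset fst (mset ws))) = length (filter (\<lambda>x. P (fst x)) ws)"
    for P and ws :: "(nat \<times> nat) list"
    by (induction ws) auto
  have "(\<Sum>x\<leftarrow>zs. length (filter (rowR x) ws)) =
      (\<Sum>i\<in>#mset (map fst zs). size (filter_mset (\<lambda>j. j < i) (mset (map fst ws))))"
    for zs ws :: "(nat \<times> nat) list"
    by (induction zs) (simp_all add: *)
  then show ?thesis using assms by presburger
qed

lemma linv_row_cong: "map fst w = map fst w' \<Longrightarrow> linv rowR w = linv rowR w'"
proof (induction w arbitrary: w')
  case (Cons x w)
  then obtain y v where w': "w' = y # v" by (cases w') auto
  then have "map fst w = map fst v" "fst x = fst y" using Cons.prems by auto
  moreover from this have "length (filter (\<lambda>b. fst b < fst x) w) = length (filter (\<lambda>b. fst b < fst y) v)"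
    using cross_row[of "[x]" "[y]" w v] by simp
  ultimately show ?case using Cons.IH[of v] w' by simp
qed simp

lemma small_context:
  assumes "small w w'"
  shows "(u @ w @ v, u @ w' @ v) \<in> measures [linv rowR, linv colR]"
proof -
  consider "mset (map fst w) = mset (map fst w')" "linv rowR w < linv rowR w'"
    | "map fst w = map fst w'" "mset w = mset w'" "linv colR w < linv colR w'"
    using assms by (auto simp: small_def)
  then show ?thesis
  proof cases
    case 1
    have "linv rowR (u @ w @ v) < linv rowR (u @ w' @ v)"
      using 1 cross_row[of u u "w @ v" "w' @ v"] cross_row[of w w' v v] by (simp add: linv_append)
    then show ?thesis by simp
  next
    case 2
    have "linv rowR (u @ w @ v) = linv rowR (u @ w' @ v)"
      by (rule linv_row_cong) (use 2 in simp)
    moreover have "length (filter P w) = length (filter P w')" for P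
      by (metis "2"(2) mset_filter size_mset)
    moreover have "(\<Sum>x\<leftarrow>w. f x) = (\<Sum>x\<leftarrow>w'. f x)" for f :: "_ \<Rightarrow> nat"
      by (metis "2"(2) mset_map sum_mset_sum_list)
    ultimately have "linv colR (u @ w @ v) < linv colR (u @ w' @ v)"
      using 2 by (simp add: linv_append)
    with \<open>linv rowR _ = _\<close> show ?thesis by simp
  qed
qed

text \<open>The defining relations solved for a product \<open>a b\<close> of letters with \<open>b < a\<close>.\<close>
definition qrhs :: "'a::comm_ring_1 \<Rightarrow> 'a \<Rightarrow> nat \<times> nat \<Rightarrow> nat \<times> nat \<Rightarrow> ('a \<times> (nat \<times> nat) \<times> (nat \<times> nat)) list" where
  "qrhs q qi a b =
     (if fst a = fst b \<or> snd a = snd b then [(qi, b, a)]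
      else if snd a < snd b then [(1, b, a)]
      else [(1, b, a), (qi - q, (fst b, snd a), (fst a, snd b))])"

text \<open>Letters from different rows are always replaced by products with increasing rows, the
  exchange term included. Letters from the same row are swapped, which removes a column
  inversion.\<close>

lemma qrhs_small: "b < a \<Longrightarrow> (c, x, y) \<in> set (qrhs q qi a b) \<Longrightarrow> small [x, y] [a, b]"
  by (cases a; cases b) (auto simp: qrhs_def small_def less_prod_def split: if_splits)

lemma not_sorted_descent:
  "\<not> sorted (w :: (nat \<times> nat) list) \<Longrightarrow> \<exists>u a b v. w = u @ [a, b] @ v \<and> b < a"
proof (induction w)
  case (Cons x w)
  show ?case
  proof (cases "sorted w")
    case False
    then obtain u a b v where "w = u @ [a, b] @ v" "b < a" using Cons by auto
    then show ?thesis by (intro exI[of _ "x # u"]) auto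
  next
    case True
    with Cons.prems obtain y w' where w: "w = y # w'" by (cases w) auto
    with True Cons.prems have "y < x" by fastforce
    with w show ?thesis by (intro exI[of _ "[]"]) auto
  qed
qed simp

text \<open>An arbitrary choice that makes rewriting deterministic, hence \<open>nf\<close> a
  function; \<open>nf_descent\<close> shows that the choice does not matter.\<close>

definition descent :: "(nat \<times> nat) list \<Rightarrow> (nat \<times> nat) list \<times> (nat \<times> nat) \<times> (nat \<times> nat) \<times> (nat \<times> nat) list" where
  "descent w = (SOME (u, a, b, v). w = u @ [a, b] @ v \<and> b < a)"

lemma descent:
  assumes "\<not> sorted w" "descent w = (u, a, b, v)"
  shows "w = u @ [a, b] @ v" "b < a"
proof -
  have "\<exists>x. case x of (u, a, b, v) \<Rightarrow> w = u @ [a, b] @ v \<and> b < a"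
    using not_sorted_descent[OF assms(1)] by auto
  from someI_ex[OF this] show "w = u @ [a, b] @ v" "b < a"
    using assms(2) unfolding descent_def by auto
qed

function nf :: "'a::comm_ring_1 \<Rightarrow> 'a \<Rightarrow> (nat \<times> nat) list \<Rightarrow> (nat \<times> nat, 'a) fralg" where
  "nf q qi w = (if sorted w then fa_word w else
     (case descent w of (u, a, b, v) \<Rightarrow>
        (\<Sum>(c, x, y)\<leftarrow>qrhs q qi a b. sc c * nf q qi (u @ [x, y] @ v))))"
  by pat_completeness auto
termination
proof (relation "inv_image (measures [linv rowR, linv colR]) (\<lambda>(q, qi, w). w)")
  show "((q, qi, u @ [x1, y1] @ v), (q, qi, w)) \<in> inv_image (measures [linv rowR, linv colR]) (\<lambda>(q, qi, w). w)"
    if "\<not> sorted w" "(u, y) = descent w" "(a, z) = y" "(b, v) = z"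
      "t \<in> set (qrhs q qi a b)" "(c, r) = t" "(x1, y1) = r"
    for q qi :: 'a and w u y a z b v t c r x1 y1
  proof -
    have "w = u @ [a, b] @ v" "b < a" "(c, x1, y1) \<in> set (qrhs q qi a b)"
      using that descent[of w u a b v] by auto
    then show ?thesis
      using small_context[OF qrhs_small, of b a c x1 y1 q qi u v] by simp
  qed
qed simp

declare nf.simps [simp del]

lemma nf_sorted: "sorted w \<Longrightarrow> nf q qi w = fa_word w"
  by (simp add: nf.simps)

text \<open>The critical pairs. \<open>h\<close> will be a coefficient of the normal form of a word
  in a fixed context; \<open>L\<close> and \<open>R\<close> permit rewriting only in words smaller
  than x1 x2 x3, which is what the induction in \<open>nf_descent\<close> provides. After a split by
  coinciding rows and by the relative order of the columns, both reductions become the same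
  combination because q * qi = 1.\<close>

lemma overlap:
  fixes q qi :: "'a::comm_ring_1" and h :: "(nat \<times> nat) list \<Rightarrow> 'a"
  assumes q: "q * qi = 1"
    and desc: "x2 < x1" "x3 < x2"
    and L: "\<And>x y z. y < x \<Longrightarrow> small [x, y, z] [x1, x2, x3] \<Longrightarrow>
       h [x, y, z] = (\<Sum>(c, x', y')\<leftarrow>qrhs q qi x y. c * h [x', y', z])"
    and R: "\<And>x y z. z < y \<Longrightarrow> small [x, y, z] [x1, x2, x3] \<Longrightarrow>
       h [x, y, z] = (\<Sum>(c, y', z')\<leftarrow>qrhs q qi y z. c * h [x, y', z'])"
  shows "(\<Sum>(c, x, y)\<leftarrow>qrhs q qi x1 x2. c * h [x, y, x3]) =
    (\<Sum>(c, y, z)\<leftarrow>qrhs q qi x2 x3. c * h [x1, y, z])"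
proof -
  obtain i k j l r m where x: "x1 = (i, k)" "x2 = (j, l)" "x3 = (r, m)"
    by (metis surj_pair)
  note sd = small_def x less_prod_def
  have qq: "q * qi = 1" "q * (qi * t) = t" for t
    using q by (simp_all flip: mult.assoc)
  consider "i > j" "j > r" | "i = j" "k > l" "j > r" | "i > j" "j = r" "l > m"
    | "i = j" "j = r" "k > l" "l > m"
    using desc unfolding x less_prod_def by fastforce
  then show ?thesis
  proof cases
    case 1
    \<comment> \<open>The names give the row sequence of the word to be rewritten. These are the
      sequences reached from i j r by one or two row exchanges, each with the pair at which it
      descends.\<close>
    have jir: "h [(j, a), (i, b), (r, c)] = (\<Sum>(d, y, z)\<leftarrow>qrhs q qi (i, b) (r, c). d * h [(j, a), y, z])" for a b c
      by (rule R) (use 1 in \<open>auto simp: sd\<close>)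
    have irj: "h [(i, a), (r, b), (j, c)] = (\<Sum>(d, y, z)\<leftarrow>qrhs q qi (i, a) (r, b). d * h [y, z, (j, c)])" for a b c
      by (rule L) (use 1 in \<open>auto simp: sd\<close>)
    have jri: "h [(j, a), (r, b), (i, c)] = (\<Sum>(d, y, z)\<leftarrow>qrhs q qi (j, a) (r, b). d * h [y, z, (i, c)])" for a b c
      by (rule L) (use 1 in \<open>auto simp: sd\<close>)
    have rij: "h [(r, a), (i, b), (j, c)] = (\<Sum>(d, y, z)\<leftarrow>qrhs q qi (i, b) (j, c). d * h [(r, a), y, z])" for a b c
      by (rule R) (use 1 in \<open>auto simp: sd\<close>)
    have ne: "i \<noteq> j" "j \<noteq> r" "i \<noteq> r" using 1 by auto
    consider "k < l" | "k = l" | "k > l" by linarith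
    then show ?thesis
      by cases (cases k m rule: linorder_cases; cases l m rule: linorder_cases;
        simp add: qrhs_def x ne jir irj jri rij; (simp add: algebra_simps qq)?)+
  next
    case 2
    have iir: "h [(i, l), (i, k), (r, c)] = (\<Sum>(d, y, z)\<leftarrow>qrhs q qi (i, k) (r, c). d * h [(i, l), y, z])"
      if "c = m" for c
      by (rule R) (use 2 that in \<open>auto simp: sd\<close>)
    have iri: "h [(i, a), (r, b), (i, c)] = (\<Sum>(d, y, z)\<leftarrow>qrhs q qi (i, a) (r, b). d * h [y, z, (i, c)])" for a b c
      by (rule L) (use 2 in \<open>auto simp: sd\<close>)
    have rii: "h [(r, a), (i, b), (i, c)] = (\<Sum>(d, y, z)\<leftarrow>qrhs q qi (i, b) (i, c). d * h [(r, a), y, z])"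
      if "c < b" for a b c
      by (rule R) (use 2 that in \<open>auto simp: sd\<close>)
    have ne: "i \<noteq> r" "j = i" "l < k" using 2 by auto
    show ?thesis
    proof -
      consider "m < l" | "m = l" | "l < m" "m < k" | "m = k" | "k < m" by linarith
      then show ?thesis
        by cases (use ne in \<open>simp add: qrhs_def x iir iri rii\<close>; (simp add: algebra_simps qq)?)+
    qed
  next
    case 3
    have ijj: "h [(i, c), (r, m), (r, l)] = (\<Sum>(d, y, z)\<leftarrow>qrhs q qi (i, c) (r, m). d * h [y, z, (r, l)])"
      if "c = k" for c
      by (rule L) (use 3 that in \<open>auto simp: sd\<close>)
    have jij: "h [(r, a), (i, b), (r, c)] = (\<Sum>(d, y, z)\<leftarrow>qrhs q qi (i, b) (r, c). d * h [(r, a), y, z])" for a b c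
      by (rule R) (use 3 in \<open>auto simp: sd\<close>)
    have jji: "h [(r, a), (r, b), (i, c)] = (\<Sum>(d, y, z)\<leftarrow>qrhs q qi (r, a) (r, b). d * h [y, z, (i, c)])"
      if "b < a" for a b c
      by (rule L) (use 3 that in \<open>auto simp: sd\<close>)
    have ne: "i \<noteq> r" "j = r" "m < l" using 3 by auto
    show ?thesis
    proof -
      consider "k < m" | "k = m" | "m < k" "k < l" | "k = l" | "l < k" by linarith
      then show ?thesis
        by cases (use ne in \<open>simp add: qrhs_def x ijj jij jji\<close>; (simp add: algebra_simps qq)?)+
    qed
  next
    case 4
    have "h [(i, l), (i, k), (i, m)] = qi * h [(i, l), (i, m), (i, k)]"
      by (subst R) (use 4 in \<open>auto simp: sd qrhs_def\<close>)
    moreover have "h [(i, l), (i, m), (i, k)] = qi * h [(i, m), (i, l), (i, k)]"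
      by (subst L) (use 4 in \<open>auto simp: sd qrhs_def\<close>)
    moreover have "h [(i, k), (i, m), (i, l)] = qi * h [(i, m), (i, k), (i, l)]"
      by (subst L) (use 4 in \<open>auto simp: sd qrhs_def\<close>)
    moreover have "h [(i, m), (i, k), (i, l)] = qi * h [(i, m), (i, l), (i, k)]"
      by (subst R) (use 4 in \<open>auto simp: sd qrhs_def\<close>)
    ultimately show ?thesis using 4 by (simp add: x qrhs_def)
  qed
qed

lemma sum_list_swap:
  "(\<Sum>x\<leftarrow>xs. \<Sum>y\<leftarrow>ys. f x y) = (\<Sum>y\<leftarrow>ys. \<Sum>x\<leftarrow>xs. f x y :: 'b::comm_monoid_add)"
  by (induction xs) (simp_all add: sum_list_addf)

lemma lookup_sum_list_sc:
  "Poly_Mapping.lookup (\<Sum>(c, x, y)\<leftarrow>xs. sc c * f x y) w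
     = (\<Sum>(c, x, y)\<leftarrow>xs. c * Poly_Mapping.lookup (f x y) w)"
  by (induction xs) (auto simp: lookup_add lookup_sc_mult)

text \<open>Bergman's diamond lemma for this rewriting system: the normal form does not depend on which
  descent is rewritten.\<close>
lemma nf_descent:
  assumes q: "q * qi = 1" and "b < a"
  shows "nf q qi (u @ [a, b] @ v) = (\<Sum>(c, x, y)\<leftarrow>qrhs q qi a b. sc c * nf q qi (u @ [x, y] @ v))"
proof -
  define red where "red u a b v = (\<Sum>(c, x, y)\<leftarrow>qrhs q qi a b. sc c * nf q qi (u @ [x, y] @ v))" for u a b v
  let ?m = "measures [linv rowR, linv colR]"
  have "nf q qi w = red u a b v" if "w = u @ [a, b] @ v" "b < a" for w u a b v
    using that
  proof (induction w arbitrary: u a b v rule: wf_induct_rule[OF wf_measures[of "[linv rowR, linv colR]"]])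
    case (1 w)
    have conf: "red u a b v = red u' a' b' v'"
      if w: "w = u @ [a, b] @ v" "w = u' @ [a', b'] @ v'" and lt: "b < a" "b' < a'"
        and le: "length u \<le> length u'" for u a b v u' a' b' v'
    proof -
      obtain t where t: "u' = u @ t" "[a, b] @ v = t @ [a', b'] @ v'"
        using w le by (metis (no_types, opaque_lifting) append_eq_append_conv_if append_eq_conv_conj append_take_drop_id)
      \<comment> \<open>\<open>t\<close> is the segment between the starts of the two descents: they
        coincide, share one letter, or are disjoint.\<close>
      consider "t = []" | "t = [a]" | m where "t = a # b # m"
        using t(2) by (cases t rule: list.exhaust; cases "tl t") auto
      then show ?thesis
      proof cases
        case 1
        then show ?thesis using t by simp
      next
        case 2
        then have b: "a' = b" "v = b' # v'" using t by auto
        show ?thesis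
        \<comment> \<open>Compared coefficient by coefficient, since \<open>overlap\<close> speaks
          of scalar-valued functions of three-letter words.\<close>
        proof (rule poly_mapping_eqI)
          fix z
          let ?h = "\<lambda>x. Poly_Mapping.lookup (nf q qi (u @ x @ v')) z"
          have small: "(u @ x @ v', w) \<in> ?m" if "small x [a, b, b']" for x
            using small_context[OF that, of u v'] w(1) b by simp
          have "(\<Sum>(c, x, y)\<leftarrow>qrhs q qi a b. c * ?h [x, y, b'])
             = (\<Sum>(c, x, y)\<leftarrow>qrhs q qi b b'. c * ?h [a, x, y])"
          proof (rule overlap[OF q])
            fix x y z' assume *: "y < x" "small [x, y, z'] [a, b, b']"
            show "?h [x, y, z'] = (\<Sum>(c, x', y')\<leftarrow>qrhs q qi x y. c * ?h [x', y', z'])"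
              using "1.IH"[OF small[OF *(2)], of u x y "z' # v'"] *(1)
              by (simp add: red_def lookup_sum_list_sc)
          next
            fix x y z' assume *: "z' < y" "small [x, y, z'] [a, b, b']"
            show "?h [x, y, z'] = (\<Sum>(c, x', y')\<leftarrow>qrhs q qi y z'. c * ?h [x, x', y'])"
              using "1.IH"[OF small[OF *(2)], of "u @ [x]" y z' v'] *(1)
              by (simp add: red_def lookup_sum_list_sc)
          qed (use lt b in auto)
          then show "Poly_Mapping.lookup (red u a b v) z = Poly_Mapping.lookup (red u' a' b' v') z"
            using b t(1) 2 by (simp add: red_def lookup_sum_list_sc)
        qed
      next
        case (3 m)
        then have v: "v = m @ [a', b'] @ v'" using t by simp
        \<comment> \<open>Disjoint descents: by induction the other descent may be rewritten inside
          each term, and the resulting double sum does not depend on which came first.\<close>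
        have "red u a b v = (\<Sum>(c, x, y)\<leftarrow>qrhs q qi a b. sc c * red (u @ [x, y] @ m) a' b' v')"
          unfolding red_def[of u a b v]
        proof (intro arg_cong[where f = sum_list] map_cong refl, clarsimp simp del: append.simps)
          fix c x y assume *: "(c, x, y) \<in> set (qrhs q qi a b)"
          have "(u @ [x, y] @ v, w) \<in> ?m"
            using small_context[OF qrhs_small[OF lt(1) *]] w(1) by simp
          from "1.IH"[OF this, of "u @ [x, y] @ m" a' b' v'] lt v
          show "sc c * nf q qi (u @ [x, y] @ v) = sc c * red (u @ [x, y] @ m) a' b' v'" by simp
        qed
        also have "\<dots> = (\<Sum>(c, x, y)\<leftarrow>qrhs q qi a b. \<Sum>(c', x', y')\<leftarrow>qrhs q qi a' b'.
            sc (c * c') * nf q qi (u @ [x, y] @ m @ [x', y'] @ v'))"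
          by (simp add: red_def sum_list_const_mult[symmetric] case_prod_unfold sc_mult mult.assoc)
        also have "\<dots> = (\<Sum>(c', x', y')\<leftarrow>qrhs q qi a' b'. \<Sum>(c, x, y)\<leftarrow>qrhs q qi a b.
            sc (c' * c) * nf q qi (u @ [x, y] @ m @ [x', y'] @ v'))"
          unfolding case_prod_unfold by (subst sum_list_swap) (simp add: mult.commute)
        also have "\<dots> = (\<Sum>(c', x', y')\<leftarrow>qrhs q qi a' b'. sc c' * red u a b (m @ [x', y'] @ v'))"
          by (simp add: red_def sum_list_const_mult[symmetric] case_prod_unfold sc_mult mult.assoc)
        also have "\<dots> = red u' a' b' v'"
          unfolding red_def[of u' a' b' v']
        proof (intro arg_cong[where f = sum_list] map_cong refl, clarsimp simp del: append.simps)
          fix c x y assume *: "(c, x, y) \<in> set (qrhs q qi a' b')"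
          have "(u' @ [x, y] @ v', w) \<in> ?m"
            using small_context[OF qrhs_small[OF lt(2) *]] w(2) by simp
          from "1.IH"[OF this, of u a b "m @ [x, y] @ v'"] lt v t(1) 3
          show "sc c * red u a b (m @ [x, y] @ v') = sc c * nf q qi (u' @ [x, y] @ v')" by simp
        qed
        finally show ?thesis .
      qed
    qed
    have ns: "\<not> sorted w" using 1(2,3) by (auto simp: sorted_append)
    obtain u' a' b' v' where d: "descent w = (u', a', b', v')" by (metis surj_pair)
    have w': "w = u' @ [a', b'] @ v'" "b' < a'" using descent[OF ns d] by auto
    have "nf q qi w = red u' a' b' v'"
      using ns d by (subst nf.simps) (simp add: red_def)
    also have "\<dots> = red u a b v"
      using conf[OF 1(2) w'(1) 1(3) w'(2)] conf[OF w'(1) 1(2) w'(2) 1(3)] by (metis nle_le)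
    finally show ?case .
  qed
  then show ?thesis using assms(2) unfolding red_def by blast
qed

section \<open>The quantum determinant is central\<close>

text \<open>The entries are indexed by all naturals, so that the exterior calculus needs no bounds,
  and \<open>Q\<close> is a central ring element in place of a scalar. The instance \<open>E\<close>
  below consists of operators on normal forms.\<close>

locale quantum_matrix =
  fixes t :: "nat \<Rightarrow> nat \<Rightarrow> 'r::ring_1" and Q Qi :: 'r
  assumes Q_central: "Q * x = x * Q"
    and Q_inverse: "Q * Qi = 1"
    and row: "j < k \<Longrightarrow> t i j * t i k = Q * (t i k * t i j)"
    and col: "i < h \<Longrightarrow> t i k * t h k = Q * (t h k * t i k)"
    and anti: "i < j \<Longrightarrow> k < l \<Longrightarrow> t i l * t j k = t j k * t i l"
    and diag: "i < j \<Longrightarrow> k < l \<Longrightarrow> t i k * t j l - t j l * t i k = (Q - Qi) * (t i l * t j k)"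
begin

lemma Q_inverse': "Qi * Q = 1"
  by (metis Q_central Q_inverse)
lemma Qi_central: "Qi * x = x * Qi"
proof -
  have "Qi * x = Qi * (x * Q) * Qi" by (simp add: mult.assoc Q_inverse)
  also have "\<dots> = (Qi * Q) * x * Qi" by (metis Q_central mult.assoc)
  finally show ?thesis by (simp add: Q_inverse')
qed

definition central :: "'r \<Rightarrow> bool" where "central c \<longleftrightarrow> (\<forall>x. x * c = c * x)"

lemma central_commute: "central c \<Longrightarrow> x * c = c * x"
  by (simp add: central_def)
lemma central_left_commute: "central c \<Longrightarrow> x * (c * y) = c * (x * y)"
  using central_commute[of c x] by (metis mult.assoc)
lemma central_mult [intro, simp]:
  assumes "central c" "central d"
  shows "central (c * d)"
  unfolding central_def
proof
  fix x
  have "x * (c * d) = c * (x * d)" using assms(1) by (rule central_left_commute)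
  also have "\<dots> = c * (d * x)" using central_commute[OF assms(2), of x] by simp
  finally show "x * (c * d) = c * d * x" by (simp add: mult.assoc)
qed
lemma central_basic [intro, simp]: "central 1" "central Q" "central Qi" "central (- Q)" "central (- Qi)"
  by (simp_all add: central_def Q_central Qi_central)
lemma central_power [intro, simp]: "central c \<Longrightarrow> central (c ^ m)"
  by (induction m) simp_all

lemma t_power: "t i j * ((- Q) ^ m * y) = (- Q) ^ m * (t i j * y)"
  by (rule central_left_commute) simp
lemma power_t: "((- Q) ^ m * y) * t i j = (- Q) ^ m * (y * t i j)"
  by (simp add: mult.assoc)
lemma power_power: "(- Q) ^ a * ((- Q) ^ b * y) = (- Q) ^ (a + b) * y"
  by (simp add: power_add mult.assoc)

lemma power_inverse: "(- Q) ^ m * (- Qi) ^ m = 1"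
proof (induction m)
  case (Suc m)
  have "(- Q) ^ Suc m * (- Qi) ^ Suc m = (- Q) * ((- Q) ^ m * (- Qi) ^ m) * (- Qi)"
    by (metis mult.assoc power_Suc power_Suc2)
  then show ?case using Suc by (simp add: Q_inverse)
qed simp

text \<open>A function on finite sets \<open>S\<close> of columns stands for the element \<open>\<Sum> f(S) e\<^sub>S\<close> of the quantum exterior
  algebra with \<open>e\<^sub>l e\<^sub>k = - q e\<^sub>k e\<^sub>l\<close> for \<open>k < l\<close>, and \<open>W i\<close> is left multiplication by
  \<open>\<Sum> t\<^sub>i\<^sub>k e\<^sub>k\<close>; \<open>V j\<close> is the corresponding right multiplication by the \<open>j\<close>-th column.\<close>
definition W :: "nat \<Rightarrow> (nat set \<Rightarrow> 'r) \<Rightarrow> nat set \<Rightarrow> 'r" where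
  "W i f S = (\<Sum>k\<in>S. (- Q) ^ card {s\<in>S. s < k} * (t i k * f (S - {k})))"

definition V :: "nat \<Rightarrow> (nat set \<Rightarrow> 'r) \<Rightarrow> nat set \<Rightarrow> 'r" where
  "V j f S = (\<Sum>i\<in>S. (- Q) ^ card {s\<in>S. i < s} * (f (S - {i}) * t i j))"

lemma sum_ordered_pairs:
  fixes g :: "nat \<Rightarrow> nat \<Rightarrow> 'r"
  assumes "finite S"
  shows "(\<Sum>k\<in>S. \<Sum>l\<in>S - {k}. g k l) = (\<Sum>(k, l)\<in>{(k, l). k \<in> S \<and> l \<in> S \<and> k < l}. g k l + g l k)"
proof -
  let ?P = "{(k, l). k \<in> S \<and> l \<in> S \<and> k < l}"
  have fin: "finite ?P" using assms by (auto intro: finite_subset[of _ "S \<times> S"])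
  have "(\<Sum>k\<in>S. \<Sum>l\<in>S - {k}. g k l) = (\<Sum>(k, l)\<in>Sigma S (\<lambda>k. S - {k}). g k l)"
    using assms by (simp add: sum.Sigma)
  also have "Sigma S (\<lambda>k. S - {k}) = ?P \<union> prod.swap ` ?P" by (auto simp: image_iff)
  also have "(\<Sum>(k, l)\<in>\<dots>. g k l) = (\<Sum>(k, l)\<in>?P. g k l) + (\<Sum>(k, l)\<in>prod.swap ` ?P. g k l)"
    by (rule sum.union_disjoint) (use fin in auto)
  also have "(\<Sum>(k, l)\<in>prod.swap ` ?P. g k l) = (\<Sum>(k, l)\<in>?P. g l k)"
    by (subst sum.reindex) (auto simp: comp_def case_prod_unfold)
  finally show ?thesis by (simp add: sum.distrib case_prod_unfold)
qed

lemma power_pair: "(- Q) ^ (a + b) * x + (- Q) ^ (Suc b + a) * y = (- Q) ^ (a + b) * (x - Q * y)"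
proof -
  have "(- Q) ^ (Suc b + a) = (- Q) ^ (a + b) * (- Q)"
    by (metis add.commute add_Suc_right power_Suc2)
  then show ?thesis by (simp add: algebra_simps)
qed

text \<open>The two orders of removing columns k < l are collected. Removing l first counts k once
  more, which gives the single extra factor -Q, so each coefficient is a 2 by 2 quantum determinant
  formed from the rows j and i.\<close>

lemma W_W:
  assumes S: "finite S"
  shows "W j (W i f) S = (\<Sum>(k, l)\<in>{(k, l). k \<in> S \<and> l \<in> S \<and> k < l}.
     (- Q) ^ (card {s\<in>S. s < k} + card {s\<in>S - {k}. s < l}) *
     ((t j k * t i l - Q * (t j l * t i k)) * f (S - {k, l})))"
proof -
  have "W j (W i f) S = (\<Sum>k\<in>S. \<Sum>l\<in>S - {k}. (- Q) ^ card {s\<in>S. s < k} *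
      (t j k * ((- Q) ^ card {s\<in>S - {k}. s < l} * (t i l * f (S - {k} - {l})))))"
    unfolding W_def by (simp add: sum_distrib_left)
  also have "\<dots> = (\<Sum>(k, l)\<in>{(k, l). k \<in> S \<and> l \<in> S \<and> k < l}.
     (- Q) ^ (card {s\<in>S. s < k} + card {s\<in>S - {k}. s < l}) *
     ((t j k * t i l - Q * (t j l * t i k)) * f (S - {k, l})))"
    unfolding sum_ordered_pairs[OF S]
  proof (intro sum.cong refl, clarify)
    fix k l assume kl: "k \<in> S" "l \<in> S" "k < l"
    have "{s\<in>S. s < l} = insert k {s\<in>S - {k}. s < l}" using kl by auto
    then have 1: "card {s\<in>S. s < l} = Suc (card {s\<in>S - {k}. s < l})" using S by simp
    have 2: "{s\<in>S - {l}. s < k} = {s\<in>S. s < k}" using kl by auto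
    have 3: "S - {l} - {k} = S - {k, l}" "S - {k} - {l} = S - {k, l}" by auto
    show "(- Q) ^ card {s\<in>S. s < k} * (t j k * ((- Q) ^ card {s\<in>S - {k}. s < l} * (t i l * f (S - {k} - {l})))) +
      (- Q) ^ card {s\<in>S. s < l} * (t j l * ((- Q) ^ card {s\<in>S - {l}. s < k} * (t i k * f (S - {l} - {k})))) =
      (- Q) ^ (card {s\<in>S. s < k} + card {s\<in>S - {k}. s < l}) *
      ((t j k * t i l - Q * (t j l * t i k)) * f (S - {k, l}))"
      unfolding 1 2 3
      unfolding t_power power_power power_pair by (simp add: algebra_simps)
  qed
  finally show ?thesis .
qed

lemma V_V:
  assumes S: "finite S"
  shows "V j (V i f) S = (\<Sum>(k, l)\<in>{(k, l). k \<in> S \<and> l \<in> S \<and> k < l}.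
     (- Q) ^ (card {s\<in>S. l < s} + card {s\<in>S - {l}. k < s}) *
     (f (S - {k, l}) * (t k i * t l j - Q * (t l i * t k j))))"
proof -
  have "V j (V i f) S = (\<Sum>k\<in>S. \<Sum>l\<in>S - {k}. (- Q) ^ card {s\<in>S. k < s} *
      ((- Q) ^ card {s\<in>S - {k}. l < s} * (f (S - {k} - {l}) * t l i) * t k j))"
    unfolding V_def by (simp add: sum_distrib_left sum_distrib_right)
  also have "\<dots> = (\<Sum>(k, l)\<in>{(k, l). k \<in> S \<and> l \<in> S \<and> k < l}.
     (- Q) ^ (card {s\<in>S. l < s} + card {s\<in>S - {l}. k < s}) *
     (f (S - {k, l}) * (t k i * t l j - Q * (t l i * t k j))))"
    unfolding sum_ordered_pairs[OF S]
  proof (intro sum.cong refl, clarify)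
    fix k l assume kl: "k \<in> S" "l \<in> S" "k < l"
    have "{s\<in>S. k < s} = insert l {s\<in>S - {l}. k < s}" using kl by auto
    then have 1: "card {s\<in>S. k < s} = Suc (card {s\<in>S - {l}. k < s})" using S by simp
    have 2: "{s\<in>S - {k}. l < s} = {s\<in>S. l < s}" using kl by auto
    have 3: "S - {l} - {k} = S - {k, l}" "S - {k} - {l} = S - {k, l}" by auto
    show "(- Q) ^ card {s\<in>S. k < s} * ((- Q) ^ card {s\<in>S - {k}. l < s} * (f (S - {k} - {l}) * t l i) * t k j) +
      (- Q) ^ card {s\<in>S. l < s} * ((- Q) ^ card {s\<in>S - {l}. k < s} * (f (S - {l} - {k}) * t k i) * t l j) =
      (- Q) ^ (card {s\<in>S. l < s} + card {s\<in>S - {l}. k < s}) *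
      (f (S - {k, l}) * (t k i * t l j - Q * (t l i * t k j)))"
      unfolding 1 2 3 power_t power_power
      by (subst add.commute, subst power_pair)
         (simp add: right_diff_distrib mult.assoc central_left_commute[of Q])
  qed
  finally show ?thesis .
qed

lemma W_infinite: "infinite S \<Longrightarrow> W i f S = 0" by (simp add: W_def)
lemma V_infinite: "infinite S \<Longrightarrow> V i f S = 0" by (simp add: V_def)

text \<open>For equal rows the 2 by 2 coefficients of \<open>W_W\<close> vanish by the relation
  within a row.\<close>

lemma W_square: "W i (W i f) = (\<lambda>S. 0)"
proof
  fix S show "W i (W i f) S = 0"
  proof (cases "finite S")
    case True
    then show ?thesis unfolding W_W[OF True] by (intro sum.neutral) (auto simp: row)
  qed (simp add: W_infinite)
qed

lemma V_square: "V i (V i f) = (\<lambda>S. 0)"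
proof
  fix S show "V i (V i f) S = 0"
  proof (cases "finite S")
    case True
    then show ?thesis unfolding V_V[OF True] by (intro sum.neutral) (auto simp: col)
  qed (simp add: V_infinite)
qed

lemma diag': "i < j \<Longrightarrow> k < l \<Longrightarrow> t j l * t i k = t i k * t j l - (Q - Qi) * (t i l * t j k)"
  using diag[of i j k l] by (simp add: algebra_simps)

text \<open>The \<open>diag\<close> and \<open>anti\<close> relations say that interchanging the two
  rows multiplies each 2 by 2 coefficient by -Q.\<close>

lemma W_swap:
  assumes "i < j"
  shows "W j (W i f) = (\<lambda>S. - Q * W i (W j f) S)"
proof
  fix S show "W j (W i f) S = - Q * W i (W j f) S"
  proof (cases "finite S")
    case True
    have "t j k * t i l - Q * (t j l * t i k) = - Q * (t i k * t j l - Q * (t i l * t j k))"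
      if "k < l" for k l
    proof -
      have "Q * (Qi * x) = x" for x by (simp add: Q_inverse flip: mult.assoc)
      then show ?thesis
        unfolding diag'[OF assms that] anti[OF assms that] by (simp add: algebra_simps)
    qed
    then show ?thesis unfolding W_W[OF True] sum_distrib_left
      by (intro sum.cong) (auto simp: mult.assoc central_left_commute[of "- Q"] simp del: mult_minus_left)
  qed (simp add: W_infinite)
qed

text \<open>The order of i and j is opposite to that in \<open>W_swap\<close> because
  \<open>V\<close> multiplies from the right.\<close>

lemma V_swap:
  assumes "i < j"
  shows "V i (V j f) = (\<lambda>S. - Q * V j (V i f) S)"
proof
  fix S show "V i (V j f) S = - Q * V j (V i f) S"
  proof (cases "finite S")
    case True
    have "t k j * t l i - Q * (t l j * t k i) = - Q * (t k i * t l j - Q * (t l i * t k j))"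
      if "k < l" for k l
    proof -
      have "Q * (Qi * x) = x" for x by (simp add: Q_inverse flip: mult.assoc)
      then show ?thesis
        unfolding diag'[OF that assms] anti[OF that assms] by (simp add: algebra_simps)
    qed
    then show ?thesis unfolding V_V[OF True] sum_distrib_left
      by (intro sum.cong) (auto simp: mult.assoc central_left_commute[of "- Q"] simp del: mult_minus_left)
  qed (simp add: V_infinite)
qed

lemma W_scale: "central c \<Longrightarrow> W i (\<lambda>S. c * f S) = (\<lambda>S. c * W i f S)"
  by (auto simp: W_def sum_distrib_left central_left_commute[of c])
lemma V_scale: "central c \<Longrightarrow> V i (\<lambda>S. c * f S) = (\<lambda>S. c * V i f S)"
  by (auto simp: V_def sum_distrib_left central_left_commute[of c] mult.assoc)
lemma W_zero: "W i (\<lambda>S. 0) = (\<lambda>S. 0)" by (simp add: W_def fun_eq_iff)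
lemma V_zero: "V i (\<lambda>S. 0) = (\<lambda>S. 0)" by (simp add: V_def fun_eq_iff)

lemma W_foldr:
  assumes "\<And>j. j \<in> set I \<Longrightarrow> j < i"
  shows "W i (foldr W I f) = (\<lambda>S. (- Q) ^ length I * foldr W I (W i f) S)"
  using assms
proof (induction I)
  case (Cons j I)
  have "W i (foldr W (j # I) f) = (\<lambda>S. - Q * W j (W i (foldr W I f)) S)"
    using W_swap[of j i] Cons.prems by simp
  also have "W i (foldr W I f) = (\<lambda>S. (- Q) ^ length I * foldr W I (W i f) S)"
    using Cons by simp
  finally show ?case by (simp add: W_scale mult.assoc)
qed simp

lemma V_foldr:
  assumes "\<And>j. j \<in> set I \<Longrightarrow> i < j"
  shows "V i (foldr V I f) = (\<lambda>S. (- Q) ^ length I * foldr V I (V i f) S)"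
  using assms
proof (induction I)
  case (Cons j I)
  have "V i (foldr V (j # I) f) = (\<lambda>S. - Q * V j (V i (foldr V I f)) S)"
    using V_swap[of i j] Cons.prems by simp
  also have "V i (foldr V I f) = (\<lambda>S. (- Q) ^ length I * foldr V I (V i f) S)"
    using Cons by simp
  finally show ?case by (simp add: V_scale mult.assoc)
qed simp

lemma foldr_W_zero: "foldr W I (\<lambda>S. 0) = (\<lambda>S. 0)"
  by (induction I) (simp_all add: W_zero)
lemma foldr_V_zero: "foldr V I (\<lambda>S. 0) = (\<lambda>S. 0)"
  by (induction I) (simp_all add: V_zero)
text \<open>\<open>W i\<close> passes the smaller rows in front of its own copy, each for a factor
  -Q, and then meets that copy, where the square is zero.\<close>

lemma W_foldr_mem:
  assumes "sorted_wrt (<) I" "i \<in> set I"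
  shows "W i (foldr W I f) = (\<lambda>S. 0)"
proof -
  obtain I1 I2 where I: "I = I1 @ i # I2" using assms(2) by (meson split_list)
  have "W i (foldr W I f) = (\<lambda>S. (- Q) ^ length I1 * foldr W I1 (W i (W i (foldr W I2 f))) S)"
    unfolding I using W_foldr[of I1 i "W i (foldr W I2 f)"] assms(1) by (auto simp: I sorted_wrt_append)
  then show ?thesis by (simp add: W_square foldr_W_zero)
qed

lemma V_foldr_mem:
  assumes "sorted_wrt (>) I" "i \<in> set I"
  shows "V i (foldr V I f) = (\<lambda>S. 0)"
proof -
  obtain I1 I2 where I: "I = I1 @ i # I2" using assms(2) by (meson split_list)
  have "V i (foldr V I f) = (\<lambda>S. (- Q) ^ length I1 * foldr V I1 (V i (V i (foldr V I2 f))) S)"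
    unfolding I using V_foldr[of I1 i "V i (foldr V I2 f)"] assms(1) by (auto simp: I sorted_wrt_append)
  then show ?thesis by (simp add: V_square foldr_V_zero)
qed

text \<open>The unit of the exterior algebra, concentrated at the empty set of columns.\<close>

definition unit_fun :: "nat set \<Rightarrow> 'r" where "unit_fun S = (if S = {} then 1 else 0)"

definition rowprod :: "nat list \<Rightarrow> nat set \<Rightarrow> 'r" where "rowprod I = foldr W I unit_fun"
definition colprod :: "nat list \<Rightarrow> nat set \<Rightarrow> 'r" where "colprod J = foldr V J unit_fun"

text \<open>Row n + 1 crosses n smaller rows, so the exponent is n (n - 1) / 2. Only its existence
  is kept, because -Q is invertible.\<close>

lemma foldr_W_rev:
  "\<exists>m. \<forall>f. foldr W (rev [1..<Suc n]) f = (\<lambda>S. (- Q) ^ m * foldr W [1..<Suc n] f S)"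
proof (induction n)
  case 0
  show ?case by (rule exI[of _ 0]) simp
next
  case (Suc n)
  then obtain m where m: "foldr W (rev [1..<Suc n]) f = (\<lambda>S. (- Q) ^ m * foldr W [1..<Suc n] f S)" for f
    by blast
  have "foldr W (rev [1..<Suc (Suc n)]) f = (\<lambda>S. (- Q) ^ (m + n) * foldr W [1..<Suc (Suc n)] f S)" for f
  proof -
    have "foldr W (rev [1..<Suc (Suc n)]) f = W (Suc n) (foldr W (rev [1..<Suc n]) f)" by simp
    also have "\<dots> = (\<lambda>S. (- Q) ^ m * W (Suc n) (foldr W [1..<Suc n] f) S)"
      unfolding m by (rule W_scale) simp
    also have "W (Suc n) (foldr W [1..<Suc n] f) = (\<lambda>S. (- Q) ^ n * foldr W [1..<Suc n] (W (Suc n) f) S)"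
      using W_foldr[of "[1..<Suc n]" "Suc n" f] by (simp del: upt_Suc)
    finally show ?thesis by (simp add: power_power)
  qed
  then show ?case by blast
qed

lemma rowprod_expand:
  assumes "finite S" "card S = length I"
  shows "rowprod I S = (\<Sum>ks\<in>permutations_of_set S.
     (- Q) ^ linv (\<lambda>a b. b < a) ks * prod_list (map2 t I ks))"
  using assms
proof (induction I arbitrary: S)
  case Nil
  then show ?case by (simp add: rowprod_def unit_fun_def)
next
  case (Cons i I)
  have ne: "S \<noteq> {}" using Cons.prems(2) by auto
  have "(\<Sum>ks\<in>permutations_of_set S. (- Q) ^ linv (\<lambda>a b. b < a) ks * prod_list (map2 t (i # I) ks))
     = (\<Sum>k\<in>S. \<Sum>ks\<in>(#) k ` permutations_of_set (S - {k}).
          (- Q) ^ linv (\<lambda>a b. b < a) ks * prod_list (map2 t (i # I) ks))"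
    unfolding permutations_of_set_nonempty[OF ne]
    by (rule sum.UNION_disjoint) (use Cons in auto)
  also have "\<dots> = (\<Sum>k\<in>S. (- Q) ^ card {s\<in>S. s < k} * (t i k * rowprod I (S - {k})))"
  proof (rule sum.cong[OF refl])
    fix k assume k: "k \<in> S"
    have "(\<Sum>ks\<in>(#) k ` permutations_of_set (S - {k}).
          (- Q) ^ linv (\<lambda>a b. b < a) ks * prod_list (map2 t (i # I) ks))
      = (\<Sum>ks\<in>permutations_of_set (S - {k}). (- Q) ^ card {s\<in>S. s < k} *
          (t i k * ((- Q) ^ linv (\<lambda>a b. b < a) ks * prod_list (map2 t I ks))))"
    proof (subst sum.reindex)
      show "sum ((\<lambda>ks. (- Q) ^ linv (\<lambda>a b. b < a) ks * prod_list (map2 t (i # I) ks)) \<circ> (#) k) (permutations_of_set (S - {k})) =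
        (\<Sum>ks\<in>permutations_of_set (S - {k}). (- Q) ^ card {s\<in>S. s < k} *
          (t i k * ((- Q) ^ linv (\<lambda>a b. b < a) ks * prod_list (map2 t I ks))))"
      proof (rule sum.cong[OF refl])
        fix ks assume "ks \<in> permutations_of_set (S - {k})"
        then have ks: "distinct ks" "set ks = S - {k}" by (auto simp: permutations_of_set_def)
        have "{x. x < k} \<inter> set ks = {s\<in>S. s < k}" using ks by auto
        then have "length (filter (\<lambda>b. b < k) ks) = card {s\<in>S. s < k}"
          using distinct_length_filter[OF ks(1), of "\<lambda>b. b < k"] by simp
        then show "((\<lambda>ks. (- Q) ^ linv (\<lambda>a b. b < a) ks * prod_list (map2 t (i # I) ks)) \<circ> (#) k) ks =
          (- Q) ^ card {s\<in>S. s < k} * (t i k * ((- Q) ^ linv (\<lambda>a b. b < a) ks * prod_list (map2 t I ks)))"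
          by (simp add: t_power power_add mult.assoc)
      qed
    qed simp
    also have "\<dots> = (- Q) ^ card {s\<in>S. s < k} * (t i k * rowprod I (S - {k}))"
      using Cons.IH[of "S - {k}"] Cons.prems k by (simp add: sum_distrib_left)
    finally show "(\<Sum>ks\<in>(#) k ` permutations_of_set (S - {k}).
          (- Q) ^ linv (\<lambda>a b. b < a) ks * prod_list (map2 t (i # I) ks)) =
       (- Q) ^ card {s\<in>S. s < k} * (t i k * rowprod I (S - {k}))" .
  qed
  also have "\<dots> = rowprod (i # I) S" by (simp add: rowprod_def W_def)
  finally show ?case by simp
qed

section \<open>Quantum minors and their Laplace expansions\<close>

definition minor :: "nat set \<Rightarrow> nat set \<Rightarrow> 'r" where
  "minor A S = rowprod (sorted_list_of_set A) S"

lemma minor_row: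
  assumes "finite A" "A \<noteq> {}"
  shows "minor A S = W (Min A) (minor (A - {Min A})) S"
  using sorted_list_of_set_nonempty[OF assms] by (simp add: minor_def[abs_def] rowprod_def)

lemma minor_empty: "minor {} = unit_fun"
  by (auto simp: minor_def rowprod_def)

lemma minor_commute:
  assumes "finite A" "\<And>i j. i \<in> A \<Longrightarrow> j \<in> S \<Longrightarrow> x * t i j = t i j * x"
  shows "x * minor A S = minor A S * x"
  using assms
proof (induction "card A" arbitrary: A S)
  case 0
  then show ?case by (simp add: minor_empty unit_fun_def)
next
  case (Suc c)
  then have ne: "A \<noteq> {}" by auto
  then have Min: "Min A \<in> A" using Suc by simp
  have IH: "x * minor (A - {Min A}) (S - {k}) = minor (A - {Min A}) (S - {k}) * x" for k
    by (rule Suc.hyps(1)) (use Suc.hyps(2) Suc.prems Min in auto)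
  show ?case unfolding minor_row[OF Suc.prems(1) ne] W_def sum_distrib_left sum_distrib_right
  proof (rule sum.cong[OF refl])
    fix k assume k: "k \<in> S"
    let ?M = "minor (A - {Min A}) (S - {k})" and ?c = "(- Q) ^ card {s\<in>S. s < k}"
    have "x * (?c * (t (Min A) k * ?M)) = ?c * (x * t (Min A) k * ?M)"
      by (simp add: central_left_commute[of ?c x] mult.assoc)
    also have "\<dots> = ?c * (t (Min A) k * (x * ?M))" using Suc.prems(2)[OF Min k] by (simp add: mult.assoc)
    finally show "x * (?c * (t (Min A) k * ?M)) = ?c * (t (Min A) k * ?M) * x"
      using IH by (simp add: mult.assoc)
  qed
qed

text \<open>Minors are built row by row, so the expansion along a column has to be proved. Expand
  along the first row, apply the induction hypothesis to the smaller minors that still contain the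
  last column, and exchange the sums. The corner entry in the first row and last column commutes
  with its complementary minor by \<open>anti\<close>, so it can be put on the right like the other
  entries.\<close>

lemma minor_last_column:
  assumes "finite A" "finite S" "card A = card S" "S \<noteq> {}"
  shows "minor A S = V (Max S) (\<lambda>A. minor A (S - {Max S})) A"
  using assms
proof (induction "card A" arbitrary: A S)
  case 0
  then show ?case by auto
next
  case (Suc c)
  define a m where "a = Min A" and "m = Max S"
  have neA: "A \<noteq> {}" using Suc by auto
  have a: "a \<in> A" "\<And>i. i \<in> A \<Longrightarrow> a \<le> i" and m: "m \<in> S" "\<And>k. k \<in> S \<Longrightarrow> k \<le> m"
    unfolding a_def m_def using Suc.prems neA by auto
  let ?A = "A - {a}" and ?S = "S - {m}"
  have "minor A S = (\<Sum>k\<in>S. (- Q) ^ card {s\<in>S. s < k} * (t a k * minor ?A (S - {k})))"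
    using minor_row[OF Suc.prems(1) neA, of S] by (simp add: W_def a_def)
  also have "\<dots> = (- Q) ^ card {s\<in>S. s < m} * (t a m * minor ?A ?S) +
      (\<Sum>k\<in>?S. (- Q) ^ card {s\<in>S. s < k} * (t a k * minor ?A (S - {k})))"
    by (rule sum.remove) (use m Suc.prems in auto)
  also have "(\<Sum>k\<in>?S. (- Q) ^ card {s\<in>S. s < k} * (t a k * minor ?A (S - {k})))
    = (\<Sum>k\<in>?S. \<Sum>i\<in>?A. (- Q) ^ card {s\<in>S. s < k} * (t a k * ((- Q) ^ card {s\<in>A. i < s} *
        (minor (?A - {i}) (?S - {k}) * t i m))))"
  proof (rule sum.cong[OF refl])
    fix k assume k: "k \<in> ?S"
    have Max: "Max (S - {k}) = m" by (rule Max_eqI) (use k m Suc.prems in auto)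
    have "minor ?A (S - {k}) = V m (\<lambda>A. minor A (S - {k} - {m})) ?A"
      unfolding Max[symmetric] by (rule Suc.hyps(1)) (use Suc.hyps(2) Suc.prems a m k in auto)
    moreover have "{s\<in>?A. i < s} = {s\<in>A. i < s}" if "i \<in> ?A" for i
      using a that by fastforce
    moreover have "S - {k} - {m} = ?S - {k}" by auto
    ultimately show "(- Q) ^ card {s\<in>S. s < k} * (t a k * minor ?A (S - {k})) =
       (\<Sum>i\<in>?A. (- Q) ^ card {s\<in>S. s < k} * (t a k * ((- Q) ^ card {s\<in>A. i < s} *
        (minor (?A - {i}) (?S - {k}) * t i m))))"
      by (simp add: V_def sum_distrib_left)
  qed
  also have "\<dots> = (\<Sum>i\<in>?A. \<Sum>k\<in>?S. (- Q) ^ card {s\<in>S. s < k} * (t a k * ((- Q) ^ card {s\<in>A. i < s} *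
        (minor (?A - {i}) (?S - {k}) * t i m))))" by (rule sum.swap)
  also have "\<dots> = (\<Sum>i\<in>?A. (- Q) ^ card {s\<in>A. i < s} * (minor (A - {i}) ?S * t i m))"
  proof (rule sum.cong[OF refl])
    fix i assume i: "i \<in> ?A"
    have Min: "Min (A - {i}) = a" by (rule Min_eqI) (use i a Suc.prems in auto)
    have "minor (A - {i}) ?S = W a (minor (A - {i} - {a})) ?S"
      unfolding Min[symmetric] by (rule minor_row) (use a i Suc.prems in auto)
    moreover have "{s\<in>?S. s < k} = {s\<in>S. s < k}" if "k \<in> ?S" for k
      using m that by fastforce
    moreover have "A - {i} - {a} = ?A - {i}" by auto
    ultimately show "(\<Sum>k\<in>?S. (- Q) ^ card {s\<in>S. s < k} * (t a k * ((- Q) ^ card {s\<in>A. i < s} *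
        (minor (?A - {i}) (?S - {k}) * t i m)))) = (- Q) ^ card {s\<in>A. i < s} * (minor (A - {i}) ?S * t i m)"
      by (simp add: W_def sum_distrib_left sum_distrib_right t_power power_power mult.assoc add.commute)
  qed
  also have "t a m * minor ?A ?S = minor ?A ?S * t a m"
  proof (rule minor_commute)
    fix i j assume "i \<in> ?A" "j \<in> ?S"
    then have "a < i" "j < m" using a m by (auto simp: order.strict_iff_order)
    then show "t a m * t i j = t i j * t a m" by (rule anti)
  qed (use Suc.prems in auto)
  also have "card {s\<in>S. s < m} = card {s\<in>A. a < s}"
  proof -
    have "{s\<in>S. s < m} = ?S" "{s\<in>A. a < s} = ?A" using a m by (auto simp: order.strict_iff_order)
    then show ?thesis using Suc.prems a m by simp
  qed
  also have "(- Q) ^ card {s\<in>A. a < s} * (minor ?A ?S * t a m) +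
      (\<Sum>i\<in>?A. (- Q) ^ card {s\<in>A. i < s} * (minor (A - {i}) ?S * t i m)) =
      (\<Sum>i\<in>A. (- Q) ^ card {s\<in>A. i < s} * (minor (A - {i}) ?S * t i m))"
    by (rule sum.remove[symmetric]) (use a Suc.prems in auto)
  finally show ?case by (simp add: V_def m_def)
qed

text \<open>Connects the two exterior algebras: the column product in decreasing order gives the
  same minors, so the rules for swapping and repeating columns become available for them.\<close>

lemma colprod_eq_minor:
  assumes "sorted_wrt (>) J" "finite A" "card A = length J"
  shows "colprod J A = minor A (set J)"
  using assms
proof (induction J arbitrary: A)
  case Nil
  then show ?case by (simp add: colprod_def minor_empty unit_fun_def)
next
  case (Cons j J)
  have Max: "Max (set (j # J)) = j" by (rule Max_eqI) (use Cons.prems in auto)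
  have J: "set (j # J) - {j} = set J" using Cons.prems by auto
  have "distinct (j # J)" using Cons.prems(1)
    by (metis distinct_rev sorted_wrt_rev strict_sorted_iff rev_rev_ident)
  then have "minor A (set (j # J)) = V j (\<lambda>A. minor A (set J)) A"
    using minor_last_column[of A "set (j # J)"] Cons.prems distinct_card[of "j # J"]
    unfolding Max J by simp
  also have "\<dots> = V j (colprod J) A"
    unfolding V_def by (rule sum.cong) (use Cons in auto)
  finally show ?case by (simp add: colprod_def)
qed

definition qdeterminant :: "nat \<Rightarrow> 'r" where "qdeterminant n = minor {1..n} {1..n}"

lemma sorted_list_of_interval: "sorted_list_of_set {1..n} = [1..<Suc n]"
  by (metis atLeastLessThanSuc_atLeastAtMost sorted_list_of_set_range)

lemma upt_remove: "k \<in> {1..n} \<Longrightarrow> [1..<Suc n] = [1..<k] @ k # [Suc k..<Suc n]"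
  using upt_add_eq_append[of 1 k "Suc n - k"] upt_conv_Cons[of k "Suc n"] by (auto simp del: upt_Suc)

lemma sorted_list_of_set_remove_interval:
  assumes "k \<in> {1..n}"
  shows "sorted_list_of_set ({1..n} - {k}) = [1..<k] @ [Suc k..<Suc n]"
proof -
  have "sorted_list_of_set ({1..n} - {k}) = remove1 k (sorted_list_of_set {1..n})"
    by (rule sorted_list_of_set_remove) simp
  then show ?thesis unfolding sorted_list_of_interval upt_remove[OF assms]
    by (simp add: remove1_append)
qed

text \<open>For i = k the missing row passes the k - 1 smaller rows to its proper place, each for a
  factor -Q. For other i in the range the row i occurs twice and the product vanishes.\<close>

lemma laplace_row:
  assumes i: "i \<in> {1..n}" and k: "k \<in> {1..n}"
  shows "W i (minor ({1..n} - {k})) {1..n} = (if i = k then (- Q) ^ (k - 1) * qdeterminant n else 0)"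
proof -
  let ?I = "[1..<k] @ [Suc k..<Suc n]"
  have minor: "minor ({1..n} - {k}) = rowprod ?I"
    using sorted_list_of_set_remove_interval[OF k] by (auto simp: minor_def)
  show ?thesis
  proof (cases "i = k")
    case True
    have "W k (rowprod ?I) = (\<lambda>S. (- Q) ^ (k - 1) * foldr W [1..<k] (W k (foldr W [Suc k..<Suc n] unit_fun)) S)"
      unfolding rowprod_def foldr_append by (subst W_foldr) auto
    also have "foldr W [1..<k] (W k (foldr W [Suc k..<Suc n] unit_fun)) = rowprod [1..<Suc n]"
      unfolding rowprod_def upt_remove[OF k] by simp
    finally show ?thesis
      unfolding minor qdeterminant_def minor_def sorted_list_of_interval using True by simp
  next
    case False
    have "W i (rowprod ?I) = (\<lambda>S. 0)"
      unfolding rowprod_def by (rule W_foldr_mem) (use False i in \<open>auto simp: sorted_wrt_append\<close>)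
    then show ?thesis unfolding minor using False by simp
  qed
qed

text \<open>The column analogue runs through \<open>colprod\<close>: the missing column passes the n
  - k larger ones.\<close>

lemma laplace_column:
  assumes j: "j \<in> {1..n}" and k: "k \<in> {1..n}"
  shows "V j (\<lambda>A. minor A ({1..n} - {k})) {1..n} = (if j = k then (- Q) ^ (n - k) * qdeterminant n else 0)"
proof -
  let ?J = "rev [Suc k..<Suc n] @ rev [1..<k]"
  have dec: "sorted_wrt (>) (rev xs)" if "sorted_wrt (<) xs" for xs :: "nat list"
    using that by (simp add: sorted_wrt_rev)
  have sorted: "sorted_wrt (>) (rev [Suc k..<Suc n])" "sorted_wrt (>) (rev [1..<k])"
    "sorted_wrt (>) (rev [1..<Suc n])"
    by (rule dec, simp del: upt_Suc)+
  have sortedJ: "sorted_wrt (>) ?J"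
    using sorted(1,2) by (auto simp: sorted_wrt_append)
  have setJ: "set ?J = {1..n} - {k}" using k by auto
  have lenJ: "length ?J = n - 1" using k by auto
  have "V j (\<lambda>A. minor A ({1..n} - {k})) {1..n} = V j (colprod ?J) {1..n}"
    unfolding V_def setJ[symmetric]
    by (intro sum.cong refl, subst colprod_eq_minor[OF sortedJ]) (use lenJ in auto)
  also have "\<dots> = (if j = k then (- Q) ^ (n - k) * qdeterminant n else 0)"
  proof (cases "j = k")
    case True
    have "V k (colprod ?J) = (\<lambda>S. (- Q) ^ (n - k) * foldr V (rev [Suc k..<Suc n]) (V k (foldr V (rev [1..<k]) unit_fun)) S)"
      unfolding colprod_def foldr_append by (subst V_foldr) (auto simp del: upt_Suc)
    also have "foldr V (rev [Suc k..<Suc n]) (V k (foldr V (rev [1..<k]) unit_fun)) = colprod (rev [1..<Suc n])"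
      unfolding colprod_def upt_remove[OF k] by simp
    finally have "V k (colprod ?J) {1..n} = (- Q) ^ (n - k) * colprod (rev [1..<Suc n]) {1..n}"
      by simp
    also have "colprod (rev [1..<Suc n]) {1..n} = qdeterminant n"
    proof -
      have "set (rev [1..<Suc n]) = {1..n}" by auto
      then show ?thesis
        using colprod_eq_minor[OF sorted(3), of "{1..n}"] by (simp add: qdeterminant_def del: upt_Suc)
    qed
    finally show ?thesis using True by simp
  next
    case False
    have "V j (colprod ?J) = (\<lambda>S. 0)"
      unfolding colprod_def by (rule V_foldr_mem[OF sortedJ]) (use False j in auto)
    then show ?thesis using False by simp
  qed
  finally show ?thesis .
qed

text \<open>The quantum adjugate is a left and a right inverse of the matrix up to the determinant, so
  the determinant times an entry can be evaluated in two ways.\<close>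
theorem qdeterminant_central:
  assumes i: "i \<in> {1..n}" and j: "j \<in> {1..n}"
  shows "qdeterminant n * t i j = t i j * qdeterminant n"
proof -
  \<comment> \<open>The entry of the quantum adjugate: (-q) to the power j - k times the
    complementary minor, with \<open>Qi\<close> supplying the negative exponents.\<close>
  define adj where "adj j k = (- Q) ^ j * ((- Qi) ^ k * minor ({1..n} - {k}) ({1..n} - {j}))" for j k
  let ?D = "qdeterminant n"
  have cl: "x * ((- Q) ^ a * y) = (- Q) ^ a * (x * y)" "x * ((- Qi) ^ a * y) = (- Qi) ^ a * (x * y)" for x y a
    by (rule central_left_commute, simp)+
  have QiQ: "(- Qi) ^ a * ((- Q) ^ a * y) = y" for a y
    using power_inverse[of a] central_commute[of "(- Qi) ^ a" "(- Q) ^ a"] by (simp flip: mult.assoc)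
  have card1: "card {s\<in>{1..n}. s < a} = a - 1" if "a \<in> {1..n}" for a
  proof -
    have "{s\<in>{1..n}. s < a} = {1..<a}" using that by auto
    then show ?thesis by simp
  qed
  have card2: "card {s\<in>{1..n}. a < s} = n - a" if "a \<in> {1..n}" for a
  proof -
    have "{s\<in>{1..n}. a < s} = {Suc a..n}" using that by auto
    then show ?thesis by simp
  qed
  have row: "(\<Sum>l\<in>{1..n}. t i l * adj l k) = (if i = k then ?D else 0)" if ik: "i \<in> {1..n}" "k \<in> {1..n}" for i k
  proof -
    have "(\<Sum>l\<in>{1..n}. t i l * adj l k) = (- Qi) ^ k * ((- Q) ^ 1 * W i (minor ({1..n} - {k})) {1..n})"
      unfolding W_def sum_distrib_left
    proof (rule sum.cong[OF refl])
      fix l assume l: "l \<in> {1..n}"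
      show "t i l * adj l k = (- Qi) ^ k * ((- Q) ^ 1 * ((- Q) ^ card {s\<in>{1..n}. s < l} *
         (t i l * minor ({1..n} - {k}) ({1..n} - {l}))))"
        using l unfolding adj_def cl[of "t i l"] cl(1)[of "(- Qi) ^ k"] power_power card1[OF l] by simp
    qed
    also have "\<dots> = (if i = k then ?D else 0)"
    proof (cases "i = k")
      case True
      have "1 + (k - 1) = k" using ik by simp
      then show ?thesis unfolding laplace_row[OF ik] using True
        by (simp only: refl if_True power_power QiQ)
    next
      case False
      then show ?thesis unfolding laplace_row[OF ik] by simp
    qed
    finally show ?thesis .
  qed
  have column: "(\<Sum>l\<in>{1..n}. adj k l * t l j) = (if j = k then ?D else 0)" if jk: "j \<in> {1..n}" "k \<in> {1..n}" for j k
  proof -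
    have "(\<Sum>l\<in>{1..n}. adj k l * t l j) = (- Qi) ^ n * ((- Q) ^ k * V j (\<lambda>A. minor A ({1..n} - {k})) {1..n})"
      unfolding V_def sum_distrib_left
    proof (rule sum.cong[OF refl])
      fix l assume l: "l \<in> {1..n}"
      have "(- Qi) ^ n * (- Q) ^ (n - l) = (- Qi) ^ l"
      proof -
        have "(- Qi) ^ n = (- Qi) ^ l * (- Qi) ^ (n - l)" using l by (simp flip: power_add)
        then show ?thesis using QiQ[of "n - l" 1] by (simp add: mult.assoc)
      qed
      then have *: "(- Qi) ^ n * ((- Q) ^ (n - l) * y) = (- Qi) ^ l * y" for y
        by (simp flip: mult.assoc)
      show "adj k l * t l j = (- Qi) ^ n * ((- Q) ^ k * ((- Q) ^ card {s\<in>{1..n}. l < s} *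
         (minor ({1..n} - {l}) ({1..n} - {k}) * t l j)))"
        unfolding adj_def card2[OF l] cl(1)[of "(- Qi) ^ n" k] * by (simp add: mult.assoc)
    qed
    also have "\<dots> = (if j = k then ?D else 0)"
      unfolding laplace_column[OF jk] using jk by (auto simp: power_power QiQ)
    finally show ?thesis .
  qed
  have "?D * t i j = (\<Sum>k\<in>{1..n}. (if i = k then ?D else 0) * t k j)"
    using i by (simp add: if_distrib[of "\<lambda>x. x * _"] cong: if_cong)
  also have "\<dots> = (\<Sum>k\<in>{1..n}. (\<Sum>l\<in>{1..n}. t i l * adj l k) * t k j)"
    by (intro sum.cong refl) (simp only: row[OF i])
  \<comment> \<open>Associativity of the triple product matrix, adjugate, matrix: the left
    bracketing gives D on the diagonal, and so does the right one.\<close>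
  also have "\<dots> = (\<Sum>l\<in>{1..n}. t i l * (\<Sum>k\<in>{1..n}. adj l k * t k j))"
    unfolding sum_distrib_left sum_distrib_right mult.assoc by (rule sum.swap)
  also have "\<dots> = (\<Sum>l\<in>{1..n}. t i l * (if j = l then ?D else 0))"
    by (intro sum.cong refl) (simp only: column[OF j])
  also have "\<dots> = t i j * ?D"
    using j by (simp add: if_distrib[of "\<lambda>x. _ * x"] cong: if_cong)
  finally show ?thesis .
qed

lemma qdeterminant_expand:
  "qdeterminant n = (\<Sum>ks\<in>permutations_of_set {1..n}.
     (- Q) ^ linv (\<lambda>a b. b < a) ks * prod_list (map2 t [1..<Suc n] ks))"
  unfolding qdeterminant_def minor_def sorted_list_of_interval
  by (rule rowprod_expand) auto

text \<open>The expansion with decreasing rows that the antidiagonal case requires; by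
  \<open>foldr_W_rev\<close> it changes D only by a power of -Q.\<close>

lemma qdeterminant_reverse:
  "\<exists>m. (- Q) ^ m * qdeterminant n = (\<Sum>ks\<in>permutations_of_set {1..n}.
     (- Q) ^ linv (\<lambda>a b. b < a) ks * prod_list (map2 t (rev [1..<Suc n]) ks))"
proof -
  obtain m where "foldr W (rev [1..<Suc n]) unit_fun = (\<lambda>S. (- Q) ^ m * foldr W [1..<Suc n] unit_fun S)"
    using foldr_W_rev by blast
  then have "(- Q) ^ m * qdeterminant n = rowprod (rev [1..<Suc n]) {1..n}"
    unfolding qdeterminant_def minor_def sorted_list_of_interval rowprod_def by metis
  also have "\<dots> = (\<Sum>ks\<in>permutations_of_set {1..n}.
     (- Q) ^ linv (\<lambda>a b. b < a) ks * prod_list (map2 t (rev [1..<Suc n]) ks))"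
    by (rule rowprod_expand) auto
  finally show ?thesis by blast
qed

end

section \<open>Faithful operators and the lexicographic basis\<close>

definition lin :: "('g list \<Rightarrow> ('h, 'a::comm_ring_1) fralg) \<Rightarrow> ('g, 'a) fralg \<Rightarrow> ('h, 'a) fralg" where
  "lin f p = (\<Sum>w\<in>Poly_Mapping.keys p. sc (Poly_Mapping.lookup p w) * f w)"

lemma lin_superset:
  assumes "finite K" "Poly_Mapping.keys p \<subseteq> K"
  shows "lin f p = (\<Sum>w\<in>K. sc (Poly_Mapping.lookup p w) * f w)"
  unfolding lin_def by (rule sum.mono_neutral_left) (use assms in \<open>auto simp: in_keys_iff\<close>)

lemma lin_add: "lin f (p + p') = lin f p + lin f p'"
proof -
  let ?K = "Poly_Mapping.keys p \<union> Poly_Mapping.keys p'"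
  have "lin f (p + p') = (\<Sum>w\<in>?K. sc (Poly_Mapping.lookup (p + p') w) * f w)"
    by (rule lin_superset) (use keys_add[of p p'] in auto)
  also have "\<dots> = lin f p + lin f p'"
    using lin_superset[of ?K p f] lin_superset[of ?K p' f]
    by (simp add: lookup_add sc_add distrib_right sum.distrib)
  finally show ?thesis .
qed

lemma lin_sc: "lin f (sc c * p) = sc c * lin f p"
proof -
  have "lin f (sc c * p) = (\<Sum>w\<in>Poly_Mapping.keys p. sc (Poly_Mapping.lookup (sc c * p) w) * f w)"
    by (rule lin_superset) (auto simp: in_keys_iff lookup_sc_mult)
  then show ?thesis by (simp add: lookup_sc_mult sc_mult mult.assoc lin_def sum_distrib_left)
qed

lemma lin_0 [simp]: "lin f 0 = 0" by (simp add: lin_def)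
lemma lin_word [simp]: "lin f (fa_word w) = f w"
  by (simp add: lin_def fa_word_def)
lemma lin_uminus: "lin f (- p) = - lin f p"
  using lin_sc[of f "- 1" p] by (simp add: sc_uminus)
lemma lin_diff: "lin f (p - p') = lin f p - lin f p'"
  using lin_add[of f p "- p'"] by (simp add: lin_uminus)
lemma lin_sum: "lin f (sum g A) = (\<Sum>x\<in>A. lin f (g x))"
  by (induction A rule: infinite_finite_induct) (simp_all add: lin_add)

lemma fa_on_UNIV [simp]: "p \<in> fa_on UNIV" by (simp add: fa_on_def)

lemma fralg_induct [case_names zero add word]:
  assumes "P 0" "\<And>x y. P x \<Longrightarrow> P y \<Longrightarrow> P (x + y)" "\<And>c w. P (sc c * fa_word w)"
  shows "P p"
  using fa_on_induct[of p UNIV P] assms by auto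

definition qrel :: "'a::comm_ring_1 \<Rightarrow> 'a \<Rightarrow> nat \<times> nat \<Rightarrow> nat \<times> nat \<Rightarrow> (nat \<times> nat, 'a) fralg" where
  "qrel q qi a b = fa_word [a, b] - (\<Sum>(c, x, y)\<leftarrow>qrhs q qi a b. sc c * fa_word [x, y])"

text \<open>One generator for each descending pair of letters, in rewriting form. Up to units these
  are the defining relations, so the ideals agree in \<open>RM_ideal_qrels\<close>.\<close>

definition qrels :: "'a::comm_ring_1 \<Rightarrow> 'a \<Rightarrow> (nat \<times> nat) set \<Rightarrow> (nat \<times> nat, 'a) fralg set" where
  "qrels q qi A = {qrel q qi a b | a b. a \<in> A \<and> b \<in> A \<and> b < a}"

lemma qrel_context:
  "fa_word u * qrel q qi a b * fa_word v =
     fa_word (u @ [a, b] @ v) - (\<Sum>(c, x, y)\<leftarrow>qrhs q qi a b. sc c * fa_word (u @ [x, y] @ v))"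
proof -
  have w: "fa_word u * fa_word [x, y] * fa_word v = fa_word (u @ [x, y] @ v)" for x y
    by (simp add: fa_word_append mult.assoc flip: append_Cons del: append_Cons)
  have "fa_word u * (\<Sum>(c, x, y)\<leftarrow>xs. sc c * fa_word [x, y]) * fa_word v =
     (\<Sum>(c, x, y)\<leftarrow>xs. sc c * fa_word (u @ [x, y] @ v))" for xs
  proof (induction xs)
    case (Cons t xs)
    obtain c x y where "t = (c, x, y)" by (metis surj_pair)
    then show ?case using Cons
      by (simp add: distrib_left distrib_right sc_left_commute[of "fa_word u"] mult.assoc)
         (simp add: w[unfolded mult.assoc])
  qed simp
  then show ?thesis unfolding qrel_def
    by (simp add: left_diff_distrib right_diff_distrib w)
qed

lemma nf_induct [case_names sorted step]:
  assumes "\<And>w. sorted w \<Longrightarrow> P w"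
    and "\<And>u a b v. b < a \<Longrightarrow> (\<And>c x y. (c, x, y) \<in> set (qrhs q qi a b) \<Longrightarrow> P (u @ [x, y] @ v)) \<Longrightarrow>
       P (u @ [a, b] @ v)"
  shows "P w"
proof (induction w rule: wf_induct_rule[OF wf_measures[of "[linv rowR, linv colR]"]])
  case (1 w)
  show ?case
  proof (cases "sorted w")
    case False
    then obtain u a b v where w: "w = u @ [a, b] @ v" "b < a" using not_sorted_descent by blast
    show ?thesis unfolding w(1)
    proof (rule assms(2)[OF w(2)])
      fix c x y assume "(c, x, y) \<in> set (qrhs q qi a b)"
      from small_context[OF qrhs_small[OF w(2) this], of u v]
      have "(u @ [x, y] @ v, w) \<in> measures [linv rowR, linv colR]" unfolding w(1) .
      then show "P (u @ [x, y] @ v)" by (rule 1)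
    qed
  qed (rule assms(1))
qed

lemma lspan_sum_list:
  "(\<And>t. t \<in> set xs \<Longrightarrow> f t \<in> lspan X) \<Longrightarrow> (\<Sum>t\<leftarrow>xs. f t) \<in> lspan X"
  by (induction xs) (auto intro: lspan.zero lspan_add)
lemma fa_ideal_sum_list:
  "(\<And>t. t \<in> set xs \<Longrightarrow> f t \<in> fa_ideal G S) \<Longrightarrow> (\<Sum>t\<leftarrow>xs. f t) \<in> fa_ideal G S"
  by (induction xs) (auto intro: fa_ideal.zero fa_ideal.add)

locale quantum_parameter =
  fixes q qi :: "'a::comm_ring_1"
  assumes q_qi: "q * qi = 1"
begin

text \<open>A rectangular set of letters is closed under rewriting, since the relations only
  recombine the rows and the columns that are present.\<close>

lemma nf_lspan:
  assumes "set w \<subseteq> A \<times> B"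
  shows "nf q qi w \<in> lspan (fa_word ` {w. set w \<subseteq> A \<times> B \<and> sorted w})"
  using assms
proof (induction w rule: nf_induct[where q = q and qi = qi])
  case (sorted w)
  then show ?case by (auto simp: nf_sorted intro: lspan_base)
next
  case (step u a b v)
  have "set (u @ [x, y] @ v) \<subseteq> A \<times> B" if "(c, x, y) \<in> set (qrhs q qi a b)" for c x y
    using step.prems that by (auto simp: qrhs_def split: if_splits)
  with step show ?case unfolding nf_descent[OF q_qi step.hyps]
    by (intro lspan_sum_list) (auto intro!: lspan_sc)
qed

lemma nf_cong_ideal:
  assumes "set w \<subseteq> A \<times> B"
  shows "fa_word w - nf q qi w \<in> fa_ideal (A \<times> B) (qrels q qi (A \<times> B))"
  using assms
proof (induction w rule: nf_induct[where q = q and qi = qi])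
  case (sorted w)
  then show ?case by (simp add: nf_sorted fa_ideal.zero)
next
  case (step u a b v)
  let ?w = "\<lambda>x y. u @ [x, y] @ v"
  have sub: "set (?w x y) \<subseteq> A \<times> B" if "(c, x, y) \<in> set (qrhs q qi a b)" for c x y
    using step.prems that by (auto simp: qrhs_def split: if_splits)
  have "(\<Sum>(c, x, y)\<leftarrow>xs. sc c * (fa_word (?w x y) - nf q qi (?w x y))) =
     (\<Sum>(c, x, y)\<leftarrow>xs. sc c * fa_word (?w x y)) - (\<Sum>(c, x, y)\<leftarrow>xs. sc c * nf q qi (?w x y))" for xs
    by (induction xs) (auto simp: algebra_simps)
  then have "fa_word (?w a b) - nf q qi (?w a b) = fa_word u * qrel q qi a b * fa_word v +
      (\<Sum>(c, x, y)\<leftarrow>qrhs q qi a b. sc c * (fa_word (?w x y) - nf q qi (?w x y)))"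
    unfolding nf_descent[OF q_qi step.hyps] qrel_context by simp
  also have "\<dots> \<in> fa_ideal (A \<times> B) (qrels q qi (A \<times> B))"
  proof (rule fa_ideal.add)
    have "qrel q qi a b \<in> qrels q qi (A \<times> B)"
      unfolding qrels_def using step.prems step.hyps by (intro CollectI exI[of _ a] exI[of _ b]) simp
    then show "fa_word u * qrel q qi a b * fa_word v \<in> fa_ideal (A \<times> B) (qrels q qi (A \<times> B))"
      by (intro fa_ideal_mult fa_ideal.gen) (use step.prems in auto)
    show "(\<Sum>(c, x, y)\<leftarrow>qrhs q qi a b. sc c * (fa_word (?w x y) - nf q qi (?w x y)))
        \<in> fa_ideal (A \<times> B) (qrels q qi (A \<times> B))"
      by (rule fa_ideal_sum_list) (use step.IH sub in \<open>auto intro!: fa_ideal_sc\<close>)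
  qed
  finally show ?case .
qed

definition NF :: "(nat \<times> nat, 'a) fralg \<Rightarrow> (nat \<times> nat, 'a) fralg" where
  "NF = lin (nf q qi)"

lemma NF_cong_ideal:
  assumes "p \<in> fa_on (A \<times> B)"
  shows "p - NF p \<in> fa_ideal (A \<times> B) (qrels q qi (A \<times> B))"
  using assms
proof (induction rule: fa_on_induct)
  case (add x y)
  have "x + y - NF (x + y) = (x - NF x) + (y - NF y)" by (simp add: NF_def lin_add)
  with fa_ideal.add[OF add] show ?case by (simp only:)
next
  case (word c w)
  have "sc c * fa_word w - NF (sc c * fa_word w) = sc c * (fa_word w - nf q qi w)"
    by (simp add: NF_def lin_sc right_diff_distrib)
  then show ?case using nf_cong_ideal[OF word] by (simp add: fa_ideal_sc)
qed (simp add: NF_def fa_ideal.zero)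

lemma NF_lspan:
  assumes "p \<in> fa_on (A \<times> B)"
  shows "NF p \<in> lspan (fa_word ` {w. set w \<subseteq> A \<times> B \<and> sorted w})"
  using assms
  by (induction rule: fa_on_induct)
     (auto simp: NF_def lin_add lin_sc intro: lspan.zero lspan_add lspan_sc nf_lspan)

text \<open>\<open>nf\<close> is not multiplicative, so the induction over the ideal carries
  arbitrary left and right contexts. For a generator the claim is then
  \<open>nf_descent\<close>.\<close>

lemma NF_ideal:
  assumes "x \<in> fa_ideal UNIV (qrels q qi UNIV)"
  shows "NF x = 0"
proof -
  have "NF (fa_word u * x * fa_word v) = 0" for u v
    using assms
  proof (induction arbitrary: u v)
    case (gen r)
    then obtain a b where r: "r = qrel q qi a b" "b < a" by (auto simp: qrels_def)
    have "lin (nf q qi) (\<Sum>(c, x, y)\<leftarrow>xs. sc c * fa_word (u @ [x, y] @ v)) =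
       (\<Sum>(c, x, y)\<leftarrow>xs. sc c * nf q qi (u @ [x, y] @ v))" for xs
      by (induction xs) (auto simp: lin_add lin_sc)
    then show ?case unfolding r(1) qrel_context NF_def lin_diff lin_word
      using nf_descent[OF q_qi r(2), of u v] by simp
  next
    case (add x y)
    then show ?case by (simp add: distrib_left distrib_right NF_def lin_add)
  next
    case (mult x u' v' c)
    have "fa_word u * fa_scal c (fa_mul (fa_word u') (fa_mul x (fa_word v'))) * fa_word v =
       sc c * (fa_word (u @ u') * x * fa_word (v' @ v))"
      by (simp add: fa_simps sc_left_commute[of "fa_word u"] fa_word_append mult.assoc)
    then show ?case using mult.IH[of "u @ u'" "v' @ v"] by (simp add: NF_def lin_sc)
  qed (simp add: NF_def)
  from this[of "[]" "[]"] show ?thesis by simp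
qed

lemma NF_cong: "p - NF p \<in> fa_ideal UNIV (qrels q qi UNIV)"
  using NF_cong_ideal[of p UNIV UNIV] by simp

lemma NF_mult: "NF (u * NF p) = NF (u * p)"
proof -
  have "u * (p - NF p) \<in> fa_ideal UNIV (qrels q qi UNIV)"
    by (rule fa_ideal_mult_left[OF NF_cong]) simp
  from NF_ideal[OF this] show ?thesis by (simp add: right_diff_distrib NF_def lin_diff)
qed

lemma NF_word: "NF (fa_word w) = nf q qi w"
  by (simp add: NF_def)
lemma NF_1 [simp]: "NF 1 = 1"
  using NF_word[of "[]"] by (simp add: nf_sorted)

lemma qrel_simps:
  "j < k \<Longrightarrow> fa_word [(i, j), (i, k)] - sc q * fa_word [(i, k), (i, j)] = - (sc q * qrel q qi (i, k) (i, j))"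
  "i < h \<Longrightarrow> fa_word [(i, k), (h, k)] - sc q * fa_word [(h, k), (i, k)] = - (sc q * qrel q qi (h, k) (i, k))"
  "i < j \<Longrightarrow> k < l \<Longrightarrow> fa_word [(i, l), (j, k)] - fa_word [(j, k), (i, l)] = - qrel q qi (j, k) (i, l)"
  "i < j \<Longrightarrow> k < l \<Longrightarrow> fa_word [(i, k), (j, l)] - fa_word [(j, l), (i, k)] - sc (q - qi) * fa_word [(i, l), (j, k)]
     = - qrel q qi (j, l) (i, k)"
proof -
  have qq: "sc q * (sc qi * x) = x" for x :: "(nat \<times> nat, 'a) fralg"
    by (simp add: q_qi flip: mult.assoc sc_mult)
  show "j < k \<Longrightarrow> fa_word [(i, j), (i, k)] - sc q * fa_word [(i, k), (i, j)] = - (sc q * qrel q qi (i, k) (i, j))"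
    by (simp add: qrel_def qrhs_def right_diff_distrib qq)
  show "i < h \<Longrightarrow> fa_word [(i, k), (h, k)] - sc q * fa_word [(h, k), (i, k)] = - (sc q * qrel q qi (h, k) (i, k))"
    by (simp add: qrel_def qrhs_def right_diff_distrib qq)
  show "i < j \<Longrightarrow> k < l \<Longrightarrow> fa_word [(i, l), (j, k)] - fa_word [(j, k), (i, l)] = - qrel q qi (j, k) (i, l)"
    by (simp add: qrel_def qrhs_def)
  show "i < j \<Longrightarrow> k < l \<Longrightarrow> fa_word [(i, k), (j, l)] - fa_word [(j, l), (i, k)] - sc (q - qi) * fa_word [(i, l), (j, k)]
     = - qrel q qi (j, l) (i, k)"
    by (simp add: qrel_def qrhs_def sc_diff algebra_simps)
qed

lemma qrels_mem: "b < a \<Longrightarrow> a \<in> A \<Longrightarrow> b \<in> A \<Longrightarrow> qrel q qi a b \<in> fa_ideal A (qrels q qi A)"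
  by (rule fa_ideal.gen) (auto simp only: qrels_def)

lemma tq_mult: "fa_mul (tq emb i j) (tq emb k l) = fa_word [emb (i, j), emb (k, l)]"
  by (simp add: tq_def fa_gen_def fa_mul_eq flip: fa_word_append)

lemma RM_ideal_qrels: "fa_ideal (idx n) (RM n q qi) = fa_ideal (idx n) (qrels q qi (idx n))"
proof (intro equalityI subsetI)
  fix x assume "x \<in> fa_ideal (idx n) (RM n q qi)"
  then show "x \<in> fa_ideal (idx n) (qrels q qi (idx n))"
  proof (rule fa_ideal_minimal)
    fix s assume "s \<in> RM n q qi"
    then show "s \<in> fa_ideal (idx n) (qrels q qi (idx n))"
      unfolding RM_def qmat_rels_def tq_mult fa_scal_eq id_apply
      by (elim UnE CollectE exE conjE; hypsubst; simp only: qrel_simps;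
          intro fa_ideal_uminus fa_ideal_sc qrels_mem; simp add: idx_def)
  qed
next
  fix x assume "x \<in> fa_ideal (idx n) (qrels q qi (idx n))"
  then show "x \<in> fa_ideal (idx n) (RM n q qi)"
  proof (rule fa_ideal_minimal)
    fix s assume "s \<in> qrels q qi (idx n)"
    then obtain i k j l where s: "s = qrel q qi (i, k) (j, l)" "(j, l) < (i, k)"
      and idx: "i \<in> {1..n}" "j \<in> {1..n}" "k \<in> {1..n}" "l \<in> {1..n}"
      by (auto simp: qrels_def idx_def)
    note gen = fa_ideal.gen[of _ "RM n q qi" "idx n"]
    note rm = RM_def qmat_rels_def tq_mult fa_scal_eq id_apply Un_iff mem_Collect_eq
    have qiq: "sc qi * (sc q * x) = x" for x :: "(nat \<times> nat, 'a) fralg"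
      by (simp add: q_qi mult.commute[of qi] flip: mult.assoc sc_mult)
    consider "i = j" "l < k" | "k = l" "j < i" | "j < i" "k < l" | "j < i" "l < k"
      using s(2) by fastforce
    then show "s \<in> fa_ideal (idx n) (RM n q qi)"
    proof cases
      case 1
      have "- (sc q * s) \<in> fa_ideal (idx n) (RM n q qi)"
        unfolding s(1) 1(1) qrel_simps(1)[OF 1(2), symmetric] by (rule gen) (unfold rm, use idx 1 in blast)
      from fa_ideal_sc[OF fa_ideal_uminus[OF this], of qi] show ?thesis by (simp add: qiq)
    next
      case 2
      have "- (sc q * s) \<in> fa_ideal (idx n) (RM n q qi)"
        unfolding s(1) 2(1) qrel_simps(2)[OF 2(2), symmetric] by (rule gen) (unfold rm, use idx 2 in blast)
      from fa_ideal_sc[OF fa_ideal_uminus[OF this], of qi] show ?thesis by (simp add: qiq)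
    next
      case 3
      have "- s \<in> fa_ideal (idx n) (RM n q qi)"
        unfolding s(1) qrel_simps(3)[OF 3, symmetric] by (rule gen) (unfold rm, use idx 3 in blast)
      then show ?thesis using fa_ideal_uminus by fastforce
    next
      case 4
      have "- s \<in> fa_ideal (idx n) (RM n q qi)"
        unfolding s(1) qrel_simps(4)[OF 4, symmetric] by (rule gen) (unfold rm, use idx 4 in blast)
      then show ?thesis using fa_ideal_uminus by fastforce
    qed
  qed
qed

lemma NF_RM:
  assumes "x \<in> fa_ideal (idx n) (RM n q qi)"
  shows "NF x = 0"
proof (rule NF_ideal, rule fa_ideal_mono)
  show "x \<in> fa_ideal (idx n) (qrels q qi (idx n))" using assms by (simp add: RM_ideal_qrels)
qed (auto simp: qrels_def)

lemma NF_cong_RM: "p \<in> fa_on (idx n) \<Longrightarrow> p - NF p \<in> fa_ideal (idx n) (RM n q qi)"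
  unfolding RM_ideal_qrels unfolding idx_def by (rule NF_cong_ideal)

lemma NF_eq_0_RM: "p \<in> fa_on (idx n) \<Longrightarrow> NF p = 0 \<Longrightarrow> p \<in> fa_ideal (idx n) (RM n q qi)"
  using NF_cong_RM[of p n] by simp

lemma lookup_sum_words:
  "finite J \<Longrightarrow> Poly_Mapping.lookup (\<Sum>w\<in>J. sc (c w) * fa_word w) w = (if w \<in> J then c w else 0)"
  by (simp add: lookup_sum sc_word lookup_single when_def)

text \<open>An element is congruent to its normal form, which gives spanning. \<open>NF\<close>
  kills the ideal and fixes sorted words, so a relation between sorted words holds already in the
  free algebra.\<close>

lemma sorted_words_basis:
  "pres_basis (GM n) (RM n q qi) fa_word {w. set w \<subseteq> idx n \<and> sorted w}"
  unfolding GM_def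
proof (rule pres_basisI)
  fix p :: "(nat \<times> nat, 'a) fralg" assume p: "p \<in> fa_on (idx n)"
  have "NF p \<in> lspan (fa_ideal (idx n) (RM n q qi) \<union> fa_word ` {w. set w \<subseteq> idx n \<and> sorted w})"
    by (rule lspan_mono[OF NF_lspan[OF p[unfolded idx_def]]]) (auto simp: idx_def)
  moreover have "p - NF p \<in> lspan (fa_ideal (idx n) (RM n q qi) \<union> fa_word ` {w. set w \<subseteq> idx n \<and> sorted w})"
    by (rule lspan_base) (use NF_cong_RM[OF p] in simp)
  ultimately have "(p - NF p) + NF p \<in> lspan (fa_ideal (idx n) (RM n q qi) \<union> fa_word ` {w. set w \<subseteq> idx n \<and> sorted w})"
    by (rule lspan_add[rotated])
  then show "p \<in> lspan (fa_ideal (idx n) (RM n q qi) \<union> fa_word ` {w. set w \<subseteq> idx n \<and> sorted w})" by simp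
next
  fix J c w
  assume J: "finite J" "J \<subseteq> {w. set w \<subseteq> idx n \<and> sorted w}"
    "(\<Sum>w\<in>J. sc (c w) * fa_word w) \<in> fa_ideal (idx n) (RM n q qi)" "w \<in> J"
  have "0 = NF (\<Sum>w\<in>J. sc (c w) * fa_word w)" using NF_RM[OF J(3)] by simp
  also have "\<dots> = (\<Sum>w\<in>J. sc (c w) * nf q qi w)" by (simp add: NF_def lin_sum lin_sc)
  also have "\<dots> = (\<Sum>w\<in>J. sc (c w) * fa_word w)"
    by (rule sum.cong) (use J(2) in \<open>auto simp: nf_sorted\<close>)
  finally have "Poly_Mapping.lookup (\<Sum>w\<in>J. sc (c w) * fa_word w) w = 0" by simp
  then show "c w = 0" using J by (simp add: lookup_sum_words)
qed auto

end

text \<open>Left multiplications on normal forms live in this ring, where the relations hold as equations.\<close>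
typedef (overloaded) ('g, 'a) lend =
  "{f :: ('g, 'a::comm_ring_1) fralg \<Rightarrow> ('g, 'a) fralg.
      (\<forall>x y. f (x + y) = f x + f y) \<and> (\<forall>c x. f (sc c * x) = sc c * f x)}"
  by (rule exI[of _ "\<lambda>x. x"]) simp

setup_lifting type_definition_lend

instantiation lend :: (type, comm_ring_1) ring_1
begin
lift_definition zero_lend :: "('a, 'b) lend" is "\<lambda>x. 0" by simp
lift_definition one_lend :: "('a, 'b) lend" is "\<lambda>x. x" by simp
lift_definition plus_lend :: "('a, 'b) lend \<Rightarrow> ('a, 'b) lend \<Rightarrow> ('a, 'b) lend" is "\<lambda>f g x. f x + g x"
  by (simp add: algebra_simps)
lift_definition uminus_lend :: "('a, 'b) lend \<Rightarrow> ('a, 'b) lend" is "\<lambda>f x. - f x" by simp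
lift_definition minus_lend :: "('a, 'b) lend \<Rightarrow> ('a, 'b) lend \<Rightarrow> ('a, 'b) lend" is "\<lambda>f g x. f x - g x"
  by (simp add: algebra_simps)
lift_definition times_lend :: "('a, 'b) lend \<Rightarrow> ('a, 'b) lend \<Rightarrow> ('a, 'b) lend" is "\<lambda>f g x. f (g x)"
  by simp
instance
proof
  show "(0 :: ('a, 'b) lend) \<noteq> 1"
    by transfer (metis one_neq_zero)
qed (transfer, simp add: algebra_simps fun_eq_iff)+
end

lemma Rep_lend_sum: "Rep_lend (sum f A) x = (\<Sum>a\<in>A. Rep_lend (f a) x)"
  by (induction A rule: infinite_finite_induct) (simp_all add: zero_lend.rep_eq plus_lend.rep_eq)

lift_definition lscal :: "'a::comm_ring_1 \<Rightarrow> ('g, 'a) lend" is "\<lambda>c x. sc c * x"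
  by (simp add: distrib_left sc_left_commute[of "sc _"])

lemma lscal_mult: "lscal (a * b) = lscal a * lscal b"
  by transfer (simp add: fun_eq_iff sc_mult mult.assoc)
lemma lscal_uminus: "lscal (- a) = - lscal a"
  by transfer (simp add: fun_eq_iff sc_uminus)
lemma lscal_1: "lscal 1 = 1"
  by transfer (simp add: fun_eq_iff)
lemma lscal_power: "lscal (a ^ m) = lscal a ^ m"
  by (induction m) (simp_all add: lscal_mult lscal_1)
lemma lscal_central: "lscal c * f = f * lscal c"
  by transfer (simp add: fun_eq_iff)

section \<open>Quantum matrices acting on normal forms\<close>

context quantum_parameter
begin

lift_definition lop :: "nat \<times> nat \<Rightarrow> (nat \<times> nat, 'a) lend" is "\<lambda>a x. NF (fa_word [a] * x)"
  by (simp add: NF_def distrib_left lin_add lin_sc sc_left_commute[of "fa_word _"])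

lemma lop_lop: "Rep_lend (lop a * lop b) x = NF (fa_word [a, b] * x)"
  by (simp add: times_lend.rep_eq lop.rep_eq NF_mult flip: mult.assoc fa_word_append)

text \<open>The assumption serves the empty word, whose operator is the identity and not
  \<open>NF\<close>.\<close>

lemma Rep_prod_lop:
  assumes "NF x = x"
  shows "Rep_lend (prod_list (map lop w)) x = NF (fa_word w * x)"
proof (induction w)
  case Nil
  then show ?case by (simp add: one_lend.rep_eq assms)
next
  case (Cons a w)
  then show ?case
    by (simp add: times_lend.rep_eq lop.rep_eq NF_mult flip: mult.assoc fa_word_append)
qed

lemma qrel_mult_0: "b < a \<Longrightarrow> NF (qrel q qi a b * x) = 0"
  by (intro NF_ideal fa_ideal_mult_right qrels_mem) auto

text \<open>A relation times an arbitrary element lies in the ideal of \<open>qrels\<close>, which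
  \<open>NF\<close> annihilates; hence the two sides of the relation act in the same way.\<close>

sublocale E: quantum_matrix "\<lambda>i j. lop (i, j)" "lscal q" "lscal qi"
proof
  have lift: "f = g" if "\<And>x. Rep_lend f x = Rep_lend g x" for f g :: "(nat \<times> nat, 'a) lend"
    using that by (metis Rep_lend_inject ext)
  have eq0: "NF (u * x) - NF (v * x) = 0" if "NF ((u - v) * x) = 0" for u v x
    using that by (simp add: left_diff_distrib NF_def lin_diff)
  note rep = times_lend.rep_eq[of "lscal _"] minus_lend.rep_eq lscal.rep_eq lop_lop
  have scNF: "sc c * NF x = NF (sc c * x)" for c x by (simp add: NF_def lin_sc)
  have NFd: "NF x - NF y = NF (x - y)" for x y by (simp add: NF_def lin_diff)
  have lscal_diff: "lscal q - lscal qi = (lscal (q - qi) :: (nat \<times> nat, 'a) lend)"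
    by transfer (simp add: fun_eq_iff sc_diff left_diff_distrib)
  have NFm: "NF (- x) = - NF x" for x by (simp add: NF_def lin_uminus)
  show "lscal q * x = x * lscal q" for x :: "(nat \<times> nat, 'a) lend" by (rule lscal_central)
  show "lscal q * lscal qi = (1 :: (nat \<times> nat, 'a) lend)" by (simp add: q_qi lscal_1 flip: lscal_mult)
  show "lop (i, j) * lop (i, k) = lscal q * (lop (i, k) * lop (i, j))" if "j < k" for i j k
  proof (rule lift)
    fix x
    have "NF ((fa_word [(i, j), (i, k)] - sc q * fa_word [(i, k), (i, j)]) * x) = 0"
      using that by (simp add: qrel_simps NFm mult.assoc qrel_mult_0 flip: scNF)
    then show "Rep_lend (lop (i, j) * lop (i, k)) x = Rep_lend (lscal q * (lop (i, k) * lop (i, j))) x"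
      by (simp add: rep scNF left_diff_distrib mult.assoc flip: NFd)
  qed
  show "lop (i, k) * lop (h, k) = lscal q * (lop (h, k) * lop (i, k))" if "i < h" for i h k
  proof (rule lift)
    fix x
    have "NF ((fa_word [(i, k), (h, k)] - sc q * fa_word [(h, k), (i, k)]) * x) = 0"
      using that by (simp add: qrel_simps NFm mult.assoc qrel_mult_0 flip: scNF)
    then show "Rep_lend (lop (i, k) * lop (h, k)) x = Rep_lend (lscal q * (lop (h, k) * lop (i, k))) x"
      by (simp add: rep scNF left_diff_distrib mult.assoc flip: NFd)
  qed
  show "lop (i, l) * lop (j, k) = lop (j, k) * lop (i, l)" if "i < j" "k < l" for i j k l
  proof (rule lift)
    fix x
    have "NF ((fa_word [(i, l), (j, k)] - fa_word [(j, k), (i, l)]) * x) = 0"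
      using that by (simp add: qrel_simps NFm qrel_mult_0)
    then show "Rep_lend (lop (i, l) * lop (j, k)) x = Rep_lend (lop (j, k) * lop (i, l)) x"
      by (simp add: rep left_diff_distrib flip: NFd)
  qed
  show "lop (i, k) * lop (j, l) - lop (j, l) * lop (i, k) = (lscal q - lscal qi) * (lop (i, l) * lop (j, k))"
    if "i < j" "k < l" for i j k l
  proof (rule lift)
    fix x
    have "NF ((fa_word [(i, k), (j, l)] - fa_word [(j, l), (i, k)] - sc (q - qi) * fa_word [(i, l), (j, k)]) * x) = 0"
      using that by (simp add: qrel_simps NFm qrel_mult_0)
    then show "Rep_lend (lop (i, k) * lop (j, l) - lop (j, l) * lop (i, k)) x =
        Rep_lend ((lscal q - lscal qi) * (lop (i, l) * lop (j, k))) x"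
      unfolding lscal_diff by (simp add: rep scNF left_diff_distrib mult.assoc flip: NFd)
  qed
qed

declare upt_Suc [simp del]

text \<open>Permutations are in one-line notation; \<open>I\<close> lists the rows in the order of the factors.\<close>
definition rowdet :: "nat list \<Rightarrow> nat \<Rightarrow> (nat \<times> nat, 'a) fralg" where
  "rowdet I n = (\<Sum>ks\<in>permutations_of_set {1..n}.
     sc ((- q) ^ linv (\<lambda>a b. b < a) ks) * fa_word (zip I ks))"

abbreviation "qD n \<equiv> rowdet [1..<Suc n] n"

lemma map2_lop: "map2 (\<lambda>i j. lop (i, j)) I ks = map lop (zip I ks)"
  by simp

lemma Rep_rowdet:
  assumes "NF x = x"
  shows "Rep_lend (\<Sum>ks\<in>permutations_of_set {1..n}.
     (- lscal q) ^ linv (\<lambda>a b. b < a) ks * prod_list (map2 (\<lambda>i j. lop (i, j)) I ks)) x = NF (rowdet I n * x)"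
proof -
  have "(- lscal q) ^ m = (lscal ((- q) ^ m) :: (nat \<times> nat, 'a) lend)" for m
    by (simp add: lscal_power lscal_uminus)
  then show ?thesis
    unfolding map2_lop Rep_lend_sum rowdet_def sum_distrib_right
    by (simp add: times_lend.rep_eq lscal.rep_eq Rep_prod_lop[OF assms] NF_def lin_sum lin_sc mult.assoc
        del: Rep_prod_lop)
qed

lemma rowdet_on: "set I \<subseteq> {1..n} \<Longrightarrow> rowdet I n \<in> fa_on (idx n)"
  unfolding rowdet_def
  by (intro fa_on_sum fa_on_mult)
     (auto simp: permutations_of_set_def idx_def dest: set_zip_leftD set_zip_rightD)

lemma qD_on: "qD n \<in> fa_on (idx n)"
  by (rule rowdet_on) auto

text \<open>The operator identity for the central determinant, evaluated at 1, compares normal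
  forms, and equal normal forms mean congruence modulo the relations.\<close>

lemma qD_commute_gen:
  assumes "a \<in> idx n"
  shows "qD n * fa_word [a] - fa_word [a] * qD n \<in> fa_ideal (idx n) (RM n q qi)"
proof (rule NF_eq_0_RM)
  obtain i j where a: "a = (i, j)" "i \<in> {1..n}" "j \<in> {1..n}" using assms by (auto simp: idx_def)
  have NFa: "NF (fa_word [a]) = fa_word [a]" by (simp add: NF_word nf_sorted)
  have "Rep_lend (E.qdeterminant n * lop a) 1 = Rep_lend (lop a * E.qdeterminant n) 1"
    using E.qdeterminant_central[OF a(2,3)] unfolding a(1) by simp
  then have "NF (qD n * fa_word [a]) = NF (fa_word [a] * qD n)"
    unfolding E.qdeterminant_expand times_lend.rep_eq Rep_rowdet[OF NF_1] lop.rep_eq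
    using Rep_rowdet[OF NFa] by (simp add: NFa NF_mult)
  then show "NF (qD n * fa_word [a] - fa_word [a] * qD n) = 0" by (simp add: NF_def lin_diff)
  show "qD n * fa_word [a] - fa_word [a] * qD n \<in> fa_on (idx n)"
    using qD_on assms by (intro fa_on_diff fa_on_mult) auto
qed

lemma qD_reverse:
  "\<exists>m. sc ((- q) ^ m) * qD n - rowdet (rev [1..<Suc n]) n \<in> fa_ideal (idx n) (RM n q qi)"
proof -
  obtain m where m: "(- lscal q) ^ m * E.qdeterminant n = (\<Sum>ks\<in>permutations_of_set {1..n}.
     (- lscal q) ^ linv (\<lambda>a b. b < a) ks * prod_list (map2 (\<lambda>i j. lop (i, j)) (rev [1..<Suc n]) ks))"
    using E.qdeterminant_reverse by blast
  have "(- lscal q) ^ m = (lscal ((- q) ^ m) :: (nat \<times> nat, 'a) lend)"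
    by (simp add: lscal_power lscal_uminus)
  then have "Rep_lend (lscal ((- q) ^ m) * E.qdeterminant n) 1 = NF (rowdet (rev [1..<Suc n]) n)"
    using Rep_rowdet[OF NF_1] m by simp
  then have "NF (sc ((- q) ^ m) * qD n) = NF (rowdet (rev [1..<Suc n]) n)"
    unfolding E.qdeterminant_expand times_lend.rep_eq lscal.rep_eq Rep_rowdet[OF NF_1]
    by (simp add: NF_def lin_sc)
  then have "NF (sc ((- q) ^ m) * qD n - rowdet (rev [1..<Suc n]) n) = 0" by (simp add: NF_def lin_diff)
  moreover have "rowdet (rev [1..<Suc n]) n \<in> fa_on (idx n)" by (rule rowdet_on) auto
  ultimately show ?thesis using qD_on by (intro exI[of _ m] NF_eq_0_RM fa_on_diff fa_on_mult) auto
qed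

lemma qD_commute:
  assumes "p \<in> fa_on (idx n)"
  shows "qD n * p - p * qD n \<in> fa_ideal (idx n) (RM n q qi)"
  using assms
proof (induction rule: fa_on_induct)
  case (add x y)
  have "qD n * (x + y) - (x + y) * qD n = (qD n * x - x * qD n) + (qD n * y - y * qD n)"
    by (simp add: algebra_simps)
  with fa_ideal.add[OF add] show ?case by (simp only:)
next
  case (word c w)
  then have "qD n * fa_word w - fa_word w * qD n \<in> fa_ideal (idx n) (RM n q qi)"
  proof (induction w)
    case (Cons a w)
    have "qD n * fa_word (a # w) - fa_word (a # w) * qD n =
       (qD n * fa_word [a] - fa_word [a] * qD n) * fa_word w + fa_word [a] * (qD n * fa_word w - fa_word w * qD n)"
      by (simp add: fa_word_Cons[of a w] algebra_simps)
    also have "\<dots> \<in> fa_ideal (idx n) (RM n q qi)"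
      using Cons qD_commute_gen[of a n]
      by (intro fa_ideal.add fa_ideal_mult_left fa_ideal_mult_right) auto
    finally show ?case .
  qed (simp add: fa_ideal.zero)
  moreover have "qD n * (sc c * fa_word w) - sc c * fa_word w * qD n = sc c * (qD n * fa_word w - fa_word w * qD n)"
    by (simp only: right_diff_distrib mult.assoc sc_left_commute[of "qD n"])
  ultimately show ?case by (simp only: fa_ideal_sc)
qed (simp add: fa_ideal.zero)

end

section \<open>Permutations in one-line notation and their length\<close>

lemma linv_map_sorted:
  "sorted_wrt (<) L \<Longrightarrow> linv (\<lambda>a b. b < a) (map \<sigma> L) =
     card {(i, j). i \<in> set L \<and> j \<in> set L \<and> i < j \<and> \<sigma> j < (\<sigma> i :: nat)}" for L :: "nat list"
proof (induction L)
  case (Cons x L)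
  let ?P = "\<lambda>L. {(i, j). i \<in> set L \<and> j \<in> set L \<and> i < j \<and> \<sigma> j < \<sigma> i}"
  let ?X = "Pair x ` {j\<in>set L. \<sigma> j < \<sigma> x}"
  have "?P (x # L) = ?X \<union> ?P L" using Cons.prems by (auto simp: image_iff)
  moreover have "finite (?P L)" by (rule finite_subset[of _ "set L \<times> set L"]) auto
  moreover have "?X \<inter> ?P L = {}" using Cons.prems by auto
  ultimately have "card (?P (x # L)) = card ?X + card (?P L)" by (simp add: card_Un_disjoint)
  also have "card ?X = card {j\<in>set L. \<sigma> j < \<sigma> x}" by (intro card_image) (auto simp: inj_on_def)
  also have "\<dots> = length (filter (\<lambda>j. \<sigma> j < \<sigma> x) L)"
    using distinct_length_filter[of L "\<lambda>j. \<sigma> j < \<sigma> x"] Cons.prems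
    by (auto simp: Int_def conj_commute strict_sorted_iff)
  finally show ?case using Cons by (simp add: filter_map comp_def)
qed simp

lemma zip_map_same: "zip L (map f L) = map (\<lambda>i. (i, f i)) L"
  by (induction L) simp_all

lemma bij_betw_one_line:
  "bij_betw (\<lambda>\<sigma>. map \<sigma> [1..<Suc n]) {\<sigma>. \<sigma> permutes {1..n}} (permutations_of_set {1..n})"
proof -
  have set: "set [1..<Suc n] = {1..n}" by auto
  have inj: "inj_on (\<lambda>\<sigma>. map \<sigma> [1..<Suc n]) {\<sigma>. \<sigma> permutes {1..n}}"
  proof (rule inj_onI, rule ext)
    fix \<sigma> \<tau> x
    assume *: "\<sigma> \<in> {\<sigma>. \<sigma> permutes {1..n}}" "\<tau> \<in> {\<sigma>. \<sigma> permutes {1..n}}"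
      "map \<sigma> [1..<Suc n] = map \<tau> [1..<Suc n]"
    show "\<sigma> x = \<tau> x"
    proof (cases "x \<in> {1..n}")
      case True
      then show ?thesis using *(3) set by auto
    next
      case False
      then show ?thesis using *(1,2) by (metis mem_Collect_eq permutes_not_in)
    qed
  qed
  have "(\<lambda>\<sigma>. map \<sigma> [1..<Suc n]) ` {\<sigma>. \<sigma> permutes {1..n}} \<subseteq> permutations_of_set {1..n}"
  proof clarify
    fix \<sigma> assume \<sigma>: "\<sigma> permutes {1..n}"
    have "set (map \<sigma> [1..<Suc n]) = {1..n}" using set permutes_image[OF \<sigma>] by (simp)
    moreover have "distinct (map \<sigma> [1..<Suc n])"
      using permutes_inj[OF \<sigma>] by (auto simp: distinct_map inj_on_def)
    ultimately show "map \<sigma> [1..<Suc n] \<in> permutations_of_set {1..n}" by (rule permutations_of_setI)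
  qed
  \<comment> \<open>Source and target both have n! elements, so the injection is onto.\<close>
  moreover have "card ((\<lambda>\<sigma>. map \<sigma> [1..<Suc n]) ` {\<sigma>. \<sigma> permutes {1..n}}) = card (permutations_of_set {1..n})"
    by (subst card_image[OF inj], subst card_permutations[of "{1..n}" n]) simp_all
  ultimately have "(\<lambda>\<sigma>. map \<sigma> [1..<Suc n]) ` {\<sigma>. \<sigma> permutes {1..n}} = permutations_of_set {1..n}"
    by (rule card_subset_eq[OF finite_permutations_of_set])
  with inj show ?thesis by (simp only: bij_betw_def)
qed

lemma (in quantum_parameter) qdet_eq:
  "qdet n q emb = (\<Sum>ks\<in>permutations_of_set {1..n}.
     sc ((- q) ^ linv (\<lambda>a b. b < a) ks) * fa_word (map emb (zip [1..<Suc n] ks)))"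
proof -
  have "qdet n q emb = (\<Sum>\<sigma>\<in>{\<sigma>. \<sigma> permutes {1..n}}.
     sc ((- q) ^ linv (\<lambda>a b. b < a) (map \<sigma> [1..<Suc n])) *
     fa_word (map emb (zip [1..<Suc n] (map \<sigma> [1..<Suc n]))))"
    unfolding qdet_def fa_scal_eq
  proof (rule sum.cong[OF refl])
    fix \<sigma> assume "\<sigma> \<in> {\<sigma>. \<sigma> permutes {1..n}}"
    have "set [1..<Suc n] = {1..n}" by auto
    then have "perm_length n \<sigma> = linv (\<lambda>a b. b < a) (map \<sigma> [1..<Suc n])"
      unfolding perm_length_def by (subst linv_map_sorted) simp_all
    then show "sc ((- q) ^ perm_length n \<sigma>) * fa_word (map (\<lambda>i. emb (i, \<sigma> i)) [1..<n + 1]) =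
       sc ((- q) ^ linv (\<lambda>a b. b < a) (map \<sigma> [1..<Suc n])) *
       fa_word (map emb (zip [1..<Suc n] (map \<sigma> [1..<Suc n])))"
      unfolding zip_map_same by (simp add: comp_def)
  qed
  also have "\<dots> = (\<Sum>ks\<in>permutations_of_set {1..n}.
     sc ((- q) ^ linv (\<lambda>a b. b < a) ks) * fa_word (map emb (zip [1..<Suc n] ks)))"
    by (rule sum.reindex_bij_betw[OF bij_betw_one_line])
  finally show ?thesis .
qed

lemma (in quantum_parameter) qdet_id: "qdet n q id = qD n"
  by (simp add: qdet_eq rowdet_def)

section \<open>Ordered words\<close>

lemma sorted_wrt_mset_unique:
  assumes "antisym r" "sorted_wrt (\<lambda>x y. (x, y) \<in> r) xs" "sorted_wrt (\<lambda>x y. (x, y) \<in> r) ys"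
    "mset xs = mset ys"
  shows "xs = ys"
  using assms(2-)
proof (induction xs arbitrary: ys)
  case (Cons x xs)
  then obtain y ys' where ys: "ys = y # ys'" by (cases ys) auto
  have "x = y"
  proof (rule ccontr)
    assume "x \<noteq> y"
    moreover have "set (x # xs) = set ys" using Cons.prems(3) by (metis set_mset_mset)
    ultimately have "y \<in> set xs" "x \<in> set ys'" using ys by auto
    then have "(x, y) \<in> r" "(y, x) \<in> r" using Cons.prems ys by auto
    with assms(1) \<open>x \<noteq> y\<close> show False by (auto dest: antisymD)
  qed
  then show ?case using Cons ys by auto
qed simp

lemma linear_order_onD:
  assumes "linear_order_on A r"
  shows "\<And>x. x \<in> A \<Longrightarrow> (x, x) \<in> r" "antisym r" "trans r"
    "\<And>x y. x \<in> A \<Longrightarrow> y \<in> A \<Longrightarrow> (x, y) \<in> r \<or> (y, x) \<in> r"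
proof -
  show refl: "\<And>x. x \<in> A \<Longrightarrow> (x, x) \<in> r" and "antisym r" "trans r"
    using assms by (auto simp: order_on_defs dest: refl_onD)
  show "(x, y) \<in> r \<or> (y, x) \<in> r" if "x \<in> A" "y \<in> A" for x y
    using assms refl that by (cases "x = y") (auto simp: order_on_defs total_on_def)
qed

lemma exists_greatest:
  assumes "linear_order_on A r" "finite B" "B \<noteq> {}" "B \<subseteq> A"
  shows "\<exists>m\<in>B. \<forall>x\<in>B. (x, m) \<in> r"
  using assms(2-)
proof (induction B rule: finite_ne_induct)
  case (singleton x)
  then show ?case using linear_order_onD(1)[OF assms(1)] by auto
next
  case (insert x B)
  then obtain m where m: "m \<in> B" "\<And>y. y \<in> B \<Longrightarrow> (y, m) \<in> r" by auto
  show ?case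
  proof (cases "(x, m) \<in> r")
    case True
    then show ?thesis using m by auto
  next
    case False
    then have "(m, x) \<in> r" using linear_order_onD(4)[OF assms(1), of x m] insert.prems m by auto
    then have "(y, x) \<in> r" if "y \<in> B" for y
      using m(2)[OF that] linear_order_onD(3)[OF assms(1)] by (meson transD)
    then show ?thesis using linear_order_onD(1)[OF assms(1), of x] insert.prems by auto
  qed
qed

lemma exists_enumeration:
  assumes "linear_order_on A r" "finite B" "B \<subseteq> A"
  shows "\<exists>xs. set xs = B \<and> distinct xs \<and> sorted_wrt (\<lambda>x y. (x, y) \<in> r) xs"
  using assms(2-)
proof (induction "card B" arbitrary: B)
  case 0
  then show ?case by (intro exI[of _ "[]"]) auto
next
  case (Suc c)
  then have "B \<noteq> {}" by auto
  then obtain m where m: "m \<in> B" "\<forall>x\<in>B. (x, m) \<in> r"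
    using exists_greatest[OF assms(1) Suc.prems(1) _ Suc.prems(2)] by auto
  have "\<exists>xs. set xs = B - {m} \<and> distinct xs \<and> sorted_wrt (\<lambda>x y. (x, y) \<in> r) xs"
    by (rule Suc.hyps(1)) (use Suc m in auto)
  then obtain xs where "set xs = B - {m}" "distinct xs" "sorted_wrt (\<lambda>x y. (x, y) \<in> r) xs" by blast
  then show ?case using m by (intro exI[of _ "xs @ [m]"]) (auto simp: sorted_wrt_append)
qed

lemma sorted_enum:
  assumes "linear_order_on A r" "finite A"
  shows "set (sorted_enum r A) = A" "distinct (sorted_enum r A)"
    "sorted_wrt (\<lambda>x y. (x, y) \<in> r) (sorted_enum r A)"
proof -
  have "\<exists>!xs. set xs = A \<and> distinct xs \<and> sorted_wrt (\<lambda>x y. (x, y) \<in> r) xs"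
  proof (rule ex_ex1I)
    show "\<exists>xs. set xs = A \<and> distinct xs \<and> sorted_wrt (\<lambda>x y. (x, y) \<in> r) xs"
      using exists_enumeration[OF assms order_refl] .
    fix xs ys
    assume "set xs = A \<and> distinct xs \<and> sorted_wrt (\<lambda>x y. (x, y) \<in> r) xs"
      "set ys = A \<and> distinct ys \<and> sorted_wrt (\<lambda>x y. (x, y) \<in> r) ys"
    then show "xs = ys"
      using sorted_wrt_mset_unique[OF linear_order_onD(2)[OF assms(1)], of xs ys]
      by (metis set_eq_iff_mset_eq_distinct)
  qed
  from theI'[OF this] show "set (sorted_enum r A) = A" "distinct (sorted_enum r A)"
    "sorted_wrt (\<lambda>x y. (x, y) \<in> r) (sorted_enum r A)"
    unfolding sorted_enum_def by auto
qed

lemma mono_word_sorted: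
  assumes "linear_order_on A r" "finite A"
  shows "sorted_wrt (\<lambda>x y. (x, y) \<in> r) (mono_word r A N)"
proof -
  have "sorted_wrt (\<lambda>x y. (x, y) \<in> r) (concat (map (\<lambda>p. replicate (N p) p) xs))"
    if "sorted_wrt (\<lambda>x y. (x, y) \<in> r) xs" "set xs \<subseteq> A" for xs
    using that
  proof (induction xs)
    case (Cons x xs)
    have "sorted_wrt (\<lambda>x y. (x, y) \<in> r) (replicate k x)" for k
      using linear_order_onD(1)[OF assms(1), of x] Cons.prems by (induction k) auto
    then show ?case using Cons by (auto simp: sorted_wrt_append)
  qed simp
  then show ?thesis unfolding mono_word_def using sorted_enum[OF assms] by simp
qed

lemma count_mono_word:
  assumes "linear_order_on A r" "finite A"
  shows "count (mset (mono_word r A N)) p = (if p \<in> A then N p else 0)"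
proof -
  have "count (mset (concat (map (\<lambda>p. replicate (N p) p) xs))) p = (if p \<in> set xs then N p else 0)"
    if "distinct xs" for xs
    using that by (induction xs) auto
  then show ?thesis unfolding mono_word_def using sorted_enum[OF assms] by simp
qed

lemma set_mono_word:
  assumes "linear_order_on A r" "finite A"
  shows "set (mono_word r A N) \<subseteq> A"
proof
  fix p assume "p \<in> set (mono_word r A N)"
  then have "count (mset (mono_word r A N)) p \<noteq> 0" by (simp add: count_mset_0_iff)
  then show "p \<in> A" unfolding count_mono_word[OF assms] by (auto split: if_splits)
qed

lemma mono_word_eqI:
  assumes "linear_order_on A r" "finite A" "set w \<subseteq> A" "sorted_wrt (\<lambda>x y. (x, y) \<in> r) w"
    "\<And>p. p \<in> A \<Longrightarrow> N p = count (mset w) p"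
  shows "mono_word r A N = w"
proof (rule sorted_wrt_mset_unique[OF linear_order_onD(2)[OF assms(1)] mono_word_sorted[OF assms(1,2)] assms(4)])
  show "mset (mono_word r A N) = mset w"
  proof (rule multiset_eqI)
    fix p show "count (mset (mono_word r A N)) p = count (mset w) p"
      using assms(3,5) by (auto simp: count_mono_word[OF assms(1,2)] count_mset_0_iff)
  qed
qed

lemma finite_idx [simp]: "finite (idx n)" by (simp add: idx_def)

text \<open>Reduces a statement about all rearrangements to two-letter swaps. It is used for
  straightening up to units and lower terms, and for the exact commutation of antidiagonal
  letters.\<close>

lemma perm_relation:
  assumes "mset w = mset w'" "set w \<subseteq> P"
    and refl: "\<And>w. R w w" and trans: "\<And>w w' w''. R w w' \<Longrightarrow> R w' w'' \<Longrightarrow> R w w''"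
    and ctx: "\<And>u w w' v. R w w' \<Longrightarrow> set u \<subseteq> P \<Longrightarrow> set v \<subseteq> P \<Longrightarrow> R (u @ w @ v) (u @ w' @ v)"
    and swap: "\<And>x y. x \<in> P \<Longrightarrow> y \<in> P \<Longrightarrow> R [x, y] [y, x]"
  shows "R w w'"
  using assms(1,2)
proof (induction w arbitrary: w')
  case (Cons x w)
  have move: "R (x # ys) (ys @ [x])" if "set ys \<subseteq> P" for ys
    using that
  proof (induction ys)
    case (Cons y ys)
    have 1: "R ([] @ [x, y] @ ys) ([] @ [y, x] @ ys)"
      by (rule ctx[OF swap]) (use Cons.prems \<open>set (x # w) \<subseteq> P\<close> in auto)
    have 2: "R ([y] @ (x # ys) @ []) ([y] @ (ys @ [x]) @ [])"
      by (rule ctx[OF Cons.IH]) (use Cons.prems in auto)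
    from trans[of "x # y # ys" "y # x # ys" "y # ys @ [x]"] 1 2 show ?case by simp
  qed (simp add: refl)
  have "x \<in> set w'" using Cons.prems(1) by (metis list.set_intros(1) set_mset_mset)
  then obtain ys zs where w': "w' = ys @ x # zs" by (meson split_list)
  then have mset: "mset w = mset (ys @ zs)" using Cons.prems(1) by simp
  then have sub: "set ys \<subseteq> P" "set zs \<subseteq> P" using Cons.prems(2) mset_eq_setD[OF mset] by auto
  have 1: "R ([x] @ w @ []) ([x] @ (ys @ zs) @ [])"
    by (rule ctx[OF Cons.IH[OF mset]]) (use Cons.prems in auto)
  have 2: "R ([] @ (x # ys) @ zs) ([] @ (ys @ [x]) @ zs)"
    by (rule ctx[OF move]) (use sub in auto)
  from trans[of "x # w" "x # ys @ zs" "ys @ x # zs"] 1 2 show ?case unfolding w' by simp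
qed (simp add: refl)

definition stat :: "(nat \<times> nat) list \<Rightarrow> nat" where
  "stat w = (\<Sum>a\<leftarrow>w. fst a * snd a)"

lemma stat_simps [simp]: "stat [] = 0" "stat (a # w) = fst a * snd a + stat w" "stat (u @ v) = stat u + stat v"
  by (simp_all add: stat_def)

lemma stat_mset: "mset w = mset w' \<Longrightarrow> stat w = stat w'"
  unfolding stat_def sum_mset_sum_list[symmetric] mset_map by simp

text \<open>The exchange term must stay inside the chosen letters when a word is straightened. This
  is needed for all letters, and separately for those below and those above the
  antidiagonal.\<close>

definition exchange_closed :: "(nat \<times> nat) set \<Rightarrow> bool" where
  "exchange_closed P \<longleftrightarrow> (\<forall>i j k l. (i, k) \<in> P \<longrightarrow> (j, l) \<in> P \<longrightarrow> i < j \<longrightarrow> k < l \<longrightarrow> (i, l) \<in> P \<and> (j, k) \<in> P)"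

locale quantum_matrices = quantum_parameter q qi for q qi :: "'a::comm_ring_1" +
  fixes n :: nat
begin

abbreviation "J \<equiv> fa_ideal (idx n) (RM n q qi)"

text \<open>Linear combinations modulo the relations, as a membership statement, so that lower terms
  can be bounded without naming their coefficients.\<close>

definition Sp :: "(nat \<times> nat, 'a) fralg set \<Rightarrow> (nat \<times> nat, 'a) fralg set" where
  "Sp X = lspan (J \<union> X)"

lemma Sp_base: "x \<in> X \<Longrightarrow> x \<in> Sp X" by (simp add: Sp_def lspan_base)
lemma Sp_J: "x \<in> J \<Longrightarrow> x \<in> Sp X" by (simp add: Sp_def lspan_base)
lemma Sp_add: "x \<in> Sp X \<Longrightarrow> y \<in> Sp X \<Longrightarrow> x + y \<in> Sp X" by (simp add: Sp_def lspan_add)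
lemma Sp_sc: "x \<in> Sp X \<Longrightarrow> sc c * x \<in> Sp X" by (simp add: Sp_def lspan_sc)
lemma Sp_sum: "(\<And>a. a \<in> A \<Longrightarrow> f a \<in> Sp X) \<Longrightarrow> sum f A \<in> Sp X" by (simp add: Sp_def lspan_sum)
lemma Sp_zero: "0 \<in> Sp X" by (simp add: Sp_def lspan.zero)
lemma Sp_minimal: "x \<in> Sp X \<Longrightarrow> (\<And>x. x \<in> X \<Longrightarrow> x \<in> Sp Y) \<Longrightarrow> x \<in> Sp Y"
  unfolding Sp_def by (erule lspan_minimal) (auto intro: lspan_base)
lemma Sp_mono: "x \<in> Sp X \<Longrightarrow> X \<subseteq> Y \<Longrightarrow> x \<in> Sp Y"
  by (erule Sp_minimal) (auto intro: Sp_base)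
lemma Sp_cong: "x - y \<in> J \<Longrightarrow> y \<in> Sp X \<Longrightarrow> x \<in> Sp X"
  using Sp_add[of "x - y" X y] Sp_J by simp
lemma Sp_map:
  assumes "x \<in> Sp X" "\<And>x. x \<in> X \<Longrightarrow> p * x * p' \<in> Sp Y" "p \<in> fa_on (idx n)" "p' \<in> fa_on (idx n)"
  shows "p * x * p' \<in> Sp Y"
  unfolding Sp_def
  by (rule lspan_map[OF assms(1)[unfolded Sp_def]])
     (use assms(2-) in \<open>auto intro: lspan_base fa_ideal_mult simp: Sp_def\<close>)
lemma Sp_map_left:
  assumes "x \<in> Sp X" "\<And>x. x \<in> X \<Longrightarrow> p * x \<in> Sp Y" "p \<in> fa_on (idx n)"
  shows "p * x \<in> Sp Y"
  using Sp_map[of x X p 1 Y] assms by simp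
lemma Sp_map_right:
  assumes "x \<in> Sp X" "\<And>x. x \<in> X \<Longrightarrow> x * p \<in> Sp Y" "p \<in> fa_on (idx n)"
  shows "x * p \<in> Sp Y"
  using Sp_map[of x X 1 p Y] assms by simp

lemma Sp_mult:
  assumes "x \<in> Sp X" "y \<in> Sp Y" "x \<in> fa_on (idx n)" "Y \<subseteq> fa_on (idx n)"
    "\<And>x y. x \<in> X \<Longrightarrow> y \<in> Y \<Longrightarrow> x * y \<in> Sp Z"
  shows "x * y \<in> Sp Z"
  using assms(2)
proof (rule Sp_map_left)
  fix y assume y: "y \<in> Y"
  show "x * y \<in> Sp Z"
    by (rule Sp_map_right[OF assms(1)]) (use assms(4,5) y in auto)
qed (rule assms(3))

lemma J_mult_word: "x \<in> J \<Longrightarrow> set u \<subseteq> idx n \<Longrightarrow> set v \<subseteq> idx n \<Longrightarrow> fa_word u * x * fa_word v \<in> J"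
  by (rule fa_ideal_mult) auto

lemma J_sym: "x - y \<in> J \<Longrightarrow> y - x \<in> J"
  using fa_ideal_uminus[of "x - y"] by simp
lemma J_trans: "x - y \<in> J \<Longrightarrow> y - z \<in> J \<Longrightarrow> x - z \<in> J"
  using fa_ideal.add[of "x - y" _ _ "y - z"] by simp

lemma J_word_context:
  assumes "fa_word w - fa_word w' \<in> J" "set u \<subseteq> idx n" "set v \<subseteq> idx n"
  shows "fa_word (u @ w @ v) - fa_word (u @ w' @ v) \<in> J"
  using J_mult_word[OF assms] by (simp add: fa_word_append algebra_simps)

lemma qrel_J: "b < a \<Longrightarrow> a \<in> idx n \<Longrightarrow> b \<in> idx n \<Longrightarrow> qrel q qi a b \<in> J"
  unfolding RM_ideal_qrels by (rule qrels_mem)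

lemma exchange_descent:
  assumes ab: "b < a" "a \<in> idx n" "b \<in> idx n"
  shows "\<exists>u u'. u' * u = 1 \<and> (fa_word [a, b] - sc u * fa_word [b, a] \<in> J \<or>
     (fst b < fst a \<and> snd b < snd a \<and> (\<exists>v. fa_word [a, b] - sc u * fa_word [b, a] -
        sc v * fa_word [(fst b, snd a), (fst a, snd b)] \<in> J)))"
proof -
  have "q * qi = 1" by (rule q_qi)
  moreover have "(fst a = fst b \<or> snd a = snd b) \<or> fst b < fst a \<and> snd a < snd b \<or> fst b < fst a \<and> snd b < snd a"
    using ab(1) by (cases a; cases b) auto
  ultimately show ?thesis
    using qrel_J[OF ab] unfolding qrel_def qrhs_def
    by (elim disjE) (force simp: algebra_simps intro: exI[of _ q] exI[of _ 1])+
qed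

end

section \<open>Straightening\<close>

context quantum_matrices
begin

text \<open>Makes \<open>exchange_descent\<close> symmetric in the two letters: for a < b the
  relation is solved for the other product by inverting the unit. The unordered pair {x, y} covers
  both orders in which the exchanged letters then appear.\<close>

lemma exchange:
  assumes a: "a \<in> idx n" and b: "b \<in> idx n"
  shows "\<exists>u u'. u' * u = 1 \<and> (fa_word [a, b] - sc u * fa_word [b, a] \<in> J \<or>
     ((fst b < fst a \<and> snd b < snd a \<or> fst a < fst b \<and> snd a < snd b) \<and>
       (\<exists>v x y. {x, y} = {(fst b, snd a), (fst a, snd b)} \<and>
          fa_word [a, b] - sc u * fa_word [b, a] - sc v * fa_word [x, y] \<in> J)))"
proof -
  consider "b < a" | "a = b" | "a < b" by (rule linorder_cases[of a b]) auto
  then show ?thesis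
  proof cases
    case 1
    from exchange_descent[OF this a b] show ?thesis by blast
  next
    case 2
    then show ?thesis by (intro exI[of _ 1] conjI disjI1) (simp_all add: fa_ideal.zero)
  next
    case 3
    obtain u u' where u: "u' * u = 1" and
      *: "fa_word [b, a] - sc u * fa_word [a, b] \<in> J \<or>
       (fst a < fst b \<and> snd a < snd b \<and> (\<exists>v. fa_word [b, a] - sc u * fa_word [a, b] -
        sc v * fa_word [(fst a, snd b), (fst b, snd a)] \<in> J))"
      using exchange_descent[OF 3 b a] by blast
    have uu: "sc u' * (sc u * x) = x" for x :: "(nat \<times> nat, 'a) fralg"
      using u by (simp flip: mult.assoc sc_mult)
    have u'': "u * u' = 1" using u by (simp add: mult.commute)
    from * show ?thesis
    proof
      assume "fa_word [b, a] - sc u * fa_word [a, b] \<in> J"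
      then have "- (sc u' * (fa_word [b, a] - sc u * fa_word [a, b])) \<in> J"
        by (intro fa_ideal_uminus fa_ideal_sc)
      then have "fa_word [a, b] - sc u' * fa_word [b, a] \<in> J"
        by (simp add: right_diff_distrib uu)
      then show ?thesis using u'' by blast
    next
      assume "fst a < fst b \<and> snd a < snd b \<and> (\<exists>v. fa_word [b, a] - sc u * fa_word [a, b] -
        sc v * fa_word [(fst a, snd b), (fst b, snd a)] \<in> J)"
      then obtain v where lt: "fst a < fst b" "snd a < snd b" and
        v: "fa_word [b, a] - sc u * fa_word [a, b] - sc v * fa_word [(fst a, snd b), (fst b, snd a)] \<in> J"
        by blast
      have "- (sc u' * (fa_word [b, a] - sc u * fa_word [a, b] - sc v * fa_word [(fst a, snd b), (fst b, snd a)])) \<in> J"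
        using v by (intro fa_ideal_uminus fa_ideal_sc)
      moreover have "- (sc u' * (fa_word [b, a] - sc u * fa_word [a, b] - sc v * fa_word [(fst a, snd b), (fst b, snd a)]))
         = fa_word [a, b] - sc u' * fa_word [b, a] - sc (- (u' * v)) * fa_word [(fst a, snd b), (fst b, snd a)]"
        by (simp add: right_diff_distrib uu sc_mult sc_uminus mult.assoc)
      ultimately have "fa_word [a, b] - sc u' * fa_word [b, a] - sc (- (u' * v)) * fa_word [(fst a, snd b), (fst b, snd a)] \<in> J"
        by simp
      then show ?thesis using u'' lt by blast
    qed
  qed
qed

definition LowW :: "(nat \<times> nat) set \<Rightarrow> nat \<Rightarrow> (nat \<times> nat, 'a) fralg set" where
  "LowW P s = Sp (fa_word ` {z. set z \<subseteq> P \<and> stat z < s})"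

lemma LowW_mult:
  assumes "x \<in> LowW P s" "set u \<subseteq> P" "set v \<subseteq> P" "P \<subseteq> idx n" "stat u + s + stat v \<le> s'"
  shows "fa_word u * x * fa_word v \<in> LowW P s'"
  unfolding LowW_def
proof (rule Sp_map[OF assms(1)[unfolded LowW_def]])
  fix y :: "(nat \<times> nat, 'a) fralg" assume "y \<in> fa_word ` {z. set z \<subseteq> P \<and> stat z < s}"
  then obtain z where z: "y = fa_word z" "set z \<subseteq> P" "stat z < s" by auto
  have "fa_word u * y * fa_word v = fa_word (u @ z @ v)"
    by (simp add: z fa_word_append mult.assoc)
  moreover have "u @ z @ v \<in> {z. set z \<subseteq> P \<and> stat z < s'}" using z assms by auto
  ultimately show "fa_word u * y * fa_word v \<in> Sp (fa_word ` {z. set z \<subseteq> P \<and> stat z < s'})"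
    by (auto intro!: Sp_base)
qed (use assms in auto)

text \<open>Equality up to a unit and terms of lower \<open>stat\<close>. Equal weights are required
  so that the lower terms of consecutive steps lie below the same bound, which makes the relation
  transitive.\<close>

definition eqv :: "(nat \<times> nat) set \<Rightarrow> (nat \<times> nat) list \<Rightarrow> (nat \<times> nat) list \<Rightarrow> bool" where
  "eqv P w w' \<longleftrightarrow> stat w = stat w' \<and>
     (\<exists>u u'. u' * u = 1 \<and> fa_word w - sc u * fa_word w' \<in> LowW P (stat w))"

text \<open>Exchanging the columns of two letters of which one lies strictly below and to the right of
  the other strictly decreases \<open>stat\<close>, so up to lower terms and units all letters commute.\<close>
lemma straighten:
  assumes "mset w = mset w'" "set w \<subseteq> P" and P: "P \<subseteq> idx n" "exchange_closed P"
  shows "eqv P w w'"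
  using assms(1,2)
proof (rule perm_relation)
  show "eqv P w w" for w
    unfolding eqv_def LowW_def by (intro conjI exI[of _ 1]) (simp_all add: Sp_zero)
  show "eqv P w w''" if eqv: "eqv P w w'" "eqv P w' w''" for w w' w''
  proof -
    have stat: "stat w = stat w'" "stat w' = stat w''" using eqv unfolding eqv_def by auto
    obtain a a' where a: "a' * a = 1" "fa_word w - sc a * fa_word w' \<in> LowW P (stat w)"
      using eqv(1) unfolding eqv_def by blast
    obtain b b' where b: "b' * b = 1" "fa_word w' - sc b * fa_word w'' \<in> LowW P (stat w)"
      using eqv(2) unfolding eqv_def stat by blast
    have "(b' * a') * (a * b) = b' * (a' * a) * b" by (simp add: mult.assoc)
    then have unit: "(b' * a') * (a * b) = 1" using a(1) b(1) by simp
    have "fa_word w - sc (a * b) * fa_word w'' =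
       (fa_word w - sc a * fa_word w') + sc a * (fa_word w' - sc b * fa_word w'')"
      by (simp add: algebra_simps sc_mult)
    also have "\<dots> \<in> LowW P (stat w)"
      using a b unfolding LowW_def by (intro Sp_add Sp_sc)
    finally show ?thesis using stat unit unfolding eqv_def by (intro conjI exI) simp_all
  qed
  show "eqv P (u @ w @ v) (u @ w' @ v)" if eqv: "eqv P w w'" and uv: "set u \<subseteq> P" "set v \<subseteq> P" for u w w' v
  proof -
    obtain a a' where *: "a' * a = 1" "fa_word w - sc a * fa_word w' \<in> LowW P (stat w)" "stat w = stat w'"
      using eqv unfolding eqv_def by auto
    have "fa_word (u @ w @ v) - sc a * fa_word (u @ w' @ v) =
        fa_word u * (fa_word w - sc a * fa_word w') * fa_word v"
      by (simp add: fa_word_append left_diff_distrib right_diff_distrib mult.assoc sc_left_commute[of "fa_word u"])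
    also have "\<dots> \<in> LowW P (stat (u @ w @ v))"
      by (rule LowW_mult[OF *(2)]) (use uv P in auto)
    finally show ?thesis using * unfolding eqv_def by auto
  qed
  show "eqv P [a, b] [b, a]" if ab: "a \<in> P" "b \<in> P" for a b
  proof -
    obtain u u' where u: "u' * u = 1" and *: "fa_word [a, b] - sc u * fa_word [b, a] \<in> J \<or>
     ((fst b < fst a \<and> snd b < snd a \<or> fst a < fst b \<and> snd a < snd b) \<and>
       (\<exists>v x y. {x, y} = {(fst b, snd a), (fst a, snd b)} \<and>
          fa_word [a, b] - sc u * fa_word [b, a] - sc v * fa_word [x, y] \<in> J))"
      using exchange[of a b] ab P by blast
    have "fa_word [a, b] - sc u * fa_word [b, a] \<in> LowW P (stat [a, b])"
    proof (cases "fa_word [a, b] - sc u * fa_word [b, a] \<in> J")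
      case True
      then show ?thesis by (simp add: LowW_def Sp_J)
    next
      case False
      with * obtain v x y where xy: "{x, y} = {(fst b, snd a), (fst a, snd b)}"
        and J: "fa_word [a, b] - sc u * fa_word [b, a] - sc v * fa_word [x, y] \<in> J"
        and lt: "(fst b < fst a \<and> snd b < snd a) \<or> (fst a < fst b \<and> snd a < snd b)"
        by blast
      have ab': "(fst a, snd a) \<in> P" "(fst b, snd b) \<in> P" using ab by simp_all
      have "(fst b, snd a) \<in> P" "(fst a, snd b) \<in> P"
        using lt P(2)[unfolded exchange_closed_def, rule_format, OF ab']
          P(2)[unfolded exchange_closed_def, rule_format, OF ab'(2,1)] by argo+
      then have "x \<in> P" "y \<in> P" using xy unfolding doubleton_eq_iff by blast+
      moreover have "stat [x, y] = fst b * snd a + fst a * snd b"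
        using xy by (auto simp: doubleton_eq_iff)
      moreover have "r * t + s * u < s * t + r * u" if "(r < s \<and> u < t) \<or> (s < r \<and> t < u)" for r s t u :: nat
      proof -
        \<comment> \<open>Expanded, this positive product is the drop of \<open>stat\<close> caused
          by the exchange.\<close>
        have "(int s - int r) * (int t - int u) > 0" using that by (auto simp: zero_less_mult_iff)
        then have "int (r * t + s * u) < int (s * t + r * u)" by (simp add: algebra_simps)
        then show ?thesis by linarith
      qed
      from this[of "fst b" "fst a" "snd b" "snd a"] lt
      have "fst b * snd a + fst a * snd b < fst a * snd a + fst b * snd b" by simp
      ultimately have "fa_word [x, y] \<in> LowW P (stat [a, b])"
        unfolding LowW_def by (intro Sp_base) auto
      then have "(fa_word [a, b] - sc u * fa_word [b, a] - sc v * fa_word [x, y]) + sc v * fa_word [x, y]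
        \<in> LowW P (stat [a, b])"
        using J unfolding LowW_def by (intro Sp_add[OF Sp_J Sp_sc])
      then show ?thesis by simp
    qed
    then show ?thesis using u unfolding eqv_def by (auto simp: add.commute)
  qed
qed

text \<open>\<open>S\<close> abstracts the wanted arrangement of the letters, such as lexicographic
  or sorted by the given order. Straightening into that arrangement leaves words of lower
  \<open>stat\<close>, which the induction treats.\<close>

lemma word_span:
  assumes P: "P \<subseteq> idx n" "exchange_closed P"
    and S: "\<And>w. set w \<subseteq> P \<Longrightarrow> \<exists>z. mset z = mset w \<and> S z"
    and w: "set w \<subseteq> P"
  shows "fa_word w \<in> Sp (fa_word ` {z. set z \<subseteq> P \<and> S z \<and> stat z \<le> stat w})"
  using w
proof (induction "stat w" arbitrary: w rule: less_induct)
  case less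
  obtain z where z: "mset z = mset w" "S z" using S[OF less.prems] by blast
  obtain u where u: "fa_word w - sc u * fa_word z \<in> LowW P (stat w)"
    using straighten[OF z(1)[symmetric] less.prems P] unfolding eqv_def by blast
  let ?X = "fa_word ` {z. set z \<subseteq> P \<and> S z \<and> stat z \<le> stat w}"
  have "fa_word w - sc u * fa_word z \<in> Sp ?X"
  proof (rule Sp_minimal[OF u[unfolded LowW_def]])
    fix x :: "(nat \<times> nat, 'a) fralg" assume "x \<in> fa_word ` {z. set z \<subseteq> P \<and> stat z < stat w}"
    then obtain y where y: "x = fa_word y" "set y \<subseteq> P" "stat y < stat w" by auto
    show "x \<in> Sp ?X" unfolding y(1)
      by (rule Sp_mono[OF less.hyps[OF y(3,2)]]) (use y in auto)
  qed
  moreover have "fa_word z \<in> Sp ?X"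
    using z mset_eq_setD[OF z(1)] less.prems stat_mset[OF z(1)] by (intro Sp_base) auto
  ultimately have "(fa_word w - sc u * fa_word z) + sc u * fa_word z \<in> Sp ?X"
    by (intro Sp_add Sp_sc)
  then show ?case by simp
qed

lemma LowW_span:
  assumes P: "P \<subseteq> idx n" "exchange_closed P"
    and S: "\<And>w. set w \<subseteq> P \<Longrightarrow> \<exists>z. mset z = mset w \<and> S z"
    and x: "x \<in> LowW P s"
  shows "x \<in> Sp (fa_word ` {z. set z \<subseteq> P \<and> S z \<and> stat z < s})"
proof (rule Sp_minimal[OF x[unfolded LowW_def]])
  fix x :: "(nat \<times> nat, 'a) fralg" assume "x \<in> fa_word ` {z. set z \<subseteq> P \<and> stat z < s}"
  then obtain y where y: "x = fa_word y" "set y \<subseteq> P" "stat y < s" by auto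
  show "x \<in> Sp (fa_word ` {z. set z \<subseteq> P \<and> S z \<and> stat z < s})" unfolding y(1)
    by (rule Sp_mono[OF word_span[OF P S y(2)]]) (use y in auto)
qed

text \<open>Sum 2 x y <= x^2 + y^2 over the positions, with strict inequality where the lists
  differ; both lists have the same sum of squares.\<close>

lemma rearrangement:
  assumes "length xs = length ys" "mset xs = mset (ys :: nat list)" "xs \<noteq> ys"
  shows "stat (zip xs ys) < stat (zip xs xs)"
proof -
  have am: "2 * (x * y) \<le> x * x + y * y" "x \<noteq> y \<Longrightarrow> 2 * (x * y) < x * x + y * y" for x y :: nat
  proof -
    have "(int x - int y)^2 \<ge> 0" "x \<noteq> y \<Longrightarrow> (int x - int y)^2 > 0" by auto
    then have "int (2 * (x * y)) \<le> int (x * x + y * y)" "x \<noteq> y \<Longrightarrow> int (2 * (x * y)) < int (x * x + y * y)"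
      by (simp_all add: power2_eq_square algebra_simps)
    then show "2 * (x * y) \<le> x * x + y * y" "x \<noteq> y \<Longrightarrow> 2 * (x * y) < x * x + y * y" by linarith+
  qed
  have "2 * stat (zip xs ys) \<le> (\<Sum>x\<leftarrow>xs. x * x) + (\<Sum>y\<leftarrow>ys. y * y) \<and>
      (xs \<noteq> ys \<longrightarrow> 2 * stat (zip xs ys) < (\<Sum>x\<leftarrow>xs. x * x) + (\<Sum>y\<leftarrow>ys. y * y))"
    using assms(1)
  proof (induction xs ys rule: list_induct2)
    case (Cons x xs y ys)
    then show ?case using am(1)[of x y] am(2)[of x y] by (cases "x = y") simp_all
  qed simp
  moreover have "(\<Sum>y\<leftarrow>ys. y * y) = (\<Sum>x\<leftarrow>xs. x * x)"
    unfolding sum_mset_sum_list[symmetric] mset_map using assms(2) by simp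
  moreover have "stat (zip xs xs) = (\<Sum>x\<leftarrow>xs. x * x)"
    by (induction xs) simp_all
  ultimately show ?thesis using assms(3) by simp
qed

lemma linv_sorted: "sorted_wrt (<) xs \<Longrightarrow> linv (\<lambda>a b. b < a) (xs :: nat list) = 0"
  by (induction xs) (auto simp: filter_empty_conv)

lemma upt_permutation: "[1..<Suc n] \<in> permutations_of_set {1..n}"
  by (rule permutations_of_setI) auto

lemma permutation_mset:
  assumes "ks \<in> permutations_of_set {1..n}"
  shows "mset [1..<Suc n] = mset ks"
proof -
  have "set [1..<Suc n] = set ks"
    unfolding permutations_of_setD(1)[OF assms] set_upt by (rule atLeastLessThanSuc_atLeastAtMost)
  then show ?thesis
    by (subst set_eq_iff_mset_eq_distinct[symmetric]) (simp_all only: distinct_upt permutations_of_setD(2)[OF assms])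
qed

lemma set_zip_idx: "set I \<subseteq> {1..n} \<Longrightarrow> ks \<in> permutations_of_set {1..n} \<Longrightarrow> set (zip I ks) \<subseteq> idx n"
  by (auto simp: idx_def permutations_of_set_def dest: set_zip_leftD set_zip_rightD)

lemma count_zip_map: "distinct I \<Longrightarrow> count (mset (zip I (map f I))) (i, j) = (if i \<in> set I \<and> j = f i then 1 else 0)"
proof (induction I)
  case (Cons a I)
  then show ?case by (cases "i = a") (auto simp: count_mset_0_iff dest: set_zip_leftD)
qed simp

lemma exchange_closed_idx: "exchange_closed (idx n)"
  by (auto simp: exchange_closed_def idx_def)

end

locale ordered_quantum_matrices = quantum_matrices q qi n for q qi :: "'a::comm_ring_1" and n +
  fixes r :: "(nat \<times> nat) rel"
  assumes r: "linear_order_on (idx n) r"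
begin

abbreviation "mw N \<equiv> mono_word r (idx n) N"
abbreviation "rsorted w \<equiv> sorted_wrt (\<lambda>x y. (x, y) \<in> r) w"

lemmas rsorted_mono = mono_word_sorted[OF r finite_idx]
lemmas count_mono = count_mono_word[OF r finite_idx]
lemmas set_mono = set_mono_word[OF r finite_idx]

lemma mono_count: "set w \<subseteq> idx n \<Longrightarrow> rsorted w \<Longrightarrow> mw (count (mset w)) = w"
  by (rule mono_word_eqI[OF r]) auto

lemma count_expo: "set w \<subseteq> idx n \<Longrightarrow> count (mset w) \<in> expo n"
  by (auto simp: expo_def count_mset_0_iff)

lemma mset_mono_count:
  assumes "set w \<subseteq> idx n"
  shows "mset (mw (count (mset w))) = mset w"
proof (rule multiset_eqI)
  fix p show "count (mset (mw (count (mset w)))) p = count (mset w) p"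
    using assms by (auto simp: count_mono count_mset_0_iff)
qed

lemma exists_rsorted: "set w \<subseteq> idx n \<Longrightarrow> \<exists>z. mset z = mset w \<and> rsorted z"
  using mset_mono_count rsorted_mono by blast

lemma rsorted_word_mono: "set z \<subseteq> idx n \<Longrightarrow> rsorted z \<Longrightarrow> fa_word z = monoM n r (count (mset z))"
  by (simp add: monoM_def mono_count)

lemma monoM_on: "monoM n r N \<in> fa_on (idx n)"
  using set_mono by (simp add: monoM_def)

text \<open>Sorting the word of N gives its lexicographic counterpart of equal \<open>stat\<close>,
  and straightening one arrangement into the other is the triangular relation.\<close>

theorem monoM_basis: "pres_basis (GM n) (RM n q qi) (monoM n r) (expo n)"
proof (rule triangular_basis[where \<mu> = stat and \<phi> = "\<lambda>N. sort (mw N)"])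
  show "pres_basis (GM n) (RM n q qi) fa_word {w. set w \<subseteq> idx n \<and> sorted w}"
    by (rule sorted_words_basis)
  show "monoM n r N \<in> fa_on (GM n)" for N using monoM_on by (simp add: GM_def)
  show "bij_betw (\<lambda>N. sort (mw N)) (expo n) {w. set w \<subseteq> idx n \<and> sorted w}"
    unfolding bij_betw_def
  proof (intro conjI equalityI subsetI inj_onI)
    fix N N' assume *: "N \<in> expo n" "N' \<in> expo n" "sort (mw N) = sort (mw N')"
    then have "mset (mw N) = mset (mw N')" by (metis mset_sort)
    then have "(if p \<in> idx n then N p else 0) = (if p \<in> idx n then N' p else 0)" for p
      by (metis count_mono)
    then have "N p = N' p" if "p \<in> idx n" for p using that by (metis (full_types))
    moreover have "N p = N' p" if "p \<notin> idx n" for p using *(1,2) that by (cases p) (simp add: expo_def)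
    ultimately show "N = N'" by blast
  next
    fix w assume "w \<in> {w. set w \<subseteq> idx n \<and> sorted w}"
    then have w: "set w \<subseteq> idx n" "sorted w" by auto
    have "sort (mw (count (mset w))) = w"
      using mset_mono_count[OF w(1)] w(2) by (intro properties_for_sort) auto
    then show "w \<in> (\<lambda>N. sort (mw N)) ` expo n" using count_expo[OF w(1)] by (metis imageI)
  qed (auto dest: subsetD[OF set_mono])
  fix N assume "N \<in> expo n"
  have m: "mset (mw N) = mset (sort (mw N))" by simp
  obtain u u' where u: "u' * u = 1"
    "fa_word (mw N) - sc u * fa_word (sort (mw N)) \<in> LowW (idx n) (stat (mw N))"
    using straighten[OF m set_mono order_refl exchange_closed_idx] unfolding eqv_def by blast
  have "fa_word (mw N) - sc u * fa_word (sort (mw N)) \<in>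
     Sp (fa_word ` {z. set z \<subseteq> idx n \<and> sorted z \<and> stat z < stat (mw N)})"
    by (rule LowW_span[OF order_refl exchange_closed_idx _ u(2)]) (metis mset_sort sorted_sort)
  then show "\<exists>u u'. u' * u = 1 \<and> monoM n r N - sc u * fa_word (sort (mw N)) \<in>
     lspan (fa_ideal (GM n) (RM n q qi) \<union> fa_word ` {w \<in> {w. set w \<subseteq> idx n \<and> sorted w}. stat w < stat (sort (mw N))})"
    using u(1) stat_mset[OF m] unfolding monoM_def GM_def Sp_def
    by (auto simp: conj_assoc)
qed

text \<open>Multiplication by D adds \<open>\<delta>\<close> to the exponent, up to a unit and terms
  of smaller weight. The constant increment c of the weight keeps lower terms low when powers of D
  are taken.\<close>

definition leading :: "(nat \<times> nat \<Rightarrow> nat) \<Rightarrow> ((nat \<times> nat \<Rightarrow> nat) \<Rightarrow> nat) \<Rightarrow> nat \<Rightarrow> bool" where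
  "leading \<delta> \<mu> c \<longleftrightarrow> (\<forall>N\<in>expo n. \<mu> (\<lambda>p. N p + \<delta> p) = \<mu> N + c \<and>
     (\<exists>u u'. u' * u = 1 \<and> monoM n r N * qD n - sc u * monoM n r (\<lambda>p. N p + \<delta> p)
        \<in> Sp (monoM n r ` {N'\<in>expo n. \<mu> N' < \<mu> N + c})))"

lemma mset_mono_add:
  assumes "set w \<subseteq> idx n"
  shows "mset (mw N @ w) = mset (mw (\<lambda>p. N p + count (mset w) p))"
  by (rule multiset_eqI) (use assms in \<open>auto simp: count_mono count_mset_0_iff\<close>)

text \<open>By \<open>rearrangement\<close> the identity permutation has the strictly largest
  \<open>stat\<close> among the terms of D, namely the sum of the squares up to n.\<close>

lemma leading_diagonal:
  "leading (\<lambda>(i, j). if i \<in> {1..n} \<and> j = i then 1 else 0) (\<lambda>N. stat (mw N)) (stat (zip [1..<Suc n] [1..<Suc n]))"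
  unfolding leading_def
proof (intro ballI conjI)
  let ?L = "[1..<Suc n]"
  let ?\<delta> = "\<lambda>(i, j). if i \<in> {1..n} \<and> j = i then 1 else (0::nat)"
  let ?z = "zip ?L ?L"
  fix N :: "nat \<times> nat \<Rightarrow> nat" assume "N \<in> expo n"
  have setL: "set ?L \<subseteq> {1..n}" by auto
  have z: "set ?z \<subseteq> idx n" by (rule set_zip_idx[OF setL upt_permutation])
  have "count (mset ?z) = ?\<delta>"
    using count_zip_map[of ?L "\<lambda>i. i"] by (auto simp: fun_eq_iff)
  then have mset: "mset (mw N @ ?z) = mset (mw (\<lambda>p. N p + ?\<delta> p))"
    using mset_mono_add[OF z, of N] by simp
  from stat_mset[OF mset] show stat: "stat (mw (\<lambda>p. N p + ?\<delta> p)) = stat (mw N) + stat ?z" by simp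
  have "set (mw N @ ?z) \<subseteq> idx n" using z set_mono by simp
  from straighten[OF mset this order_refl exchange_closed_idx]
  obtain u u' where u: "u' * u = 1"
    "fa_word (mw N @ ?z) - sc u * fa_word (mw (\<lambda>p. N p + ?\<delta> p)) \<in> LowW (idx n) (stat (mw N) + stat ?z)"
    unfolding eqv_def by auto
  let ?PS = "permutations_of_set {1..n}"
  have "qD n = fa_word ?z + (\<Sum>ks\<in>?PS - {?L}. sc ((- q) ^ linv (\<lambda>a b. b < a) ks) * fa_word (zip ?L ks))"
    unfolding rowdet_def by (subst sum.remove[OF _ upt_permutation]) (simp_all add: linv_sorted)
  let ?X = "\<Sum>ks\<in>?PS - {?L}. sc ((- q) ^ linv (\<lambda>a b. b < a) ks) * fa_word (mw N @ zip ?L ks)"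
  from \<open>qD n = _\<close> have qD: "fa_word (mw N) * qD n = fa_word (mw N @ ?z) + ?X"
    by (simp add: distrib_left sum_distrib_left fa_word_append sc_left_commute[of "fa_word _"])
  have X: "?X \<in> LowW (idx n) (stat (mw N) + stat ?z)"
    unfolding LowW_def
  proof (intro Sp_sum Sp_sc Sp_base imageI CollectI conjI)
    fix ks assume ks: "ks \<in> ?PS - {?L}"
    then have mset: "mset ?L = mset ks" by (intro permutation_mset) simp
    have "stat (zip ?L ks) < stat ?z"
      by (rule rearrangement[OF mset_eq_length[OF mset] mset]) (use ks in auto)
    then show "stat (mw N @ zip ?L ks) < stat (mw N) + stat ?z" by simp
    show "set (mw N @ zip ?L ks) \<subseteq> idx n" using set_mono set_zip_idx[OF setL] ks by simp
  qed
  have "monoM n r N * qD n - sc u * monoM n r (\<lambda>p. N p + ?\<delta> p) =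
      (fa_word (mw N @ ?z) - sc u * fa_word (mw (\<lambda>p. N p + ?\<delta> p))) + ?X"
    unfolding monoM_def qD by simp
  also have "\<dots> \<in> LowW (idx n) (stat (mw N) + stat ?z)"
    using u(2) X unfolding LowW_def by (rule Sp_add)
  finally have "monoM n r N * qD n - sc u * monoM n r (\<lambda>p. N p + ?\<delta> p) \<in> LowW (idx n) (stat (mw N) + stat ?z)" .
  from LowW_span[OF order_refl exchange_closed_idx exists_rsorted this]
  have "monoM n r N * qD n - sc u * monoM n r (\<lambda>p. N p + ?\<delta> p) \<in>
     Sp (monoM n r ` {N' \<in> expo n. stat (mw N') < stat (mw N) + stat ?z})"
    by (rule Sp_mono) (auto simp: rsorted_word_mono mono_count intro!: imageI count_expo)
  with u(1) show "\<exists>u u'. u' * u = 1 \<and> monoM n r N * qD n - sc u * monoM n r (\<lambda>p. N p + ?\<delta> p) \<in>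
     Sp (monoM n r ` {N' \<in> expo n. stat (mw N') < stat (mw N) + stat ?z})" by blast
qed

end

section \<open>Orders adapted to the antidiagonal\<close>

context quantum_matrices
begin

lemma word_commute:
  assumes "x \<in> idx n" "y \<in> idx n" "fst x < fst y" "snd y < snd x"
  shows "fa_word [x, y] - fa_word [y, x] \<in> J" "fa_word [y, x] - fa_word [x, y] \<in> J"
proof -
  have "x < y" using assms(3) by (simp add: less_prod_def)
  moreover have "qrel q qi y x = fa_word [y, x] - fa_word [x, y]"
    using assms(3,4) by (simp add: qrel_def qrhs_def)
  ultimately show *: "fa_word [y, x] - fa_word [x, y] \<in> J" using qrel_J[of x y] assms by simp
  from J_sym[OF *] show "fa_word [x, y] - fa_word [y, x] \<in> J" .
qed

text \<open>The values 0, 1, 2 mean below, on and above the antidiagonal.\<close>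
definition cls :: "nat \<times> nat \<Rightarrow> nat" where
  "cls a = (if n + 1 < fst a + snd a then 0 else if fst a + snd a = n + 1 then 1 else 2)"

abbreviation "Cls c \<equiv> {a \<in> idx n. cls a = c}"

lemma cls_cases: "cls a = 0 \<or> cls a = 1 \<or> cls a = 2" by (simp add: cls_def)

lemma cls_iff:
  "cls a = 0 \<longleftrightarrow> n + 1 < fst a + snd a" "cls a = 1 \<longleftrightarrow> fst a + snd a = n + 1"
  "cls a = 2 \<longleftrightarrow> fst a + snd a < n + 1"
  by (auto simp: cls_def)

lemma filter_cls: "set w \<subseteq> idx n \<Longrightarrow> set (filter (\<lambda>a. cls a = c) w) \<subseteq> Cls c" by auto

lemma sorted_cls_split:
  "sorted_wrt (\<lambda>x y. cls x \<le> cls y) w \<Longrightarrow>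
   w = filter (\<lambda>a. cls a = 0) w @ filter (\<lambda>a. cls a = 1) w @ filter (\<lambda>a. cls a = 2) w"
proof (induction w)
  case (Cons x w)
  have e0: "filter (\<lambda>a. cls a = 0) w = []" if "cls x \<noteq> 0"
    using Cons.prems that by (auto simp: filter_empty_conv)
  have e1: "filter (\<lambda>a. cls a = 1) w = []" if "cls x = 2"
    using Cons.prems that by (auto simp: filter_empty_conv)
  show ?case using cls_cases[of x] Cons e0 e1 by auto
qed simp

lemma move_commute:
  assumes "\<And>y. y \<in> set ys \<Longrightarrow> fa_word [x, y] - fa_word [y, x] \<in> J" "x \<in> idx n" "set ys \<subseteq> idx n"
  shows "fa_word (x # ys) - fa_word (ys @ [x]) \<in> J"
  using assms
proof (induction ys)
  case (Cons y ys)
  have 1: "fa_word ([] @ [x, y] @ ys) - fa_word ([] @ [y, x] @ ys) \<in> J"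
    by (rule J_word_context) (use Cons.prems in auto)
  have 2: "fa_word ([y] @ (x # ys) @ []) - fa_word ([y] @ (ys @ [x]) @ []) \<in> J"
    by (rule J_word_context) (use Cons in auto)
  from J_trans[of "fa_word (x # y # ys)" "fa_word (y # x # ys)" "fa_word (y # ys @ [x])"] 1 2
  show ?case by simp
qed (simp add: fa_ideal.zero)

text \<open>Stable insertion by class: only pairs in the wrong class order are interchanged, and
  these commute by assumption, so no correction terms arise.\<close>

lemma class_sort:
  assumes "sorted_wrt (\<lambda>x y. cls y < cls x \<longrightarrow> fa_word [x, y] - fa_word [y, x] \<in> J) w" "set w \<subseteq> idx n"
  shows "fa_word w - fa_word (filter (\<lambda>a. cls a = 0) w @ filter (\<lambda>a. cls a = 1) w @ filter (\<lambda>a. cls a = 2) w) \<in> J"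
  using assms
proof (induction w)
  case (Cons x w)
  define F where "F c = filter (\<lambda>a. cls a = c) w" for c
  have F: "set (F c) \<subseteq> idx n" for c using Cons.prems by (auto simp: F_def)
  have "fa_word w - fa_word (F 0 @ F 1 @ F 2) \<in> J"
    unfolding F_def using Cons by auto
  then have "fa_word ([x] @ w @ []) - fa_word ([x] @ (F 0 @ F 1 @ F 2) @ []) \<in> J"
    by (rule J_word_context) (use Cons.prems in auto)
  then have 1: "fa_word (x # w) - fa_word (x # F 0 @ F 1 @ F 2) \<in> J" by simp
  have move: "fa_word ([] @ (x # ys) @ zs) - fa_word ([] @ (ys @ [x]) @ zs) \<in> J"
    if "\<And>y. y \<in> set ys \<Longrightarrow> y \<in> set w \<and> cls y < cls x" "set zs \<subseteq> idx n" for ys zs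
  proof (rule J_word_context[OF move_commute])
    show "fa_word [x, y] - fa_word [y, x] \<in> J" if "y \<in> set ys" for y
      using \<open>y \<in> set ys \<Longrightarrow> y \<in> set w \<and> cls y < cls x\<close>[OF that] Cons.prems(1) by simp
  qed (use that Cons.prems in auto)
  have m1: "fa_word (x # F 0 @ F 1 @ F 2) - fa_word (F 0 @ x # F 1 @ F 2) \<in> J" if "cls x = 1"
  proof -
    have "y \<in> set w \<and> cls y < cls x" if "y \<in> set (F 0)" for y
      using that \<open>cls x = 1\<close> by (simp add: F_def)
    from move[of "F 0" "F 1 @ F 2", OF this] F show ?thesis by simp
  qed
  have m2: "fa_word (x # F 0 @ F 1 @ F 2) - fa_word (F 0 @ F 1 @ x # F 2) \<in> J" if "cls x = 2"
  proof -
    have "y \<in> set w \<and> cls y < cls x" if "y \<in> set (F 0 @ F 1)" for y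
      using that \<open>cls x = 2\<close> unfolding F_def set_append set_filter by (elim UnE) simp_all
    from move[of "F 0 @ F 1" "F 2", OF this] F show ?thesis by simp
  qed
  from cls_cases[of x] show ?case
  proof (elim disjE)
    assume "cls x = 0"
    then show ?thesis using 1 by (simp add: F_def)
  next
    assume x: "cls x = 1"
    from J_trans[OF 1 m1[OF x]] x show ?thesis by (simp add: F_def)
  next
    assume x: "cls x = 2"
    from J_trans[OF 1 m2[OF x]] x show ?thesis by (simp add: F_def)
  qed
qed (simp add: fa_ideal.zero)

text \<open>Of two distinct antidiagonal letters, the one in the smaller row has the larger column,
  so they commute exactly.\<close>

lemma antidiagonal_perm:
  assumes "mset B = mset B'" "set B \<subseteq> Cls 1"
  shows "fa_word B - fa_word B' \<in> J"
  using assms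
proof (rule perm_relation)
  show "fa_word w - fa_word w \<in> J" for w by (simp add: fa_ideal.zero)
  show "fa_word w - fa_word w'' \<in> J" if "fa_word w - fa_word w' \<in> J" "fa_word w' - fa_word w'' \<in> J" for w w' w''
    using that by (rule J_trans)
  show "fa_word (u @ w @ v) - fa_word (u @ w' @ v) \<in> J"
    if "fa_word w - fa_word w' \<in> J" "set u \<subseteq> Cls 1" "set v \<subseteq> Cls 1" for u w w' v
    using that by (intro J_word_context) auto
  show "fa_word [x, y] - fa_word [y, x] \<in> J" if "x \<in> Cls 1" "y \<in> Cls 1" for x y
  proof -
    have idx: "x \<in> idx n" "y \<in> idx n" and cls: "cls x = 1" "cls y = 1" using that by blast+
    have sum: "fst x + snd x = n + 1" "fst y + snd y = n + 1"
      using cls unfolding cls_iff by blast+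
    consider "x = y" | "fst x < fst y" "snd y < snd x" | "fst y < fst x" "snd x < snd y"
    proof (cases "fst x" "fst y" rule: linorder_cases)
      case equal
      then have "x = y" using sum by (intro prod_eqI) simp_all
      then show ?thesis by (rule that)
    qed (use sum that in \<open>simp_all\<close>)
    then show ?thesis
      using word_commute[OF idx] word_commute[OF idx(2,1)] by cases (simp_all add: fa_ideal.zero)
  qed
qed

text \<open>The row plus column of each exchanged letter lies strictly between the sums of the two
  original letters, so both stay on the same side of the antidiagonal.\<close>

lemma exchange_closed_Cls: "exchange_closed (Cls 0)" "exchange_closed (Cls 2)"
  by (auto simp: exchange_closed_def cls_def idx_def split: if_splits)

definition LA :: "nat \<Rightarrow> (nat \<times> nat, 'a) fralg set" where
  "LA k = fa_word ` {A @ B | A B. set A \<subseteq> Cls 0 \<and> set B \<subseteq> Cls 1 \<and> length B \<le> k}"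

lemma LA_I: "set A \<subseteq> Cls 0 \<Longrightarrow> set B \<subseteq> Cls 1 \<Longrightarrow> length B \<le> k \<Longrightarrow> fa_word (A @ B) \<in> Sp (LA k)"
  by (rule Sp_base) (auto simp: LA_def)

text \<open>If an antidiagonal letter does not pass a lower one up to a unit, the exchange replaces
  both by two lower letters. The number of antidiagonal letters can thus only drop.\<close>

lemma antidiagonal_past_lower1:
  assumes b: "b \<in> Cls 1" and Z: "set Z \<subseteq> Cls 0"
  shows "fa_word (b # Z) \<in> Sp (LA 1)"
  using Z
proof (induction Z)
  case Nil
  show ?case using LA_I[of "[]" "[b]" 1] b by simp
next
  case (Cons l Z)
  have l: "l \<in> Cls 0" and Z: "set Z \<subseteq> Cls 0" using Cons.prems by auto
  obtain u u' where *: "fa_word [b, l] - sc u * fa_word [l, b] \<in> J \<or>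
     ((fst l < fst b \<and> snd l < snd b \<or> fst b < fst l \<and> snd b < snd l) \<and>
       (\<exists>v x y. {x, y} = {(fst l, snd b), (fst b, snd l)} \<and>
          fa_word [b, l] - sc u * fa_word [l, b] - sc v * fa_word [x, y] \<in> J))"
    using exchange[of b l] b l by blast
  have lb: "fa_word [l, b] * fa_word Z \<in> Sp (LA 1)"
  proof -
    have "fa_word [l] * fa_word (b # Z) \<in> Sp (LA 1)"
    proof (rule Sp_map_left[OF Cons.IH[OF Z]])
      fix x assume "x \<in> LA 1"
      then obtain A B where "x = fa_word (A @ B)" "set A \<subseteq> Cls 0" "set B \<subseteq> Cls 1" "length B \<le> 1"
        by (auto simp: LA_def)
      then show "fa_word [l] * x \<in> Sp (LA 1)"
        using LA_I[of "l # A" B 1] l by (simp flip: fa_word_append)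
    qed (use l in auto)
    then show ?thesis by (simp flip: fa_word_append)
  qed
  have eq: "fa_word (b # l # Z) = fa_word [b, l] * fa_word Z" by (simp flip: fa_word_append)
  have Zon: "fa_word Z \<in> fa_on (idx n)" using Z by auto
  show ?case
  proof (cases "fa_word [b, l] - sc u * fa_word [l, b] \<in> J")
    case True
    then have "(fa_word [b, l] - sc u * fa_word [l, b]) * fa_word Z \<in> J"
      by (rule fa_ideal_mult_right[OF _ Zon])
    moreover have "fa_word (b # l # Z) - sc u * (fa_word [l, b] * fa_word Z) =
       (fa_word [b, l] - sc u * fa_word [l, b]) * fa_word Z"
      unfolding eq by (simp add: left_diff_distrib mult.assoc)
    ultimately show ?thesis using Sp_sc[OF lb, of u] by (metis Sp_cong)
  next
    case False
    with * obtain v x y where lt: "fst l < fst b \<and> snd l < snd b \<or> fst b < fst l \<and> snd b < snd l"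
      and xy: "{x, y} = {(fst l, snd b), (fst b, snd l)}"
      and J: "fa_word [b, l] - sc u * fa_word [l, b] - sc v * fa_word [x, y] \<in> J" by blast
    have "cls b = 1" "cls l = 0" "b \<in> idx n" "l \<in> idx n" using b l by blast+
    then have sum: "fst b + snd b = n + 1" "n + 1 < fst l + snd l"
      and idx: "fst b \<in> {1..n}" "snd b \<in> {1..n}" "fst l \<in> {1..n}" "snd l \<in> {1..n}"
      unfolding cls_iff idx_def mem_Times_iff by blast+
    have "n + 1 < fst l + snd b" "n + 1 < fst b + snd l" using sum lt by linarith+
    then have "(fst l, snd b) \<in> Cls 0" "(fst b, snd l) \<in> Cls 0"
      using idx unfolding mem_Collect_eq cls_iff idx_def mem_Times_iff fst_conv snd_conv by blast+
    then have "x \<in> Cls 0" "y \<in> Cls 0" using xy unfolding doubleton_eq_iff by blast+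
    then have "fa_word (x # y # Z) \<in> Sp (LA 1)" using LA_I[of "x # y # Z" "[]" 1] Z by simp
    then have xyZ: "fa_word [x, y] * fa_word Z \<in> Sp (LA 1)" by (simp flip: fa_word_append)
    have "(fa_word [b, l] - sc u * fa_word [l, b] - sc v * fa_word [x, y]) * fa_word Z \<in> J"
      by (rule fa_ideal_mult_right[OF J Zon])
    moreover have "fa_word (b # l # Z) - (sc u * (fa_word [l, b] * fa_word Z) + sc v * (fa_word [x, y] * fa_word Z)) =
       (fa_word [b, l] - sc u * fa_word [l, b] - sc v * fa_word [x, y]) * fa_word Z"
      unfolding eq by (simp add: left_diff_distrib mult.assoc)
    ultimately show ?thesis
      using Sp_add[OF Sp_sc[OF lb, of u] Sp_sc[OF xyZ, of v]] by (metis Sp_cong)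
  qed
qed

text \<open>The letters of \<open>B\<close> cross one by one, starting with the last. Lower letters
  produced on the way remain in the front block, and the bound on antidiagonal letters is
  kept.\<close>

lemma antidiagonal_past_lower:
  assumes "set B \<subseteq> Cls 1" "set Z \<subseteq> Cls 0"
  shows "fa_word (B @ Z) \<in> Sp (LA (length B))"
  using assms(1)
proof (induction B)
  case Nil
  show ?case using LA_I[of Z "[]" 0] assms(2) by simp
next
  case (Cons b B)
  have "fa_word [b] * fa_word (B @ Z) \<in> Sp (LA (length (b # B)))"
  proof (rule Sp_map_left[where X = "LA (length B)"])
    fix x assume "x \<in> LA (length B)"
    then obtain A B' where x: "x = fa_word (A @ B')" "set A \<subseteq> Cls 0" "set B' \<subseteq> Cls 1" "length B' \<le> length B"
      by (auto simp: LA_def)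
    have "fa_word (b # A) * fa_word B' \<in> Sp (LA (length (b # B)))"
    proof (rule Sp_map_right[OF antidiagonal_past_lower1])
      fix y assume "y \<in> LA 1"
      then obtain A'' B'' where y: "y = fa_word (A'' @ B'')" "set A'' \<subseteq> Cls 0" "set B'' \<subseteq> Cls 1" "length B'' \<le> 1"
        by (auto simp: LA_def)
      then show "y * fa_word B' \<in> Sp (LA (length (b # B)))"
        using LA_I[of A'' "B'' @ B'" "length (b # B)"] x by (simp add: fa_word_append mult.assoc)
    qed (use Cons.prems x in auto)
    moreover have "fa_word (b # A) * fa_word B' = fa_word [b] * x"
      unfolding x(1) by (simp flip: fa_word_append)
    ultimately show "fa_word [b] * x \<in> Sp (LA (length (b # B)))" by simp
  qed (use Cons in auto)
  then show ?case by (simp flip: fa_word_append)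
qed

lemma set_zip_reverse: "ks \<in> permutations_of_set {1..n} \<Longrightarrow> set (zip (rev [1..<Suc n]) ks) \<subseteq> idx n"
  by (rule set_zip_idx) auto

text \<open>The reason for the reversed rows: along such a term the rows decrease, so a later letter
  of smaller class must lie in a larger column, and letters in that position commute
  exactly.\<close>

lemma reverse_term_class_sort:
  assumes ks: "ks \<in> permutations_of_set {1..n}"
  defines "w \<equiv> zip (rev [1..<Suc n]) ks"
  shows "fa_word w - fa_word (filter (\<lambda>a. cls a = 0) w @ filter (\<lambda>a. cls a = 1) w @ filter (\<lambda>a. cls a = 2) w) \<in> J"
proof (rule class_sort)
  show w: "set w \<subseteq> idx n" unfolding w_def by (rule set_zip_reverse[OF ks])
  have dist: "distinct ks" using permutations_of_setD[OF ks] by simp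
  show "sorted_wrt (\<lambda>x y. cls y < cls x \<longrightarrow> fa_word [x, y] - fa_word [y, x] \<in> J) w"
    unfolding sorted_wrt_iff_nth_less
  proof (intro allI impI)
    fix p p' assume p: "p < p'" "p' < length w" and lt: "cls (w ! p') < cls (w ! p)"
    have len: "p < length (rev [1..<Suc n])" "p' < length (rev [1..<Suc n])" "p < length ks" "p' < length ks"
      using p by (auto simp: w_def)
    have wp: "w ! p = (rev [1..<Suc n] ! p, ks ! p)" "w ! p' = (rev [1..<Suc n] ! p', ks ! p')"
      using len by (simp_all add: w_def)
    have "rev [1..<Suc n] ! p' < rev [1..<Suc n] ! p" using len p(1) by (simp add: rev_nth)
    then have fst: "fst (w ! p') < fst (w ! p)" using wp by simp
    moreover have "snd (w ! p) < snd (w ! p')"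
    proof -
      have "fst (w ! p) + snd (w ! p) < fst (w ! p') + snd (w ! p')"
        using lt cls_cases[of "w ! p"] cls_cases[of "w ! p'"] cls_iff[of "w ! p"] cls_iff[of "w ! p'"]
        by linarith
      then show ?thesis using fst by linarith
    qed
    moreover have "w ! p \<in> idx n" "w ! p' \<in> idx n" using w p nth_mem[of p w] nth_mem[of p' w] by auto
    ultimately show "fa_word [w ! p, w ! p'] - fa_word [w ! p', w ! p] \<in> J"
      using word_commute(2)[of "w ! p'" "w ! p"] by simp
  qed
qed

text \<open>With reversed rows the antidiagonal permutation is the list 1, ..., n, the only one that
  makes all n letters antidiagonal.\<close>

lemma antidiagonal_count_less:
  assumes ks: "ks \<in> permutations_of_set {1..n}" "ks \<noteq> [1..<Suc n]"
  shows "length (filter (\<lambda>a. cls a = 1) (zip (rev [1..<Suc n]) ks)) < n"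
proof -
  let ?w = "zip (rev [1..<Suc n]) ks"
  have "length ks = n" using permutations_of_setD[OF ks(1)] distinct_card[of ks] by simp
  then have len: "length ?w = n" by simp
  show ?thesis
  proof (rule ccontr)
    assume "\<not> ?thesis"
    then have "length (filter (\<lambda>a. cls a = 1) ?w) = length ?w"
      using length_filter_le[of "\<lambda>a. cls a = 1" ?w] len by linarith
    then have all: "cls a = 1" if "a \<in> set ?w" for a
      using length_filter_less[OF that, of "\<lambda>a. cls a = 1"] by linarith
    have "ks ! p = [1..<Suc n] ! p" if "p < n" for p
    proof -
      have "?w ! p = (rev [1..<Suc n] ! p, ks ! p)" using that \<open>length ks = n\<close> by simp
      moreover have "cls (?w ! p) = 1" using that len by (intro all nth_mem) simp
      ultimately have "rev [1..<Suc n] ! p + ks ! p = n + 1" unfolding cls_iff by simp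
      moreover have "rev [1..<Suc n] ! p = n - p" "[1..<Suc n] ! p = Suc p"
        using that by (simp_all add: rev_nth)
      ultimately show ?thesis using that by linarith
    qed
    then have "ks = [1..<Suc n]" using \<open>length ks = n\<close> by (intro nth_equalityI) simp_all
    with ks(2) show False by simp
  qed
qed

end

locale antidiagonal_order = ordered_quantum_matrices q qi n r for q qi :: "'a::comm_ring_1" and n r +
  assumes n_pos: "1 \<le> n"
    and order: "\<And>i j h k l m. i \<in> {1..n} \<Longrightarrow> j \<in> {1..n} \<Longrightarrow> h \<in> {1..n} \<Longrightarrow> k \<in> {1..n} \<Longrightarrow>
      l \<in> {1..n} \<Longrightarrow> m \<in> {1..n} \<Longrightarrow> j > n + 1 - i \<Longrightarrow> k = n + 1 - h \<Longrightarrow> m < n + 1 - l \<Longrightarrow>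
      ((i, j), (h, k)) \<in> r \<and> ((h, k), (l, m)) \<in> r"
begin

lemma cls_less_r:
  assumes "x \<in> idx n" "y \<in> idx n" "cls x < cls y"
  shows "(x, y) \<in> r"
proof -
  obtain a b c d where xy: "x = (a, b)" "y = (c, d)" by (metis surj_pair)
  have idx: "a \<in> {1..n}" "b \<in> {1..n}" "c \<in> {1..n}" "d \<in> {1..n}" using assms xy by (auto simp: idx_def)
  then have le: "1 \<le> a" "a \<le> n" "1 \<le> b" "b \<le> n" "1 \<le> c" "c \<le> n" "1 \<le> d" "d \<le> n" by simp_all
  \<comment> \<open>\<open>order\<close> speaks of one letter from each class. A corner (1, 1) or
    (n, n) supplies the missing outer class, and the antidiagonal letter (1, n) links a letter below
    to a letter above.\<close>
  have one: "1 \<in> {1..n}" "n \<in> {1..n}" using n_pos by auto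
  consider "cls x = 0" "cls y = 1" | "cls x = 1" "cls y = 2" | "cls x = 0" "cls y = 2"
    using assms(3) cls_cases[of x] cls_cases[of y] by linarith
  then show ?thesis
  proof cases
    case 1
    then have "n + 1 < a + b" "c + d = n + 1" unfolding cls_iff xy fst_conv snd_conv .
    then have "b > n + 1 - a" "d = n + 1 - c" "1 < n + 1 - (1::nat)"
      using le by linarith+
    then show ?thesis using order[OF idx one(1) one(1)] xy by blast
  next
    case 2
    then have "a + b = n + 1" "c + d < n + 1" unfolding cls_iff xy fst_conv snd_conv .
    then have "n > n + 1 - n" "b = n + 1 - a" "d < n + 1 - c"
      using le by linarith+
    then show ?thesis using order[OF one(2) one(2) idx] xy by blast
  next
    case 3
    then have "n + 1 < a + b" "c + d < n + 1" unfolding cls_iff xy fst_conv snd_conv .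
    then have "b > n + 1 - a" "n = n + 1 - 1" "d < n + 1 - c"
      using le by linarith+
    then have "((a, b), (1, n)) \<in> r" "((1, n), (c, d)) \<in> r" using order[OF idx(1,2) one idx(3,4)] by blast+
    then show ?thesis using linear_order_onD(3)[OF r] xy by (auto dest: transD)
  qed
qed

lemma r_cls_le: "x \<in> idx n \<Longrightarrow> y \<in> idx n \<Longrightarrow> (x, y) \<in> r \<Longrightarrow> cls x \<le> cls y"
  using cls_less_r[of y x] linear_order_onD(2)[OF r] by (metis antisymD less_irrefl not_le)

lemma rsorted_split:
  assumes "set w \<subseteq> idx n" "rsorted w"
  shows "w = filter (\<lambda>a. cls a = 0) w @ filter (\<lambda>a. cls a = 1) w @ filter (\<lambda>a. cls a = 2) w"
proof (rule sorted_cls_split)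
  show "sorted_wrt (\<lambda>x y. cls x \<le> cls y) w"
    using assms(2) by (rule sorted_wrt_mono_rel[rotated]) (use assms(1) in \<open>blast intro: r_cls_le\<close>)
qed

lemma rsorted_append_cls:
  assumes "set A \<subseteq> Cls 0" "set B \<subseteq> Cls 1" "set C \<subseteq> Cls 2" "rsorted A" "rsorted B" "rsorted C"
  shows "rsorted (A @ B @ C)"
proof -
  have cross: "(x, y) \<in> r" if "set X \<subseteq> Cls c" "set Y \<subseteq> Cls d" "c < d" "x \<in> set X" "y \<in> set Y"
    for x y X Y c d
  proof -
    have "x \<in> idx n" "y \<in> idx n" "cls x = c" "cls y = d" using that by blast+
    with that(3) show ?thesis by (intro cls_less_r) simp_all
  qed
  show ?thesis
    unfolding sorted_wrt_append set_append
    using cross[OF assms(1,2)] cross[OF assms(1,3)] cross[OF assms(2,3)] assms(4-6) by auto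
qed

definition anti_count :: "(nat \<times> nat \<Rightarrow> nat) \<Rightarrow> nat" where
  "anti_count N = length (filter (\<lambda>a. cls a = 1) (mw N))"

lemma anti_count_mset: "mset (mw N) = mset w \<Longrightarrow> anti_count N = length (filter (\<lambda>a. cls a = 1) w)"
  unfolding anti_count_def by (metis mset_filter size_mset)

text \<open>Each block is rearranged inside its own class, the outer ones by straightening and the
  middle one exactly. The concatenation is then ordered, and the number of antidiagonal letters is
  unchanged.\<close>

lemma class_word_span:
  assumes "set A \<subseteq> Cls 0" "set B \<subseteq> Cls 1" "set C \<subseteq> Cls 2"
  shows "fa_word (A @ B @ C) \<in> Sp (monoM n r ` {N \<in> expo n. anti_count N = length B})"
proof -
  obtain B' where B': "mset B' = mset B" "rsorted B'" using exists_rsorted[of B] assms by auto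
  have setB': "set B' \<subseteq> Cls 1" using assms(2) mset_eq_setD[OF B'(1)] by simp
  let ?X = "fa_word ` {z. set z \<subseteq> Cls 0 \<and> rsorted z \<and> stat z \<le> stat A}"
  let ?Y = "fa_word ` {z. set z \<subseteq> Cls 2 \<and> rsorted z \<and> stat z \<le> stat C}"
  let ?Z = "monoM n r ` {N \<in> expo n. anti_count N = length B}"
  have A: "fa_word A \<in> Sp ?X"
    by (rule word_span[OF _ exchange_closed_Cls(1) exists_rsorted assms(1)]) auto
  have C: "fa_word C \<in> Sp ?Y"
    by (rule word_span[OF _ exchange_closed_Cls(2) exists_rsorted assms(3)]) auto
  have "fa_word A * (fa_word B * fa_word C) \<in> Sp ?Z"
  proof (rule Sp_mult[OF A, where Y = "(\<lambda>y. fa_word B * y) ` ?Y"])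
    show "fa_word B * fa_word C \<in> Sp ((\<lambda>y. fa_word B * y) ` ?Y)"
      by (rule Sp_map_left[OF C]) (use assms in \<open>auto intro: Sp_base\<close>)
    show "fa_word A \<in> fa_on (idx n)" using assms by auto
    show "(\<lambda>y. fa_word B * y) ` ?Y \<subseteq> fa_on (idx n)" using assms by (auto intro!: fa_on_mult)
    fix x y :: "(nat \<times> nat, 'a) fralg" assume "x \<in> ?X" "y \<in> (\<lambda>y. fa_word B * y) ` ?Y"
    then obtain A' C' where x: "x = fa_word A'" "set A' \<subseteq> Cls 0" "rsorted A'"
      and y: "y = fa_word B * fa_word C'" "set C' \<subseteq> Cls 2" "rsorted C'" by auto
    have idx: "set A' \<subseteq> idx n" "set C' \<subseteq> idx n" "set (A' @ B' @ C') \<subseteq> idx n" using x y setB' by auto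
    have "fa_word B - fa_word B' \<in> J" by (rule antidiagonal_perm) (use B' assms in auto)
    from J_word_context[OF this idx(1,2)]
    have J: "x * y - fa_word (A' @ B' @ C') \<in> J" by (simp add: x y fa_word_append)
    have sorted: "rsorted (A' @ B' @ C')" by (rule rsorted_append_cls) (use x y setB' B' in auto)
    have "mset (mw (count (mset (A' @ B' @ C')))) = mset (A' @ B' @ C')"
      by (rule mset_mono_count[OF idx(3)])
    then have "anti_count (count (mset (A' @ B' @ C'))) = length (filter (\<lambda>a. cls a = 1) (A' @ B' @ C'))"
      by (rule anti_count_mset)
    also have "filter (\<lambda>a. cls a = 1) A' = []" "filter (\<lambda>a. cls a = 1) C' = []" "filter (\<lambda>a. cls a = 1) B' = B'"
      using x y setB' by (auto simp: filter_empty_conv intro!: filter_True)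
    then have "length (filter (\<lambda>a. cls a = 1) (A' @ B' @ C')) = length B"
      using B'(1) mset_eq_length by auto
    finally have ac: "anti_count (count (mset (A' @ B' @ C'))) = length B" .
    have "fa_word (A' @ B' @ C') \<in> Sp ?Z"
      unfolding rsorted_word_mono[OF idx(3) sorted]
      by (intro Sp_base imageI CollectI conjI count_expo[OF idx(3)] ac)
    with J show "x * y \<in> Sp ?Z" by (rule Sp_cong)
  qed
  then show ?thesis by (simp add: fa_word_append)
qed

lemma upt_map_reverse: "[1..<Suc n] = map (\<lambda>i. n + 1 - i) (rev [1..<Suc n])"
  by (rule nth_equalityI) (auto simp: rev_nth)

text \<open>Centrality allows D to be inserted between the antidiagonal block and the upper block of
  the ordered word, where its n antidiagonal letters join those already present. The unit is the
  inverse of the power of -q in \<open>qD_reverse\<close>.\<close>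

theorem leading_antidiagonal:
  "leading (\<lambda>(i, j). if i \<in> {1..n} \<and> j = n + 1 - i then 1 else 0) anti_count n"
  unfolding leading_def
proof (intro ballI conjI)
  let ?L = "[1..<Suc n]" and ?R = "rev [1..<Suc n]"
  let ?\<delta> = "\<lambda>(i, j). if i \<in> {1..n} \<and> j = n + 1 - i then 1 else (0::nat)"
  let ?z = "zip ?R ?L"
  let ?PS = "permutations_of_set {1..n}"
  let ?F = "\<lambda>c. filter (\<lambda>a. cls a = c)"
  fix N :: "nat \<times> nat \<Rightarrow> nat" assume "N \<in> expo n"
  define w' where "w' = mw (\<lambda>p. N p + ?\<delta> p)"
  define A B C where "A = ?F 0 (mw N)" and "B = ?F 1 (mw N)" and "C = ?F 2 (mw N)"
  have w: "mw N = A @ B @ C" unfolding A_def B_def C_def by (rule rsorted_split[OF set_mono rsorted_mono])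
  have sub: "set A \<subseteq> Cls 0" "set B \<subseteq> Cls 1" "set C \<subseteq> Cls 2"
    using filter_cls[OF set_mono] unfolding A_def B_def C_def by blast+
  have subi: "set A \<subseteq> idx n" "set B \<subseteq> idx n" "set C \<subseteq> idx n" using sub by auto
  have z: "set ?z \<subseteq> idx n" by (rule set_zip_reverse[OF upt_permutation])
  have "count (mset ?z) = ?\<delta>"
    using count_zip_map[of ?R "\<lambda>i. n + 1 - i"] unfolding upt_map_reverse[symmetric] by (auto simp: fun_eq_iff)
  then have mset: "mset (mw N @ ?z) = mset w'"
    using mset_mono_add[OF z, of N] by (simp add: w'_def)
  have z1: "set ?z \<subseteq> Cls 1"
  proof
    fix a assume a: "a \<in> set ?z"
    then have "a \<in> set (zip ?R (map (\<lambda>i. n + 1 - i) ?R))" using upt_map_reverse by metis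
    then have "snd a = n + 1 - fst a" unfolding zip_map_same by auto
    then show "a \<in> Cls 1" using a z by (auto simp: cls_def idx_def)
  qed
  then have Fz: "?F 1 ?z = ?z" "?F 0 ?z = []" "?F 2 ?z = []"
    by (auto simp: filter_empty_conv intro!: filter_True)
  have "anti_count (\<lambda>p. N p + ?\<delta> p) = length (?F 1 (mw N @ ?z))"
    by (rule anti_count_mset) (use mset w'_def in simp)
  also have "\<dots> = anti_count N + length ?z"
    unfolding filter_append length_append Fz anti_count_def ..
  finally show "anti_count (\<lambda>p. N p + ?\<delta> p) = anti_count N + n" by simp
  let ?low = "monoM n r ` {N' \<in> expo n. anti_count N' < anti_count N + n}"
  obtain m where m: "sc ((- q) ^ m) * qD n - rowdet ?R n \<in> J" using qD_reverse by blast
  define c where "c = (- qi) ^ m"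
  have c: "(- q) ^ m * c = 1" unfolding c_def using q_qi by (simp flip: power_mult_distrib)
  then have cc: "sc c * (sc ((- q) ^ m) * x) = x" for x :: "(nat \<times> nat, 'a) fralg"
    by (simp add: mult.commute flip: mult.assoc sc_mult)
  have qD: "qD n - sc c * rowdet ?R n \<in> J"
    using fa_ideal_sc[OF m, of c] by (simp add: right_diff_distrib cc)
  define X :: "nat list \<Rightarrow> (nat \<times> nat, 'a) fralg" where "X ks = fa_word (A @ B @ zip ?R ks @ C)" for ks
  have expand: "fa_word (A @ B) * rowdet ?R n * fa_word C = X ?L +
     (\<Sum>ks\<in>?PS - {?L}. sc ((- q) ^ linv (\<lambda>a b. b < a) ks) * X ks)"
  proof -
    have "fa_word (A @ B) * rowdet ?R n * fa_word C = (\<Sum>ks\<in>?PS. sc ((- q) ^ linv (\<lambda>a b. b < a) ks) * X ks)"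
      unfolding rowdet_def X_def sum_distrib_left sum_distrib_right
      by (rule sum.cong) (simp_all add: fa_word_append mult.assoc sc_left_commute[of "fa_word _"])
    also have "\<dots> = X ?L + (\<Sum>ks\<in>?PS - {?L}. sc ((- q) ^ linv (\<lambda>a b. b < a) ks) * X ks)"
      by (subst sum.remove[OF _ upt_permutation]) (simp_all add: linv_sorted)
    finally show ?thesis .
  qed
  \<comment> \<open>The main term differs from the ordered word only by a permutation of
    antidiagonal letters; the outer blocks are the same.\<close>
  have main: "X ?L - fa_word w' \<in> J"
  proof -
    have w'_set: "set w' \<subseteq> idx n" and w'_sorted: "rsorted w'"
      unfolding w'_def by (rule set_mono rsorted_mono)+
    have ms: "mset (?F c w') = mset (?F c (mw N)) + mset (?F c ?z)" for c
      unfolding mset_filter mset[symmetric] by simp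
    have sorted_filter: "rsorted (?F c u)" if "rsorted u" for c u
      using that by (rule sorted_wrt_filter)
    note uniq = sorted_wrt_mset_unique[OF linear_order_onD(2)[OF r]]
    have ms0: "mset (?F 0 w') = mset A" and ms1: "mset (?F 1 w') = mset (B @ ?z)" and ms2: "mset (?F 2 w') = mset C"
      using ms[of 0] ms[of 1] ms[of 2] unfolding Fz A_def[symmetric] B_def[symmetric] C_def[symmetric] by simp_all
    have "?F 0 w' = A"
      by (rule uniq[OF _ _ ms0]) (use w'_sorted rsorted_mono in \<open>auto simp: A_def intro: sorted_filter\<close>)
    moreover have "?F 2 w' = C"
      by (rule uniq[OF _ _ ms2]) (use w'_sorted rsorted_mono in \<open>auto simp: C_def intro: sorted_filter\<close>)
    ultimately have w'_split: "w' = A @ ?F 1 w' @ C" using rsorted_split[OF w'_set w'_sorted] by simp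
    have "fa_word (B @ ?z) - fa_word (?F 1 w') \<in> J"
      by (rule antidiagonal_perm[OF ms1[symmetric]]) (use sub z1 in simp)
    from J_word_context[OF this subi(1,3)] have "X ?L - fa_word (A @ ?F 1 w' @ C) \<in> J" by (simp add: X_def)
    then show ?thesis using w'_split by simp
  qed
  \<comment> \<open>For the other terms: sort the factor from D by class, move \<open>B\<close> past
    its lower letters, and order the blocks. The factor contributes fewer than n antidiagonal
    letters, and none is created on the way.\<close>
  have rest: "X ks \<in> Sp ?low" if ks: "ks \<in> ?PS - {?L}" for ks
  proof -
    let ?w = "zip ?R ks"
    have w: "set ?w \<subseteq> idx n" using ks by (intro set_zip_reverse) simp
    have Fw: "set (?F c ?w) \<subseteq> Cls c" for c by (rule filter_cls[OF w])
    have Fwi: "set (?F c ?w) \<subseteq> idx n" for c using w by auto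
    have less: "length (?F 1 ?w) < n" using antidiagonal_count_less ks by blast
    have "set (A @ B) \<subseteq> idx n" using subi by simp
    from J_word_context[OF reverse_term_class_sort this subi(3), of ks] ks
    have J: "X ks - fa_word A * fa_word (B @ ?F 0 ?w) * fa_word (?F 1 ?w @ ?F 2 ?w @ C) \<in> J"
      by (simp add: X_def fa_word_append mult.assoc)
    have "fa_word A * fa_word (B @ ?F 0 ?w) * fa_word (?F 1 ?w @ ?F 2 ?w @ C) \<in> Sp ?low"
    proof (rule Sp_map[OF antidiagonal_past_lower[OF sub(2) Fw]])
      fix x assume "x \<in> LA (length B)"
      then obtain A' B' where x: "x = fa_word (A' @ B')" "set A' \<subseteq> Cls 0" "set B' \<subseteq> Cls 1" "length B' \<le> length B"
        by (auto simp: LA_def)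
      have "fa_word ((A @ A') @ (B' @ ?F 1 ?w) @ (?F 2 ?w @ C)) \<in>
         Sp (monoM n r ` {N \<in> expo n. anti_count N = length (B' @ ?F 1 ?w)})"
        by (rule class_word_span) (use sub x Fw in auto)
      moreover have "length (B' @ ?F 1 ?w) < anti_count N + n"
        using less x(4) by (simp add: anti_count_def B_def)
      ultimately have "fa_word ((A @ A') @ (B' @ ?F 1 ?w) @ (?F 2 ?w @ C)) \<in> Sp ?low"
        by (elim Sp_mono) auto
      then show "fa_word A * x * fa_word (?F 1 ?w @ ?F 2 ?w @ C) \<in> Sp ?low"
        unfolding x(1) by (simp add: fa_word_append mult.assoc)
    qed (use subi Fwi in auto)
    with J show ?thesis by (rule Sp_cong)
  qed
  \<comment> \<open>Four contributions: moving D in front of \<open>C\<close>, replacing D by its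
    reversed expansion, the main term, and the remaining terms. The first three vanish modulo the
    relations.\<close>
  have "monoM n r N * qD n - sc c * monoM n r (\<lambda>p. N p + ?\<delta> p) =
     fa_word (A @ B) * (fa_word C * qD n - qD n * fa_word C) +
     fa_word (A @ B) * (qD n - sc c * rowdet ?R n) * fa_word C +
     sc c * (X ?L - fa_word w') + sc c * (\<Sum>ks\<in>?PS - {?L}. sc ((- q) ^ linv (\<lambda>a b. b < a) ks) * X ks)"
  proof -
    have "fa_word (A @ B) * (sc c * rowdet ?R n) * fa_word C = sc c * X ?L +
       sc c * (\<Sum>ks\<in>?PS - {?L}. sc ((- q) ^ linv (\<lambda>a b. b < a) ks) * X ks)"
      unfolding sc_left_commute mult.assoc[of "sc c"] expand distrib_left ..
    then show ?thesis
      unfolding monoM_def w w'_def[symmetric] fa_word_append[of "A @ B" C, unfolded append_assoc]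
      by (simp add: right_diff_distrib left_diff_distrib mult.assoc)
  qed
  also have "\<dots> \<in> Sp ?low"
  proof (intro Sp_add)
    have on: "fa_word (A @ B) \<in> fa_on (idx n)" "fa_word C \<in> fa_on (idx n)" using subi by auto
    show "fa_word (A @ B) * (fa_word C * qD n - qD n * fa_word C) \<in> Sp ?low"
      by (rule Sp_J, rule fa_ideal_mult_left[OF J_sym[OF qD_commute[OF on(2)]] on(1)])
    show "fa_word (A @ B) * (qD n - sc c * rowdet ?R n) * fa_word C \<in> Sp ?low"
      by (rule Sp_J, rule fa_ideal_mult[OF qD on])
    show "sc c * (X ?L - fa_word w') \<in> Sp ?low"
      by (rule Sp_J, rule fa_ideal_sc[OF main])
    show "sc c * (\<Sum>ks\<in>?PS - {?L}. sc ((- q) ^ linv (\<lambda>a b. b < a) ks) * X ks) \<in> Sp ?low"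
      by (intro Sp_sc Sp_sum rest)
  qed
  finally show "\<exists>u u'. u' * u = 1 \<and> monoM n r N * qD n - sc u * monoM n r (\<lambda>p. N p + ?\<delta> p) \<in> Sp ?low"
    using c by blast
qed

end

section \<open>The general and the special linear case\<close>

declare One_nat_def [simp del]

lemma reindex_basis:
  assumes "pres_basis G S b I" "bij_betw \<phi> I' I" "\<And>i. i \<in> I' \<Longrightarrow> b' i = b (\<phi> i)"
  shows "pres_basis G S b' I'"
proof (rule triangular_basis[where \<mu> = "\<lambda>_. 0", OF assms(1) _ assms(2)])
  show "b' i \<in> fa_on G" if "i \<in> I'" for i
    using that assms pres_basis_on[OF assms(1)] by (auto simp: bij_betw_def)
  show "\<exists>u u'. u' * u = 1 \<and> b' i - sc u * b (\<phi> i) \<in> lspan (fa_ideal G S \<union> b ` {j \<in> I. (0::nat) < 0})"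
    if "i \<in> I'" for i
    using assms(3)[OF that] by (intro exI[of _ 1]) (simp add: lspan.zero)
qed

text \<open>A relation modulo the larger ideal becomes one in the old algebra after subtracting
  members outside \<open>I0\<close>. The two index sets are disjoint, so the coefficients on
  \<open>I0\<close> vanish.\<close>

lemma quotient_basis:
  fixes b :: "'i \<Rightarrow> ('g, 'a::comm_ring_1) fralg"
  assumes basis: "pres_basis G S b I" and sub: "S \<subseteq> S'" "I0 \<subseteq> I"
    and ideal: "\<And>x. x \<in> fa_ideal G S' \<Longrightarrow> x \<in> lspan (fa_ideal G S \<union> b ` (I - I0))"
    and vanish: "\<And>i. i \<in> I - I0 \<Longrightarrow> b i \<in> fa_ideal G S'"
  shows "pres_basis G S' b I0"
proof (rule pres_basisI)
  show "b i \<in> fa_on G" if "i \<in> I0" for i using that sub pres_basis_on[OF basis] by blast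
next
  fix p :: "('g, 'a) fralg" assume "p \<in> fa_on G"
  from pres_basis_span[OF basis this] show "p \<in> lspan (fa_ideal G S' \<union> b ` I0)"
  proof (rule lspan_minimal)
    fix x assume "x \<in> fa_ideal G S \<union> b ` I"
    then have "x \<in> fa_ideal G S' \<union> b ` I0"
      using vanish sub fa_ideal_mono[of x G S G S'] by blast
    then show "x \<in> lspan (fa_ideal G S' \<union> b ` I0)" by (rule lspan_base)
  qed
next
  fix K c i0
  assume K: "finite K" "K \<subseteq> I0" "(\<Sum>i\<in>K. sc (c i) * b i) \<in> fa_ideal G S'" "i0 \<in> K"
  obtain s where s: "s \<in> lspan (b ` (I - I0))" "(\<Sum>i\<in>K. sc (c i) * b i) - s \<in> fa_ideal G S"
    using lspan_Un_ideal[OF ideal[OF K(3)]] by blast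
  obtain L d where L: "finite L" "L \<subseteq> I - I0" "s = (\<Sum>i\<in>L. sc (d i) * b i)"
    using lspan_image_sum[OF s(1)] by blast
  define e where "e i = (if i \<in> K then c i else - d i)" for i
  have disj: "K \<inter> L = {}" using K L by auto
  have "(\<Sum>i\<in>K \<union> L. sc (e i) * b i) = (\<Sum>i\<in>K. sc (e i) * b i) + (\<Sum>i\<in>L. sc (e i) * b i)"
    using K L disj by (intro sum.union_disjoint) auto
  also have "(\<Sum>i\<in>K. sc (e i) * b i) = (\<Sum>i\<in>K. sc (c i) * b i)" by (simp add: e_def)
  also have "(\<Sum>i\<in>L. sc (e i) * b i) = (\<Sum>i\<in>L. - (sc (d i) * b i))"
    by (rule sum.cong) (use disj in \<open>auto simp: e_def sc_uminus\<close>)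
  also have "(\<Sum>i\<in>K. sc (c i) * b i) + \<dots> = (\<Sum>i\<in>K. sc (c i) * b i) - s"
    by (simp add: L(3) sum_negf)
  finally have "(\<Sum>i\<in>K \<union> L. sc (e i) * b i) \<in> fa_ideal G S" using s(2) by simp
  from pres_basis_indep[OF basis _ _ this, of i0] have "e i0 = 0"
    using K L sub by auto
  then show "c i0 = 0" using K(4) by (simp add: e_def)
qed

text \<open>Common frame for both parts of the theorem: \<open>f\<close> gives the column of the
  leading letter in each row, i on the diagonal and n + 1 - i on the antidiagonal.\<close>

locale determinant_basis = ordered_quantum_matrices q qi n r for q qi :: "'a::comm_ring_1" and n r +
  fixes f :: "nat \<Rightarrow> nat" and \<mu> :: "(nat \<times> nat \<Rightarrow> nat) \<Rightarrow> nat" and c :: nat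
  assumes n_pos: "1 \<le> n"
    and f: "\<And>i. i \<in> {1..n} \<Longrightarrow> f i \<in> {1..n}"
    and leading: "leading (\<lambda>(i, j). if i \<in> {1..n} \<and> j = f i then 1 else 0) \<mu> c"
begin

definition \<delta> :: "nat \<times> nat \<Rightarrow> nat" where
  "\<delta> = (\<lambda>(i, j). if i \<in> {1..n} \<and> j = f i then 1 else 0)"

text \<open>The highest power of the leading monomial of D that divides the monomial N.\<close>

definition mn :: "(nat \<times> nat \<Rightarrow> nat) \<Rightarrow> nat" where
  "mn N = Min {N (i, f i) | i. i \<in> {1..n}}"

definition shift :: "(nat \<times> nat \<Rightarrow> nat) \<Rightarrow> nat \<Rightarrow> nat \<times> nat \<Rightarrow> nat" where
  "shift N k = (\<lambda>p. N p + k * \<delta> p)"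

definition unshift :: "(nat \<times> nat \<Rightarrow> nat) \<Rightarrow> nat \<times> nat \<Rightarrow> nat" where
  "unshift N = (\<lambda>p. N p - mn N * \<delta> p)"

abbreviation "expo0 \<equiv> {N \<in> expo n. mn N = 0}"

lemma finite_diag: "finite {N (i, f i) | i. i \<in> {1..n}}" for N :: "nat \<times> nat \<Rightarrow> nat"
  by (simp add: setcompr_eq_image)
lemma diag_ne: "{N (i, f i) | i. i \<in> {1..n}} \<noteq> {}" for N :: "nat \<times> nat \<Rightarrow> nat"
  using n_pos by auto

lemma mn_le: "i \<in> {1..n} \<Longrightarrow> mn N \<le> N (i, f i)"
  unfolding mn_def by (intro Min_le[OF finite_diag]) auto
lemma mn_attained: "\<exists>i\<in>{1..n}. mn N = N (i, f i)"
  using Min_in[OF finite_diag diag_ne, of N] unfolding mn_def by auto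
lemma mn_eqI: "(\<And>i. i \<in> {1..n} \<Longrightarrow> m \<le> N (i, f i)) \<Longrightarrow> i \<in> {1..n} \<Longrightarrow> N (i, f i) = m \<Longrightarrow> mn N = m"
  using mn_le[of i N] mn_attained[of N] by fastforce

lemma \<delta>_diag: "i \<in> {1..n} \<Longrightarrow> \<delta> (i, f i) = 1" by (simp add: \<delta>_def)
lemma \<delta>_cases: "\<delta> p = 0 \<or> (\<exists>i\<in>{1..n}. p = (i, f i) \<and> \<delta> p = 1)"
  by (cases p) (auto simp: \<delta>_def)

lemma shift_expo: "N \<in> expo n \<Longrightarrow> shift N k \<in> expo n"
  using f by (auto simp: expo_def shift_def \<delta>_def idx_def)
lemma unshift_expo: "N \<in> expo n \<Longrightarrow> unshift N \<in> expo n"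
  by (auto simp: expo_def unshift_def)

lemma mn_shift: "mn (shift N k) = mn N + k"
proof -
  obtain i where i: "i \<in> {1..n}" "mn N = N (i, f i)" using mn_attained by blast
  show ?thesis by (rule mn_eqI[OF _ i(1)]) (use i mn_le[of _ N] in \<open>simp_all add: shift_def \<delta>_diag\<close>)
qed

lemma mn_unshift: "mn (unshift N) = 0"
proof -
  obtain i where i: "i \<in> {1..n}" "mn N = N (i, f i)" using mn_attained by blast
  show ?thesis by (rule mn_eqI[OF _ i(1)]) (use i in \<open>simp_all add: unshift_def \<delta>_diag\<close>)
qed

lemma shift_unshift: "shift (unshift N) (mn N) = N"
proof
  fix p
  show "shift (unshift N) (mn N) p = N p"
    using \<delta>_cases[of p] mn_le[of _ N] by (auto simp: shift_def unshift_def)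
qed

lemma unshift_shift: "mn N = 0 \<Longrightarrow> unshift (shift N k) = N"
  by (auto simp: unshift_def mn_shift) (auto simp: shift_def)

lemma shift_0: "shift N 0 = N" by (simp add: shift_def)
lemma unshift_eq: "mn N = 0 \<Longrightarrow> unshift N = N" by (simp add: unshift_def)

text \<open>Division by the leading monomial: each exponent is uniquely a remainder that it does not
  divide plus a multiple of \<open>\<delta>\<close>.\<close>

lemma bij_shift: "bij_betw (\<lambda>(N, k). shift N k) (expo0 \<times> UNIV) (expo n)"
proof (rule bij_betwI[where g = "\<lambda>N. (unshift N, mn N)"])
  show "(\<lambda>(N, k). shift N k) \<in> expo0 \<times> UNIV \<rightarrow> expo n" by (auto intro: shift_expo)
  show "(\<lambda>N. (unshift N, mn N)) \<in> expo n \<rightarrow> expo0 \<times> UNIV" by (auto intro: unshift_expo mn_unshift)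
qed (auto simp: unshift_shift mn_shift shift_unshift)

abbreviation "low m \<equiv> monoM n r ` {N \<in> expo n. \<mu> N < m}"

lemma leadingD:
  assumes "N \<in> expo n"
  shows "\<mu> (\<lambda>p. N p + \<delta> p) = \<mu> N + c"
    "\<exists>u u'. u' * u = 1 \<and> monoM n r N * qD n - sc u * monoM n r (\<lambda>p. N p + \<delta> p) \<in> Sp (low (\<mu> N + c))"
  using leading assms unfolding leading_def \<delta>_def by auto

lemma mono_det_low:
  assumes "N \<in> expo n" "\<mu> N < m"
  shows "monoM n r N * qD n \<in> Sp (low (m + c))"
proof -
  obtain u where "monoM n r N * qD n - sc u * monoM n r (\<lambda>p. N p + \<delta> p) \<in> Sp (low (\<mu> N + c))"
    using leadingD[OF assms(1)] by blast
  then have "monoM n r N * qD n - sc u * monoM n r (\<lambda>p. N p + \<delta> p) \<in> Sp (low (m + c))"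
    by (rule Sp_mono) (use assms in auto)
  moreover have "monoM n r (\<lambda>p. N p + \<delta> p) \<in> Sp (low (m + c))"
    using shift_expo[OF assms(1), of 1] assms leadingD[OF assms(1)] by (intro Sp_base imageI) (simp add: shift_def)
  ultimately have "(monoM n r N * qD n - sc u * monoM n r (\<lambda>p. N p + \<delta> p)) + sc u * monoM n r (\<lambda>p. N p + \<delta> p)
     \<in> Sp (low (m + c))" by (intro Sp_add Sp_sc)
  then show ?thesis by simp
qed

text \<open>In the induction step the error for the k-th power is multiplied by D once more;
  \<open>mono_det_low\<close> raises its bound by c, just as the weight of the leading term
  rises.\<close>

lemma leading_power:
  assumes N: "N \<in> expo n"
  shows "\<mu> (shift N k) = \<mu> N + k * c \<and>
     (\<exists>u u'. u' * u = 1 \<and> monoM n r N * qD n ^ k - sc u * monoM n r (shift N k) \<in> Sp (low (\<mu> (shift N k))))"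
proof (induction k)
  case 0
  show ?case by (auto simp: shift_def intro!: exI[of _ 1] Sp_zero)
next
  case (Suc k)
  let ?s = "shift N k" and ?m = "\<mu> N + k * c"
  have s: "?s \<in> expo n" by (rule shift_expo[OF N])
  have Suc_s: "shift N (Suc k) = (\<lambda>p. ?s p + \<delta> p)" by (auto simp: shift_def)
  from Suc obtain u u' where u: "u' * u = 1" "\<mu> ?s = ?m"
    "monoM n r N * qD n ^ k - sc u * monoM n r ?s \<in> Sp (low ?m)" by auto
  obtain v v' where v: "v' * v = 1"
    "monoM n r ?s * qD n - sc v * monoM n r (shift N (Suc k)) \<in> Sp (low (?m + c))"
    using leadingD(2)[OF s] unfolding Suc_s u(2) by blast
  have \<mu>: "\<mu> (shift N (Suc k)) = ?m + c" using leadingD(1)[OF s] unfolding Suc_s u(2) .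
  have "(monoM n r N * qD n ^ k - sc u * monoM n r ?s) * qD n \<in> Sp (low (?m + c))"
    by (rule Sp_map_right[OF u(3) _ qD_on]) (auto intro: mono_det_low)
  then have "(monoM n r N * qD n ^ k - sc u * monoM n r ?s) * qD n +
     sc u * (monoM n r ?s * qD n - sc v * monoM n r (shift N (Suc k))) \<in> Sp (low (?m + c))"
    using v(2) by (intro Sp_add Sp_sc)
  also have "(monoM n r N * qD n ^ k - sc u * monoM n r ?s) * qD n +
     sc u * (monoM n r ?s * qD n - sc v * monoM n r (shift N (Suc k))) =
     monoM n r N * qD n ^ Suc k - sc (u * v) * monoM n r (shift N (Suc k))"
    unfolding power_Suc2 by (simp add: algebra_simps sc_mult)
  finally have "monoM n r N * qD n ^ Suc k - sc (u * v) * monoM n r (shift N (Suc k)) \<in> Sp (low (?m + c))" .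
  moreover have "(u' * v') * (u * v) = 1"
    using u(1) v(1) by (metis mult.assoc mult.commute mult_1)
  ultimately show ?case unfolding \<mu> by (auto simp: add.commute add.left_commute)
qed

definition MD :: "(nat \<times> nat \<Rightarrow> nat) \<times> nat \<Rightarrow> (nat \<times> nat, 'a) fralg" where
  "MD = (\<lambda>(N, k). monoM n r N * qD n ^ k)"

lemma MD_on: "MD x \<in> fa_on (idx n)"
  by (cases x) (auto simp: MD_def intro!: fa_on_mult fa_on_power monoM_on qD_on)

lemma MD_triangular:
  assumes "i \<in> expo0 \<times> UNIV"
  shows "\<exists>u u'. u' * u = 1 \<and> MD i - sc u * monoM n r ((\<lambda>(N, k). shift N k) i) \<in>
     lspan (J \<union> monoM n r ` {N \<in> expo n. \<mu> N < \<mu> ((\<lambda>(N, k). shift N k) i)})"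
  using assms leading_power[of "fst i" "snd i"] unfolding Sp_def MD_def by (cases i) auto

lemma MD_basis: "pres_basis (GM n) (RM n q qi) MD (expo0 \<times> UNIV)"
proof (rule triangular_basis[OF monoM_basis _ bij_shift])
  show "MD i \<in> fa_on (GM n)" for i using MD_on by (simp add: GM_def)
  show "\<exists>u u'. u' * u = 1 \<and> MD i - sc u * monoM n r ((\<lambda>(N, k). shift N k) i) \<in>
     lspan (fa_ideal (GM n) (RM n q qi) \<union> monoM n r ` {N \<in> expo n. \<mu> N < \<mu> ((\<lambda>(N, k). shift N k) i)})"
    if "i \<in> expo0 \<times> UNIV" for i
    using MD_triangular[OF that] by (simp add: GM_def)
qed

lemma power_commute:
  assumes "p \<in> fa_on (idx n)"
  shows "qD n ^ k * p - p * qD n ^ k \<in> J"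
proof (induction k)
  case (Suc k)
  have "qD n ^ Suc k * p - p * qD n ^ Suc k =
     qD n * (qD n ^ k * p - p * qD n ^ k) + (qD n * p - p * qD n) * qD n ^ k"
    by (simp add: algebra_simps)
  also have "\<dots> \<in> J"
    by (intro fa_ideal.add fa_ideal_mult_left fa_ideal_mult_right Suc qD_commute assms qD_on fa_on_power)
  finally show ?case .
qed (simp add: fa_ideal.zero)

abbreviation "JSL \<equiv> fa_ideal (idx n) (RSL n q qi)"

text \<open>Because D is central, the factor D - 1 can be moved to the front modulo the relations,
  so the two-sided ideal reduces to one-sided multiples.\<close>

lemma JSL_form:
  assumes "x \<in> JSL"
  shows "\<exists>y\<in>fa_on (idx n). x - (qD n - 1) * y \<in> J"
  using assms
proof induction
  case (gen s)
  then consider "s \<in> RM n q qi" | "s = qD n - 1"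
    by (auto simp: RSL_def RM_def qdet_id fa_one_eq)
  then show ?case
  proof cases
    case 1
    then show ?thesis by (intro bexI[of _ 0]) (auto intro: fa_ideal.gen)
  next
    case 2
    then show ?thesis by (intro bexI[of _ 1]) (auto intro: fa_ideal.zero)
  qed
next
  case zero
  show ?case by (intro bexI[of _ 0]) (auto intro: fa_ideal.zero)
next
  case (add x x')
  then obtain y y' where y: "y \<in> fa_on (idx n)" "x - (qD n - 1) * y \<in> J"
    "y' \<in> fa_on (idx n)" "x' - (qD n - 1) * y' \<in> J" by blast
  have "x + x' - (qD n - 1) * (y + y') = (x - (qD n - 1) * y) + (x' - (qD n - 1) * y')"
    by (simp add: algebra_simps)
  then have "x + x' - (qD n - 1) * (y + y') \<in> J" using fa_ideal.add[OF y(2,4)] by (simp only:)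
  then show ?case using y(1,3) by (intro bexI[of _ "y + y'"]) auto
next
  case (mult x u v a)
  then obtain y where y: "y \<in> fa_on (idx n)" "x - (qD n - 1) * y \<in> J" by blast
  have on: "fa_word u \<in> fa_on (idx n)" "fa_word v \<in> fa_on (idx n)" using mult by auto
  \<comment> \<open>The last summand contains the commutator of D with the left word, the price of
    moving D - 1 in front of it.\<close>
  have "fa_scal a (fa_mul (fa_word u) (fa_mul x (fa_word v))) - (qD n - 1) * (sc a * (fa_word u * y * fa_word v))
     = sc a * (fa_word u * (x - (qD n - 1) * y) * fa_word v) - sc a * ((qD n * fa_word u - fa_word u * qD n) * (y * fa_word v))"
    by (simp add: fa_simps algebra_simps sc_left_commute[of "qD n"])
  also have "\<dots> \<in> J"
    by (intro fa_ideal_diff fa_ideal_sc fa_ideal_mult fa_ideal_mult_right qD_commute on y fa_on_mult)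
  finally show ?case using on y by (intro bexI[of _ "sc a * (fa_word u * y * fa_word v)"]) (auto intro!: fa_on_mult)
qed

text \<open>A basis adapted to the ideal generated by \<open>D - 1\<close>: modulo the relations the ideal is spanned by
  the members with \<open>k > 0\<close>.\<close>
definition MDdiff :: "(nat \<times> nat \<Rightarrow> nat) \<times> nat \<Rightarrow> (nat \<times> nat, 'a) fralg" where
  "MDdiff = (\<lambda>(N, k). if k = 0 then monoM n r N else MD (N, k) - MD (N, k - 1))"

lemma MDdiff_basis: "pres_basis (idx n) (RM n q qi) MDdiff (expo0 \<times> UNIV)"
proof (rule triangular_basis[where \<phi> = "\<lambda>x. x" and \<mu> = snd])
  show "pres_basis (idx n) (RM n q qi) MD (expo0 \<times> UNIV)" using MD_basis by (simp add: GM_def)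
  show "MDdiff i \<in> fa_on (idx n)" for i
    by (cases i) (auto simp: MDdiff_def intro!: fa_on_diff MD_on monoM_on)
  show "bij_betw (\<lambda>x. x) (expo0 \<times> UNIV) (expo0 \<times> UNIV)" by (simp add: bij_betw_def)
  show "\<exists>u u'. u' * u = 1 \<and> MDdiff i - sc u * MD i \<in> lspan (J \<union> MD ` {j \<in> expo0 \<times> UNIV. snd j < snd i})"
    if "i \<in> expo0 \<times> UNIV" for i
  proof -
    obtain N k where i: "i = (N, k)" by (cases i)
    have "MDdiff i - MD i \<in> lspan (J \<union> MD ` {j \<in> expo0 \<times> UNIV. snd j < snd i})"
    proof (cases k)
      case 0
      then show ?thesis by (simp add: i MDdiff_def MD_def lspan.zero)
    next
      case (Suc m)
      have "MD (N, m) \<in> lspan (J \<union> MD ` {j \<in> expo0 \<times> UNIV. snd j < snd i})"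
        using that Suc i by (intro lspan_base) auto
      then show ?thesis using Suc by (simp add: i MDdiff_def lspan_uminus)
    qed
    then show ?thesis by (intro exI[of _ 1]) simp
  qed
qed

text \<open>A member of \<open>MDdiff\<close> with positive second index is the preceding member of
  \<open>MD\<close> times D - 1, so these members span the ideal of D - 1 modulo the relations. What
  survives are the monomials in \<open>expo0\<close>.\<close>

theorem SL_basis: "pres_basis (GSL n) (RSL n q qi) (monoM n r) expo0"
proof (rule reindex_basis[where \<phi> = "\<lambda>N. (N, 0)"])
  show "pres_basis (GSL n) (RSL n q qi) MDdiff (expo0 \<times> {0})"
    unfolding GSL_def
  proof (rule quotient_basis[OF MDdiff_basis])
    show "RM n q qi \<subseteq> RSL n q qi" by (auto simp: RM_def RSL_def)
    show "expo0 \<times> {0} \<subseteq> expo0 \<times> UNIV" by auto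
    have D1: "qD n - 1 \<in> JSL" by (rule fa_ideal.gen) (simp add: RSL_def qdet_id fa_one_eq)
    have MDdiff_Suc: "MDdiff (N, Suc k) = monoM n r N * qD n ^ k * (qD n - 1)" for N k
      unfolding MDdiff_def MD_def by (simp add: right_diff_distrib mult.assoc power_commutes)
    show "MDdiff i \<in> JSL" if i: "i \<in> expo0 \<times> UNIV - expo0 \<times> {0}" for i
    proof -
      obtain N k where "i = (N, k)" "k \<noteq> 0" using i by (cases i) auto
      then obtain k where i: "i = (N, Suc k)" by (cases k) auto
      show ?thesis unfolding i MDdiff_Suc
        by (rule fa_ideal_mult_left[OF D1]) (intro fa_on_mult fa_on_power monoM_on qD_on)
    qed
    fix x assume "x \<in> JSL"
    then obtain y where y: "y \<in> fa_on (idx n)" "x - (qD n - 1) * y \<in> J" using JSL_form by blast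
    let ?Y = "J \<union> MDdiff ` (expo0 \<times> UNIV - expo0 \<times> {0})"
    have ysp: "y \<in> lspan (J \<union> MD ` (expo0 \<times> UNIV))"
      using pres_basis_span[OF MD_basis] y(1) by (simp add: GM_def)
    have "y * (qD n - 1) \<in> lspan ?Y"
    proof -
      have "1 * y * (qD n - 1) \<in> lspan ?Y"
      proof (rule lspan_map[OF ysp])
        fix z assume z: "z \<in> J \<union> MD ` (expo0 \<times> UNIV)"
        show "1 * z * (qD n - 1) \<in> lspan ?Y"
        proof (cases "z \<in> J")
          case True
          then have "z * (qD n - 1) \<in> J" by (rule fa_ideal_mult_right) (intro fa_on_diff qD_on fa_on_1)
          then show ?thesis by (intro lspan_base) simp
        next
          case False
          with z obtain N k where "N \<in> expo0" "z = MD (N, k)" by auto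
          then have "1 * z * (qD n - 1) = MDdiff (N, Suc k)" "(N, Suc k) \<in> expo0 \<times> UNIV - expo0 \<times> {0}"
            by (simp_all add: MDdiff_Suc MD_def)
          then show ?thesis by (intro lspan_base) (simp only: UnI2 imageI)
        qed
      qed
      then show ?thesis by simp
    qed
    moreover have "x - y * (qD n - 1) \<in> J"
    proof -
      have "x - y * (qD n - 1) = (x - (qD n - 1) * y) + (qD n * y - y * qD n)" by (simp add: algebra_simps)
      also have "\<dots> \<in> J" by (intro fa_ideal.add y qD_commute)
      finally show ?thesis .
    qed
    ultimately have "(x - y * (qD n - 1)) + y * (qD n - 1) \<in> lspan ?Y"
      by (intro lspan_add) (auto intro: lspan_base)
    then show "x \<in> lspan ?Y" by simp
  qed
  show "bij_betw (\<lambda>N. (N, 0)) expo0 (expo0 \<times> {0})" by (auto simp: bij_betw_def inj_on_def)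
  show "monoM n r N = MDdiff (N, 0)" for N by (simp add: MDdiff_def)
qed

section \<open>Localisation at the determinant\<close>

definition emb :: "(nat \<times> nat, 'a) fralg \<Rightarrow> ((nat \<times> nat) option, 'a) fralg" where
  "emb = lin (\<lambda>w. fa_word (map Some w))"

lemma emb_word: "emb (fa_word w) = fa_word (map Some w)" by (simp add: emb_def)
lemma emb_add: "emb (x + y) = emb x + emb y" by (simp add: emb_def lin_add)
lemma emb_diff: "emb (x - y) = emb x - emb y" by (simp add: emb_def lin_diff)
lemma emb_0: "emb 0 = 0" by (simp add: emb_def)
lemma emb_sc: "emb (sc a * x) = sc a * emb x" by (simp add: emb_def lin_sc)
lemma emb_1: "emb 1 = 1" using emb_word[of "[]"] by simp
lemma emb_sum: "emb (sum g A) = (\<Sum>x\<in>A. emb (g x))" by (simp add: emb_def lin_sum)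

lemma emb_mult: "emb (x * y) = emb x * emb y"
proof (induction x rule: fralg_induct)
  case (word a w)
  show ?case
  proof (induction y rule: fralg_induct)
    case (word b w')
    have "sc a * fa_word w * (sc b * fa_word w') = sc a * (sc b * fa_word (w @ w'))"
      by (simp add: fa_word_append mult.assoc sc_left_commute[of "fa_word w"])
    moreover have "sc a * fa_word (map Some w) * (sc b * fa_word (map Some w')) = sc a * (sc b * fa_word (map Some (w @ w')))"
      by (simp add: fa_word_append mult.assoc sc_left_commute[of "fa_word (map Some w)"])
    ultimately show ?case by (simp add: emb_sc emb_word)
  qed (simp_all add: emb_0 emb_add distrib_left)
qed (simp_all add: emb_0 emb_add distrib_right)

lemma emb_power: "emb (x ^ k) = emb x ^ k"
  by (induction k) (simp_all add: emb_1 emb_mult)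

lemma map_Some_GGL: "set w \<subseteq> idx n \<Longrightarrow> set (map Some w) \<subseteq> GGL n"
  unfolding GGL_def set_map by blast

lemma emb_on: "p \<in> fa_on (idx n) \<Longrightarrow> emb p \<in> fa_on (GGL n)"
proof (induction rule: fa_on_induct)
  case (word a w)
  then show ?case
    unfolding emb_sc emb_word by (intro fa_on_mult fa_on_sc) (simp only: fa_on_word map_Some_GGL)
qed (auto simp: emb_0 emb_add)

lemma emb_qmat_rels: "qmat_rels n q qi Some = emb ` RM n q qi"
proof -
  have 1: "emb (fa_word [a, b]) = fa_word [Some a, Some b]" for a b by (simp add: emb_word)
  have 2: "emb ` {F i j k | i j k. P i j k} = {emb (F i j k) | i j k. P i j k}"
    for F and P :: "nat \<Rightarrow> nat \<Rightarrow> nat \<Rightarrow> bool" by blast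
  have 3: "emb ` {F i j k l | i j k l. P i j k l} = {emb (F i j k l) | i j k l. P i j k l}"
    for F and P :: "nat \<Rightarrow> nat \<Rightarrow> nat \<Rightarrow> nat \<Rightarrow> bool" by blast
  show ?thesis
    by (simp only: RM_def qmat_rels_def tq_mult fa_scal_eq id_apply image_Un 2 3 emb_diff emb_sc 1)
qed

lemma fa_ideal_on:
  assumes "\<And>s. s \<in> S \<Longrightarrow> s \<in> fa_on G" "x \<in> fa_ideal G S"
  shows "x \<in> fa_on G"
  using assms(2)
proof induction
  case (mult x u v a)
  then show ?case unfolding fa_simps by (intro fa_on_mult fa_on_sc) simp_all
qed (auto intro: assms(1))

lemma RM_on: "s \<in> RM n q qi \<Longrightarrow> s \<in> fa_on (idx n)"
  unfolding RM_def qmat_rels_def tq_mult fa_scal_eq id_apply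
  by (elim UnE CollectE exE conjE; hypsubst; intro fa_on_diff fa_on_mult fa_on_sc; simp add: idx_def)

abbreviation "JGL \<equiv> fa_ideal (GGL n) (RGL n q qi)"
abbreviation "DGL \<equiv> emb (qD n)"

lemma qdet_Some: "qdet n q Some = DGL"
  unfolding qdet_eq rowdet_def emb_sum emb_sc emb_word ..

lemma Dinv_word: "Dinv = fa_word [None]" by (simp add: Dinv_def fa_gen_def)

lemma RGL_eq: "RGL n q qi = emb ` RM n q qi \<union> {Dinv * DGL - 1, DGL * Dinv - 1}"
  by (simp add: RGL_def emb_qmat_rels fa_mul_eq fa_one_eq qdet_Some)

lemma DGL_on: "DGL \<in> fa_on (GGL n)" by (intro emb_on qD_on)
lemma Dinv_on: "Dinv \<in> fa_on (GGL n)" by (simp add: Dinv_word GGL_def)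

lemma JGL_on: "x \<in> JGL \<Longrightarrow> x \<in> fa_on (GGL n)"
proof (rule fa_ideal_on)
  show "s \<in> fa_on (GGL n)" if "s \<in> RGL n q qi" for s
    using that RM_on unfolding RGL_eq by (auto intro!: emb_on fa_on_diff fa_on_mult DGL_on Dinv_on)
qed

lemma J_JGL: "x \<in> J \<Longrightarrow> emb x \<in> JGL"
proof (induction rule: fa_ideal.induct)
  case (gen s)
  then show ?case by (intro fa_ideal.gen) (simp add: RGL_eq)
next
  case (mult x u v a)
  have "fa_word (map Some u) * emb x * fa_word (map Some v) \<in> JGL"
    using mult by (intro fa_ideal_mult) (simp_all only: fa_on_word map_Some_GGL)
  from fa_ideal_sc[OF this, of a] show ?case unfolding fa_simps emb_sc by (simp add: emb_mult emb_word mult.assoc)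
qed (simp_all add: emb_0 emb_add fa_ideal.zero fa_ideal.add)

definition strip :: "(nat \<times> nat) option list \<Rightarrow> (nat \<times> nat) list" where
  "strip w = map the (filter (\<lambda>x. x \<noteq> None) w)"
definition nones :: "(nat \<times> nat) option list \<Rightarrow> nat" where
  "nones w = length (filter (\<lambda>x. x = None) w)"

text \<open>Multiplication by \<open>D\<^sup>K\<close> clears the denominators of all words with at most \<open>K\<close> letters
  \<open>None\<close>; for the other words the truncated subtraction makes the value irrelevant.\<close>
definition clear :: "nat \<Rightarrow> ((nat \<times> nat) option, 'a) fralg \<Rightarrow> (nat \<times> nat, 'a) fralg" where
  "clear K = lin (\<lambda>w. fa_word (strip w) * qD n ^ (K - nones w))"

lemma strip_simps [simp]: "strip (u @ v) = strip u @ strip v" "strip (map Some w) = w" "strip [] = []"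
  "strip (replicate m None) = []"
  by (simp_all add: strip_def comp_def)
lemma nones_simps [simp]: "nones (u @ v) = nones u + nones v" "nones (map Some w) = 0" "nones [] = 0"
  "nones (replicate m None) = m"
  by (simp_all add: nones_def comp_def)

lemma strip_idx: "set w \<subseteq> GGL n \<Longrightarrow> set (strip w) \<subseteq> idx n"
  by (force simp: strip_def GGL_def)

lemma clear_emb:
  "clear K (fa_word u * emb p * fa_word v) =
     fa_word (strip u) * p * fa_word (strip v) * qD n ^ (K - (nones u + nones v))"
proof (induction p rule: fralg_induct)
  case (word a w)
  have "fa_word u * emb (sc a * fa_word w) * fa_word v = sc a * fa_word (u @ map Some w @ v)"
    by (simp add: emb_sc emb_word fa_word_append mult.assoc sc_left_commute[of "fa_word u"])
  moreover have "fa_word (strip u) * (sc a * fa_word w) * fa_word (strip v) = sc a * fa_word (strip u @ w @ strip v)"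
    by (simp add: fa_word_append mult.assoc sc_left_commute[of "fa_word (strip u)"])
  ultimately show ?case by (simp add: clear_def lin_sc mult.assoc)
qed (simp_all add: emb_0 emb_add clear_def lin_add distrib_left distrib_right)

text \<open>The exponents of D on both sides agree even where the subtraction is truncated. What
  remains is to move a power of D past the letters of \<open>v\<close>, which centrality
  permits.\<close>

lemma clear_mult:
  assumes uv: "set u \<subseteq> GGL n" "set v \<subseteq> GGL n" and x: "x \<in> fa_on (GGL n)"
  shows "clear K (fa_word u * x * fa_word v) -
     fa_word (strip u) * clear (K - (nones u + nones v)) x * fa_word (strip v) \<in> J"
  using x
proof (induction rule: fa_on_induct)
  case (add x y)
  have "clear K (fa_word u * (x + y) * fa_word v) -
     fa_word (strip u) * clear (K - (nones u + nones v)) (x + y) * fa_word (strip v) =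
     (clear K (fa_word u * x * fa_word v) - fa_word (strip u) * clear (K - (nones u + nones v)) x * fa_word (strip v)) +
     (clear K (fa_word u * y * fa_word v) - fa_word (strip u) * clear (K - (nones u + nones v)) y * fa_word (strip v))"
    by (simp add: clear_def lin_add distrib_left distrib_right)
  with fa_ideal.add[OF add] show ?case by (simp only:)
next
  case (word a w)
  let ?P = "qD n ^ (K - (nones u + nones v) - nones w)"
  have "fa_word u * (sc a * fa_word w) * fa_word v = sc a * fa_word (u @ w @ v)"
    by (simp add: fa_word_append mult.assoc sc_left_commute[of "fa_word u"])
  then have "clear K (fa_word u * (sc a * fa_word w) * fa_word v) =
      sc a * (fa_word (strip (u @ w @ v)) * qD n ^ (K - nones (u @ w @ v)))"
    by (simp only: clear_def lin_sc lin_word)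
  then have "clear K (fa_word u * (sc a * fa_word w) * fa_word v) =
      sc a * (fa_word (strip u) * fa_word (strip w) * (fa_word (strip v) * ?P))"
    by (simp add: fa_word_append mult.assoc diff_diff_eq add.assoc add.commute[of "nones v"])
  moreover have "fa_word (strip u) * clear (K - (nones u + nones v)) (sc a * fa_word w) * fa_word (strip v) =
      sc a * (fa_word (strip u) * fa_word (strip w) * (?P * fa_word (strip v)))"
    by (simp add: clear_def lin_sc mult.assoc sc_left_commute[of "fa_word (strip u)"])
  ultimately have "clear K (fa_word u * (sc a * fa_word w) * fa_word v) -
     fa_word (strip u) * clear (K - (nones u + nones v)) (sc a * fa_word w) * fa_word (strip v) =
     sc a * (fa_word (strip u) * fa_word (strip w) * (fa_word (strip v) * ?P - ?P * fa_word (strip v)))"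
    by (simp add: right_diff_distrib)
  also have "\<dots> \<in> J"
    using strip_idx[OF uv(1)] strip_idx[OF uv(2)] strip_idx[OF word]
    by (intro fa_ideal_sc fa_ideal_mult_left[OF J_sym[OF power_commute]] fa_on_mult) simp_all
  finally show ?case .
qed (simp add: clear_def fa_ideal.zero)

text \<open>Clearing respects the relations only for large K: \<open>clear 0\<close> sends
  \<open>Dinv * DGL - 1\<close> to \<open>qD n - 1\<close>. Multiplication by words raises the bound
  by the number of their letters \<open>None\<close>.\<close>

lemma clear_JGL:
  assumes "x \<in> JGL"
  shows "\<exists>K0. \<forall>K\<ge>K0. clear K x \<in> J"
  using assms
proof induction
  case (gen s)
  then consider p where "p \<in> RM n q qi" "s = emb p" | "s = Dinv * DGL - 1" | "s = DGL * Dinv - 1"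
    unfolding RGL_eq by blast
  then show ?case
  proof cases
    case 1
    have "clear K s = p * qD n ^ K" for K using clear_emb[of K "[]" p "[]"] 1 by simp
    then show ?thesis using fa_ideal_mult_right[OF fa_ideal.gen[OF 1(1)] fa_on_power[OF qD_on]] by auto
  next
    case 2
    have one: "clear K 1 = qD n ^ K" for K using clear_emb[of K "[]" 1 "[]"] by (simp add: emb_1)
    have "clear K s = 0" if "K \<ge> 1" for K
    proof -
      have "clear K (Dinv * DGL) = qD n * qD n ^ (K - 1)"
        using clear_emb[of K "[None]" "qD n" "[]"] by (simp add: Dinv_word strip_def nones_def One_nat_def)
      also have "\<dots> = qD n ^ K" using that by (metis Suc_diff_1 less_le_trans power_Suc zero_less_one)
      finally show ?thesis using one unfolding 2 by (simp add: clear_def lin_diff)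
    qed
    then show ?thesis using fa_ideal.zero by metis
  next
    case 3
    have one: "clear K 1 = qD n ^ K" for K using clear_emb[of K "[]" 1 "[]"] by (simp add: emb_1)
    have "clear K s = 0" if "K \<ge> 1" for K
    proof -
      have "clear K (DGL * Dinv) = qD n * qD n ^ (K - 1)"
        using clear_emb[of K "[]" "qD n" "[None]"] by (simp add: Dinv_word strip_def nones_def One_nat_def)
      also have "\<dots> = qD n ^ K" using that by (metis Suc_diff_1 less_le_trans power_Suc zero_less_one)
      finally show ?thesis using one unfolding 3 by (simp add: clear_def lin_diff)
    qed
    then show ?thesis using fa_ideal.zero by metis
  qed
next
  case zero
  show ?case by (simp add: clear_def fa_ideal.zero)
next
  case (add x y)
  then obtain K0 K1 where "\<forall>K\<ge>K0. clear K x \<in> J" "\<forall>K\<ge>K1. clear K y \<in> J" by blast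
  then have "\<forall>K\<ge>max K0 K1. clear K (x + y) \<in> J"
    by (simp add: clear_def lin_add fa_ideal.add)
  then show ?case by blast
next
  case (mult x u v a)
  then obtain K0 where K0: "\<forall>K\<ge>K0. clear K x \<in> J" by blast
  let ?m = "nones u + nones v"
  have "clear K (fa_scal a (fa_mul (fa_word u) (fa_mul x (fa_word v)))) \<in> J" if K: "K \<ge> K0 + ?m" for K
  proof -
    have "clear (K - ?m) x \<in> J" using K0 K by simp
    then have "fa_word (strip u) * clear (K - ?m) x * fa_word (strip v) \<in> J"
      using strip_idx mult(2,3) by (intro fa_ideal_mult) simp_all
    from fa_ideal.add[OF clear_mult[OF mult(2,3) JGL_on[OF mult(1)], of K] this]
    have "clear K (fa_word u * x * fa_word v) \<in> J" by simp
    from fa_ideal_sc[OF this, of a] show ?thesis by (simp add: fa_simps clear_def lin_sc mult.assoc)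
  qed
  then show ?case by blast
qed

definition GLb :: "(nat \<times> nat \<Rightarrow> nat) \<times> int \<Rightarrow> ((nat \<times> nat) option, 'a) fralg" where
  "GLb = (\<lambda>(N, Z). fa_mul (monoGL n r N) (Dpow n q Z))"

lemma monoGL_emb: "monoGL n r N = emb (monoM n r N)"
  by (simp add: monoGL_def monoM_def emb_word)

lemma Dpow_eq: "Dpow n q Z = (if 0 \<le> Z then DGL ^ nat Z else Dinv ^ nat (- Z))"
  by (simp add: Dpow_def fa_pow_eq qdet_Some)

lemma Dinv_power: "Dinv ^ m = fa_word (replicate m None)"
  by (induction m) (simp_all add: Dinv_word flip: fa_word_append)

lemma clear_GLb:
  assumes "0 \<le> Z + int K"
  shows "clear K (GLb (N, Z)) = MD (N, nat (Z + int K))"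
proof (cases "0 \<le> Z")
  case True
  have "GLb (N, Z) = emb (monoM n r N * qD n ^ nat Z)"
    using True by (simp add: GLb_def fa_mul_eq Dpow_eq monoGL_emb emb_mult emb_power)
  then have "clear K (GLb (N, Z)) = monoM n r N * qD n ^ nat Z * qD n ^ K"
    using clear_emb[of K "[]" "monoM n r N * qD n ^ nat Z" "[]"] by simp
  moreover have "nat (Z + int K) = nat Z + K" using True by simp
  ultimately show ?thesis by (simp add: MD_def power_add mult.assoc)
next
  case False
  have "GLb (N, Z) = emb (monoM n r N) * fa_word (replicate (nat (- Z)) None)"
    using False by (simp add: GLb_def fa_mul_eq Dpow_eq monoGL_emb Dinv_power)
  then have "clear K (GLb (N, Z)) = monoM n r N * qD n ^ (K - nat (- Z))"
    using clear_emb[of K "[]" "monoM n r N" "replicate (nat (- Z)) None"] by simp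
  moreover have "nat (Z + int K) = K - nat (- Z)" using False assms by simp
  ultimately show ?thesis by (simp add: MD_def)
qed

lemma GLb_on: "GLb x \<in> fa_on (GGL n)"
  by (cases x) (auto simp: GLb_def fa_mul_eq monoGL_emb Dpow_eq intro!: fa_on_mult fa_on_power emb_on monoM_on DGL_on Dinv_on)

lemma Dinv_DGL: "Dinv * DGL - 1 \<in> JGL" "DGL * Dinv - 1 \<in> JGL"
  by (rule fa_ideal.gen, simp add: RGL_eq)+

lemma Dinv_commute:
  assumes x: "x \<in> fa_on (idx n)"
  shows "Dinv * emb x - emb x * Dinv \<in> JGL"
proof -
  have "emb (qD n * x - x * qD n) \<in> JGL" by (rule J_JGL[OF qD_commute[OF x]])
  then have comm: "DGL * emb x - emb x * DGL \<in> JGL" by (simp add: emb_diff emb_mult)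
  \<comment> \<open>The commutator of D with x, multiplied by \<open>Dinv\<close> on both sides, is
    up to sign the wanted one, apart from multiples of the two inverse relations.\<close>
  have "Dinv * emb x - emb x * Dinv =
     (Dinv * DGL - 1) * (emb x * Dinv) - Dinv * emb x * (DGL * Dinv - 1) - Dinv * (DGL * emb x - emb x * DGL) * Dinv"
    by (simp add: algebra_simps)
  also have "\<dots> \<in> JGL"
    by (intro fa_ideal_diff fa_ideal_mult fa_ideal_mult_left[OF Dinv_DGL(2)] fa_ideal_mult_right[OF Dinv_DGL(1)]
        comm fa_on_mult emb_on x Dinv_on)
  finally show ?thesis .
qed

lemma GL_trans: "x - y \<in> JGL \<Longrightarrow> y - z \<in> JGL \<Longrightarrow> x - z \<in> JGL"
  using fa_ideal.add[of "x - y" _ _ "y - z"] by simp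

lemma word_strip:
  assumes "set w \<subseteq> GGL n"
  shows "fa_word w - emb (fa_word (strip w)) * Dinv ^ nones w \<in> JGL"
  using assms
proof (induction w)
  case (Cons a w)
  let ?x = "fa_word (strip w)" and ?k = "nones w"
  have IH: "fa_word w - emb ?x * Dinv ^ ?k \<in> JGL" using Cons by simp
  have xon: "?x \<in> fa_on (idx n)" using strip_idx[of w] Cons.prems by simp
  have aon: "fa_word [a] \<in> fa_on (GGL n)" using Cons.prems by simp
  have 1: "fa_word (a # w) - fa_word [a] * (emb ?x * Dinv ^ ?k) \<in> JGL"
    using fa_ideal_mult_left[OF IH aon] by (simp add: right_diff_distrib flip: fa_word_append)
  show ?case
  proof (cases a)
    case (Some b)
    then have "strip (a # w) = b # strip w" "nones (a # w) = ?k" by (simp_all add: strip_def nones_def)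
    moreover have "emb (fa_word (b # strip w)) = fa_word [a] * emb ?x"
      unfolding emb_word using Some fa_word_Cons[of "Some b" "map Some (strip w)"] by (simp only: list.map)
    ultimately show ?thesis using 1 by (simp only: mult.assoc)
  next
    case None
    have "(Dinv * emb ?x - emb ?x * Dinv) * Dinv ^ ?k \<in> JGL"
      by (intro fa_ideal_mult_right Dinv_commute xon fa_on_power Dinv_on)
    then have "fa_word [a] * (emb ?x * Dinv ^ ?k) - emb (fa_word (strip (a # w))) * Dinv ^ nones (a # w) \<in> JGL"
      using None by (simp add: strip_def nones_def Dinv_word left_diff_distrib mult.assoc)
    with 1 show ?thesis by (rule GL_trans)
  qed
qed (simp add: emb_1 fa_ideal.zero)

lemma DGL_Dinv_power: "DGL ^ j * Dinv ^ k - Dpow n q (int j - int k) \<in> JGL"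
proof (induction j arbitrary: k)
  case 0
  show ?case by (cases "k = 0") (simp_all add: Dpow_eq fa_ideal.zero)
next
  case (Suc j)
  show ?case
  proof (cases k)
    case 0
    have "nat (1 + int j) = Suc j" by simp
    then show ?thesis using 0 by (simp add: Dpow_eq fa_ideal.zero)
  next
    case (Suc m)
    have "DGL ^ j * (DGL * Dinv - 1) * Dinv ^ m \<in> JGL"
      by (intro fa_ideal_mult Dinv_DGL fa_on_power DGL_on Dinv_on)
    then have "DGL ^ Suc j * Dinv ^ k - DGL ^ j * Dinv ^ m \<in> JGL"
      unfolding Suc power_Suc2[of DGL] power_Suc[of Dinv]
      by (simp only: left_diff_distrib right_diff_distrib mult.assoc mult_1 mult_1_right)
    from GL_trans[OF this Suc.IH[of m]] show ?thesis using Suc by simp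
  qed
qed

lemma lspan_emb:
  assumes "x \<in> lspan (J \<union> X)"
  shows "emb x \<in> lspan (JGL \<union> emb ` X)"
  using assms
proof induction
  case (step x y a)
  then have "emb x \<in> lspan (JGL \<union> emb ` X)" by (intro lspan_base) (auto intro: J_JGL)
  then show ?case using step unfolding emb_add emb_sc by (intro lspan_add lspan_sc)
qed (simp add: emb_0 lspan.zero)

text \<open>For spanning, collect the letters \<open>None\<close> at the right, expand the rest in
  \<open>MD\<close>, and cancel powers of D. For independence, multiply a relation by a high power
  of D: distinct members become distinct members of \<open>MD\<close>.\<close>

theorem GL_basis: "pres_basis (GGL n) (RGL n q qi) GLb (expo0 \<times> UNIV)"
proof (rule pres_basisI)
  show "GLb x \<in> fa_on (GGL n)" for x by (rule GLb_on)
next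
  fix p :: "((nat \<times> nat) option, 'a) fralg" assume "p \<in> fa_on (GGL n)"
  then show "p \<in> lspan (JGL \<union> GLb ` (expo0 \<times> UNIV))"
  proof (induction rule: fa_on_induct)
    case (word a w)
    let ?Y = "JGL \<union> GLb ` (expo0 \<times> UNIV)"
    have "fa_word (strip w) \<in> lspan (J \<union> MD ` (expo0 \<times> UNIV))"
      using pres_basis_span[OF MD_basis, of "fa_word (strip w)"] strip_idx[OF word] by (simp add: GM_def)
    from lspan_emb[OF this]
    have *: "emb (fa_word (strip w)) \<in> lspan (JGL \<union> emb ` MD ` (expo0 \<times> UNIV))" .
    have "1 * emb (fa_word (strip w)) * Dinv ^ nones w \<in> lspan ?Y"
    proof (rule lspan_map[OF *])
      fix x assume x: "x \<in> JGL \<union> emb ` MD ` (expo0 \<times> UNIV)"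
      show "1 * x * Dinv ^ nones w \<in> lspan ?Y"
      proof (cases "x \<in> JGL")
        case True
        then have "x * Dinv ^ nones w \<in> JGL" by (rule fa_ideal_mult_right) (intro fa_on_power Dinv_on)
        then show ?thesis by (intro lspan_base) simp
      next
        case False
        then obtain N k where N: "N \<in> expo0" "x = emb (MD (N, k))" using x by blast
        let ?Z = "int k - int (nones w)"
        have "monoGL n r N * (DGL ^ k * Dinv ^ nones w - Dpow n q ?Z) \<in> JGL"
          by (intro fa_ideal_mult_left DGL_Dinv_power) (simp add: monoGL_emb emb_on monoM_on)
        then have "1 * x * Dinv ^ nones w - GLb (N, ?Z) \<in> JGL"
          by (simp add: N MD_def GLb_def fa_mul_eq monoGL_emb emb_mult emb_power right_diff_distrib mult.assoc)
        moreover have "GLb (N, ?Z) \<in> lspan ?Y" by (rule lspan_base) (use N in blast)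
        ultimately have "(1 * x * Dinv ^ nones w - GLb (N, ?Z)) + GLb (N, ?Z) \<in> lspan ?Y"
          by (intro lspan_add) (auto intro: lspan_base)
        then show ?thesis by simp
      qed
    qed
    then have "(fa_word w - emb (fa_word (strip w)) * Dinv ^ nones w) + emb (fa_word (strip w)) * Dinv ^ nones w \<in> lspan ?Y"
      using word_strip[OF word] by (intro lspan_add) (auto intro: lspan_base)
    then show ?case by (simp add: lspan_sc)
  qed (auto intro: lspan.zero lspan_add)
next
  fix K a x
  assume K: "finite K" "K \<subseteq> expo0 \<times> UNIV" "(\<Sum>i\<in>K. sc (a i) * GLb i) \<in> JGL" "x \<in> K"
  obtain K0 where K0: "\<forall>k\<ge>K0. clear k (\<Sum>i\<in>K. sc (a i) * GLb i) \<in> J" using clear_JGL[OF K(3)] by blast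
  \<comment> \<open>\<open>K0\<close> makes the cleared relation fall into the ideal; the sum makes
    every shifted exponent nonnegative, so that no truncation occurs and the indices stay
    distinct.\<close>
  define k where "k = K0 + (\<Sum>i\<in>K. nat \<bar>snd i\<bar>)"
  have k: "0 \<le> snd i + int k" if "i \<in> K" for i
  proof -
    have "nat \<bar>snd i\<bar> \<le> (\<Sum>i\<in>K. nat \<bar>snd i\<bar>)" by (rule member_le_sum) (use that K in auto)
    then show ?thesis unfolding k_def by linarith
  qed
  define g where "g i = (fst i, nat (snd i + int k))" for i :: "(nat \<times> nat \<Rightarrow> nat) \<times> int"
  have inj: "inj_on g K"
  proof (rule inj_onI)
    fix i i' assume "i \<in> K" "i' \<in> K" "g i = g i'"
    then show "i = i'" using k[of i] k[of i'] by (auto simp: g_def prod_eq_iff)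
  qed
  have "clear k (\<Sum>i\<in>K. sc (a i) * GLb i) = (\<Sum>i\<in>K. sc (a i) * clear k (GLb i))"
    by (simp add: clear_def lin_sum lin_sc)
  also have "\<dots> = (\<Sum>i\<in>K. sc (a i) * MD (g i))"
    by (rule sum.cong) (use k clear_GLb in \<open>auto simp: g_def\<close>)
  also have "\<dots> = (\<Sum>j\<in>g ` K. sc (a (the_inv_into K g j)) * MD j)"
    unfolding sum.reindex[OF inj] by (rule sum.cong) (auto simp: the_inv_into_f_f[OF inj])
  finally have eq: "clear k (\<Sum>i\<in>K. sc (a i) * GLb i) = (\<Sum>j\<in>g ` K. sc (a (the_inv_into K g j)) * MD j)" .
  have "K0 \<le> k" unfolding k_def by simp
  with K0 have "clear k (\<Sum>i\<in>K. sc (a i) * GLb i) \<in> J" by blast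
  then have "(\<Sum>j\<in>g ` K. sc (a (the_inv_into K g j)) * MD j) \<in> fa_ideal (GM n) (RM n q qi)"
    unfolding eq GM_def .
  moreover have "g ` K \<subseteq> expo0 \<times> UNIV" unfolding g_def using K(2) by force
  ultimately have "a (the_inv_into K g (g x)) = 0"
    using pres_basis_indep[OF MD_basis, of "g ` K" "\<lambda>j. a (the_inv_into K g j)" "g x"] K(1,4) by simp
  then show "a x = 0" using K(4) by (simp add: the_inv_into_f_f[OF inj])
qed

text \<open>Compared with \<open>GL_basis\<close>. For k > 0 the members are those with Z = -k. For
  k = 0 the monomial N corresponds to the remainder of N with the power \<open>mn N\<close> of D, to
  which it is related triangularly.\<close>

theorem GL_basis_wedge:
  "pres_basis (GGL n) (RGL n q qi) (\<lambda>(N, k). fa_mul (monoGL n r N) (fa_pow Dinv k))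
     {(N, k). N \<in> expo n \<and> (k = 0 \<or> mn N = 0)}"
proof (rule triangular_basis[OF GL_basis, where
    \<phi> = "\<lambda>(N, k). if k = 0 then (unshift N, int (mn N)) else (N, - int k)" and
    \<mu> = "\<lambda>(N, Z). if 0 \<le> Z then \<mu> (shift N (nat Z)) else 0"])
  let ?I = "{(N, k). N \<in> expo n \<and> (k = 0 \<or> mn N = 0)}"
  let ?\<phi> = "\<lambda>(N, k). if k = 0 then (unshift N, int (mn N)) else (N, - int k)"
  \<comment> \<open>The value 0 for negative Z is harmless, because there the two families coincide
    and no correction terms have to be bounded.\<close>
  let ?\<mu> = "\<lambda>(N, Z). if 0 \<le> Z then \<mu> (shift N (nat Z)) else 0"
  show "((\<lambda>(N, k). fa_mul (monoGL n r N) (fa_pow Dinv k)) i :: ((nat \<times> nat) option, 'a) fralg) \<in> fa_on (GGL n)" for i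
    by (cases i) (auto simp: fa_mul_eq fa_pow_eq monoGL_emb intro!: fa_on_mult fa_on_power emb_on monoM_on Dinv_on)
  show "bij_betw ?\<phi> ?I (expo0 \<times> UNIV)"
  proof (rule bij_betwI[where g = "\<lambda>(N, Z). if 0 \<le> Z then (shift N (nat Z), 0) else (N, nat (- Z))"])
    show "?\<phi> \<in> ?I \<rightarrow> expo0 \<times> UNIV" by (auto intro: unshift_expo mn_unshift)
    show "(\<lambda>(N, Z). if 0 \<le> Z then (shift N (nat Z), 0) else (N, nat (- Z))) \<in> expo0 \<times> UNIV \<rightarrow> ?I"
      by (auto intro: shift_expo split: if_splits)
  qed (auto simp: shift_unshift unshift_shift mn_shift shift_0 unshift_eq)
  show "\<exists>u u'. u' * u = 1 \<and> (\<lambda>(N, k). fa_mul (monoGL n r N) (fa_pow Dinv k)) i - sc u * GLb (?\<phi> i)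
     \<in> lspan (JGL \<union> GLb ` {j \<in> expo0 \<times> UNIV. ?\<mu> j < ?\<mu> (?\<phi> i)})" if "i \<in> ?I" for i
  proof -
    obtain N k where i: "i = (N, k)" by (cases i)
    with that have N: "N \<in> expo n" by simp
    show ?thesis
    proof (cases "k = 0")
      case False
      then show ?thesis
        by (intro exI[of _ 1]) (simp add: i GLb_def fa_mul_eq fa_pow_eq Dpow_eq lspan.zero)
    next
      case True
      let ?N0 = "unshift N" and ?z = "mn N"
      let ?X = "JGL \<union> GLb ` {j \<in> expo0 \<times> UNIV. ?\<mu> j < \<mu> N}"
      have "(?N0, ?z) \<in> expo0 \<times> UNIV" using N unshift_expo mn_unshift by simp
      from MD_triangular[OF this] obtain u u' where u: "u' * u = 1"
        "MD (?N0, ?z) - sc u * monoM n r N \<in> lspan (J \<union> monoM n r ` {N' \<in> expo n. \<mu> N' < \<mu> N})"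
        by (auto simp: shift_unshift)
      \<comment> \<open>The corrections are given as monomials; \<open>triangular_span\<close>
        rewrites them in \<open>MD\<close> without raising the weight.\<close>
      have "MD (?N0, ?z) - sc u * monoM n r N \<in> lspan (J \<union> MD ` {j \<in> expo0 \<times> UNIV. \<mu> ((\<lambda>(N, k). shift N k) j) < \<mu> N})"
      proof (rule lspan_minimal[OF u(2)])
        fix x assume x: "x \<in> J \<union> monoM n r ` {N' \<in> expo n. \<mu> N' < \<mu> N}"
        show "x \<in> lspan (J \<union> MD ` {j \<in> expo0 \<times> UNIV. \<mu> ((\<lambda>(N, k). shift N k) j) < \<mu> N})"
        proof (cases "x \<in> J")
          case False
          then obtain N' where N': "x = monoM n r N'" "N' \<in> expo n" "\<mu> N' < \<mu> N" using x by blast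
          have "monoM n r N' \<in> lspan (J \<union> MD ` {j \<in> expo0 \<times> UNIV. \<mu> ((\<lambda>(N, k). shift N k) j) \<le> \<mu> N'})"
            by (rule triangular_span[OF bij_shift MD_triangular N'(2)])
          then show ?thesis unfolding N'(1) by (rule lspan_mono) (use N'(3) in auto)
        qed (simp add: lspan_base)
      qed
      from lspan_emb[OF this]
      have "emb (MD (?N0, ?z)) - sc u * emb (monoM n r N) \<in> lspan ?X"
        unfolding emb_diff emb_sc
      proof (rule lspan_mono)
        have "emb (MD (N, k)) = GLb (N, int k)" for N k
          by (simp add: MD_def GLb_def fa_mul_eq Dpow_eq monoGL_emb emb_mult emb_power)
        then show "JGL \<union> emb ` MD ` {j \<in> expo0 \<times> UNIV. \<mu> ((\<lambda>(N, k). shift N k) j) < \<mu> N} \<subseteq> ?X"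
          by (force simp: image_iff)
      qed
      from lspan_sc[OF lspan_uminus[OF this], of u']
      have "emb (monoM n r N) - sc u' * emb (MD (?N0, ?z)) \<in> lspan ?X"
        using u(1) by (simp add: right_diff_distrib flip: mult.assoc sc_mult)
      moreover have "u * u' = 1" using u(1) by (simp add: mult.commute)
      moreover have "GLb (?N0, int ?z) = emb (MD (?N0, ?z))"
        by (simp add: MD_def GLb_def fa_mul_eq Dpow_eq monoGL_emb emb_mult emb_power)
      ultimately show ?thesis using True
        by (intro exI[of _ u'] exI[of _ u]) (simp add: i shift_unshift monoGL_emb fa_mul_eq fa_pow_eq)
    qed
  qed
qed

section \<open>The index sets as conditions on minima\<close>

lemma wedge_index: "{(N, k). N \<in> expo n \<and> Min ({N (i, f i) | i. i \<in> {1..n}} \<union> {k}) = 0} =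
   {(N, k). N \<in> expo n \<and> (k = 0 \<or> mn N = 0)}"
proof -
  have "Min ({N (i, f i) | i. i \<in> {1..n}} \<union> {k}) = min (mn N) k" for N :: "nat \<times> nat \<Rightarrow> nat" and k
    unfolding mn_def by (subst Min_Un[OF finite_diag diag_ne]) simp_all
  then show ?thesis by (auto simp: min_def split: if_splits)
qed

lemma vee_index: "{(N, Z). N \<in> expo n \<and> Min {N (i, f i) | i. i \<in> {1..n}} = 0} = expo0 \<times> UNIV"
  by (auto simp: mn_def)

lemma three_bases:
  "pres_basis (GGL n) (RGL n q qi) (\<lambda>(N, k). fa_mul (monoGL n r N) (fa_pow Dinv k))
     {(N, k). N \<in> expo n \<and> Min ({N (i, f i) | i. i \<in> {1..n}} \<union> {k}) = 0}
   \<and> pres_basis (GGL n) (RGL n q qi) (\<lambda>(N, Z). fa_mul (monoGL n r N) (Dpow n q Z))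
     {(N, Z). N \<in> expo n \<and> Min {N (i, f i) | i. i \<in> {1..n}} = 0}
   \<and> pres_basis (GSL n) (RSL n q qi) (monoM n r)
     {N. N \<in> expo n \<and> Min {N (i, f i) | i. i \<in> {1..n}} = 0}"
  unfolding wedge_index vee_index unfolding GLb_def[symmetric] mn_def[symmetric]
  using GL_basis_wedge GL_basis SL_basis by blast

end

theorem theorem2p1:
  fixes q qi :: "'a::comm_ring_1" and n :: nat
  assumes n: "1 \<le> n"
    and q_inv: "q * qi = 1"
    and not_inv: "\<not> (\<exists>x\<in>gen_subring {q, qi}. (q - 1) * x = 1)"
  shows
    "(\<forall>r. linear_order_on (idx n) r \<longrightarrow>
        pres_basis (GM n) (RM n q qi) (monoM n r) (expo n)
      \<and> pres_basis (GGL n) (RGL n q qi)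
          (\<lambda>(N, k). fa_mul (monoGL n r N) (fa_pow Dinv k))
          {(N, k). N \<in> expo n \<and> Min ({N (i, i) | i. i \<in> {1..n}} \<union> {k}) = 0}
      \<and> pres_basis (GGL n) (RGL n q qi)
          (\<lambda>(N, Z). fa_mul (monoGL n r N) (Dpow n q Z))
          {(N, Z). N \<in> expo n \<and> Min {N (i, i) | i. i \<in> {1..n}} = 0}
      \<and> pres_basis (GSL n) (RSL n q qi) (monoM n r)
          {N. N \<in> expo n \<and> Min {N (i, i) | i. i \<in> {1..n}} = 0})
   \<and>
    (\<forall>r. linear_order_on (idx n) r \<longrightarrow>
        (\<forall>i j h k l m. i \<in> {1..n} \<and> j \<in> {1..n} \<and> h \<in> {1..n} \<and> k \<in> {1..n}
             \<and> l \<in> {1..n} \<and> m \<in> {1..n} \<and> j > n + 1 - i \<and> k = n + 1 - h \<and> m < n + 1 - l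
           \<longrightarrow> ((i, j), (h, k)) \<in> r \<and> ((h, k), (l, m)) \<in> r) \<longrightarrow>
        pres_basis (GGL n) (RGL n q qi)
          (\<lambda>(N, k). fa_mul (monoGL n r N) (fa_pow Dinv k))
          {(N, k). N \<in> expo n \<and> Min ({N (i, n + 1 - i) | i. i \<in> {1..n}} \<union> {k}) = 0}
      \<and> pres_basis (GGL n) (RGL n q qi)
          (\<lambda>(N, Z). fa_mul (monoGL n r N) (Dpow n q Z))
          {(N, Z). N \<in> expo n \<and> Min {N (i, n + 1 - i) | i. i \<in> {1..n}} = 0}
      \<and> pres_basis (GSL n) (RSL n q qi) (monoM n r)
          {N. N \<in> expo n \<and> Min {N (i, n + 1 - i) | i. i \<in> {1..n}} = 0})"
proof (intro conjI allI impI)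
  fix r :: "(nat \<times> nat) rel" assume r: "linear_order_on (idx n) r"
  interpret ordered_quantum_matrices q qi n r
    by unfold_locales (rule q_inv r)+
  show "pres_basis (GM n) (RM n q qi) (monoM n r) (expo n)" by (rule monoM_basis)
  \<comment> \<open>Part (a): the leading letters are diagonal, and each factor D adds the weight of
    the diagonal monomial.\<close>
  interpret determinant_basis q qi n r "\<lambda>i. i" "\<lambda>N. stat (mw N)" "stat (zip [1..<Suc n] [1..<Suc n])"
    by unfold_locales (rule n, assumption, rule leading_diagonal)
  note three = three_bases
  show "pres_basis (GGL n) (RGL n q qi) (\<lambda>(N, k). fa_mul (monoGL n r N) (fa_pow Dinv k))
      {(N, k). N \<in> expo n \<and> Min ({N (i, i) | i. i \<in> {1..n}} \<union> {k}) = 0}"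
    and "pres_basis (GGL n) (RGL n q qi) (\<lambda>(N, Z). fa_mul (monoGL n r N) (Dpow n q Z))
      {(N, Z). N \<in> expo n \<and> Min {N (i, i) | i. i \<in> {1..n}} = 0}"
    and "pres_basis (GSL n) (RSL n q qi) (monoM n r) {N. N \<in> expo n \<and> Min {N (i, i) | i. i \<in> {1..n}} = 0}"
    using three by blast+
next
  fix r :: "(nat \<times> nat) rel"
  assume r: "linear_order_on (idx n) r"
    and order: "\<forall>i j h k l m. i \<in> {1..n} \<and> j \<in> {1..n} \<and> h \<in> {1..n} \<and> k \<in> {1..n}
             \<and> l \<in> {1..n} \<and> m \<in> {1..n} \<and> j > n + 1 - i \<and> k = n + 1 - h \<and> m < n + 1 - l
           \<longrightarrow> ((i, j), (h, k)) \<in> r \<and> ((h, k), (l, m)) \<in> r"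
  interpret antidiagonal_order q qi n r
    by unfold_locales (use q_inv r n order in blast)+
  \<comment> \<open>Part (b): the leading letters are antidiagonal, and each factor D raises the
    count by n.\<close>
  interpret determinant_basis q qi n r "\<lambda>i. n + 1 - i" anti_count n
    by unfold_locales (rule n, simp, linarith, rule leading_antidiagonal)
  note three = three_bases
  show "pres_basis (GGL n) (RGL n q qi) (\<lambda>(N, k). fa_mul (monoGL n r N) (fa_pow Dinv k))
      {(N, k). N \<in> expo n \<and> Min ({N (i, n + 1 - i) | i. i \<in> {1..n}} \<union> {k}) = 0}"
    and "pres_basis (GGL n) (RGL n q qi) (\<lambda>(N, Z). fa_mul (monoGL n r N) (Dpow n q Z))
      {(N, Z). N \<in> expo n \<and> Min {N (i, n + 1 - i) | i. i \<in> {1..n}} = 0}"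
    and "pres_basis (GSL n) (RSL n q qi) (monoM n r) {N. N \<in> expo n \<and> Min {N (i, n + 1 - i) | i. i \<in> {1..n}} = 0}"
    using three by blast+
qed

end
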